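(* Let $n\ge 1$ be an integer, let $\alpha,\beta\in\mathbb{R}$ be arbitrary, and let $H=H_2+H_3+H_4$ be the Hamiltonian of the Fermi-Pasta-Ulam lattice with fixed endpoints and $n$ moving particles, in the coordinates $(Q,P)$ on $T^*\mathbb{R}^n$. Then $H$ has a quartic Birkhoff normal form of the form $\overline{H}=H_2+\overline{H}_4$ (that is, a Birkhoff normal form of order $4$ with $\overline{H}_3=0$), and $\overline{H}$ is Liouville integrable with integrals the linear energies $E_k=\tfrac12(P_k^2+\Omega_k^2Q_k^2)$, $1\le k\le n$; i.e. the functions $E_1,\dots,E_n$ Poisson commute with each other and $\{\overline{H},E_k\}=0$ for all $1\le k\le n$.
   Context: Setting: let $N=2n+2$ and $W(x)=\frac{1}{2!}x^2+\frac{\alpha}{3!}x^3+\frac{\beta}{4!}x^4$. The periodic FPU lattice with $N$ particles has Hamiltonian $\sum_{j\in\mathbb{Z}/N\mathbb{Z}}\left[\frac12p_j^2+W(q_{j+1}-q_j)\right]$ on $T^*\mathbb{R}^N$. The lattice with fixed endpoints ($q_0=q_{n+1}=0$) and $n$ moving particles is identified with the invariant symplectic subspace $\{q_j=-q_{N-j},\ p_j=-p_{N-j}\ \forall j\}$ of this periodic lattice, with symplectic form and Hamiltonian restricted to it. On this subspace one uses the coordinates $(Q,P)=(Q_1,\dots,Q_n;P_1,\dots,P_n)$ given by $$q_j=\frac{1}{\sqrt{n+1}}\sum_{k=1}^n\sin\!\Big(\frac{jk\pi}{n+1}\Big)Q_k,\qquad p_j=\frac{1}{\sqrt{n+1}}\sum_{k=1}^n\sin\!\Big(\frac{jk\pi}{n+1}\Big)P_k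 .$$ In these coordinates the restricted symplectic form is $\sum_{k=1}^n dQ_k\wedge dP_k$. With $\Omega_k=2\sin\big(\frac{k\pi}{2n+2}\big)$ the Hamiltonian is $H=H_2+H_3+H_4$, where $$H_2=\sum_{k=1}^n\tfrac12(P_k^2+\Omega_k^2Q_k^2),\quad H_3=\frac{\alpha}{3!}\sum_{j\in\mathbb{Z}/N\mathbb{Z}}(q_{j+1}-q_j)^3,\quad H_4=\frac{\beta}{4!}\sum_{j\in\mathbb{Z}/N\mathbb{Z}}(q_{j+1}-q_j)^4,$$ the $q_j$ being expressed in terms of $Q$ by $q_j=\frac{1}{\sqrt{n+1}}\sum_{k=1}^n\sin\big(\frac{jk\pi}{n+1}\big)Q_k$. Poisson bracket: $\{F,G\}=\sum_{k=1}^n\left(\frac{\partial F}{\partial Q_k}\frac{\partial G}{\partial P_k}-\frac{\partial F}{\partial P_k}\frac{\partial G}{\partial Q_k}\right)$. Birkhoff normal form: a Birkhoff normal form of order $s$ of $H$ (quartic if $s=4$) is a polynomial $\overline{H}=H_2+\overline{H}_3+\dots+\overline{H}_s$, with $\overline{H}_r$ a homogeneous polynomial of degree $r$ in $(Q,P)$ and $\{H_2,\overline{H}_r\}=0$ for $3\le r\le s$, for which there exist an open neighbourhood $U$ of $0$ in $T^*\mathbb{R}^n$ and a symplectic diffeomorphism $\Phi$ from $U$ onto its image in $T^*\mathbb{R}^n$ with $\Phi(0)=0$, $D\Phi(0)=\mathrm{Id}$ and $H\circ\Phi=\overline{H}+\mathcal{O}(\|(Q,P)\|^{s+1})$. *)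

theory Defs
  imports "HOL-Analysis.Analysis" "HOL-Library.Landau_Symbols"
begin

section \<open>Symplectic geometry of the phase space\<close>

text \<open>The phase space \<open>T\<^sup>*\<real>\<^sup>n\<close> with points \<open>(Q, P)\<close>, where \<open>n = CARD('n)\<close>.\<close>

type_synonym 'n phase = "(real ^ 'n) \<times> (real ^ 'n)"

definition symplectic_form :: "'n::finite phase \<Rightarrow> 'n phase \<Rightarrow> real" where
  "symplectic_form u v = (\<Sum>i\<in>UNIV. fst u $ i * snd v $ i - snd u $ i * fst v $ i)"

definition partial_Q :: "'n::finite \<Rightarrow> ('n phase \<Rightarrow> real) \<Rightarrow> 'n phase \<Rightarrow> real" where
  "partial_Q i F z = frechet_derivative F (at z) (axis i 1, 0)"

definition partial_P :: "'n::finite \<Rightarrow> ('n phase \<Rightarrow> real) \<Rightarrow> 'n phase \<Rightarrow> real" where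
  "partial_P i F z = frechet_derivative F (at z) (0, axis i 1)"

definition poisson_bracket ::
    "('n::finite phase \<Rightarrow> real) \<Rightarrow> ('n phase \<Rightarrow> real) \<Rightarrow> 'n phase \<Rightarrow> real" where
  "poisson_bracket F G z =
     (\<Sum>i\<in>UNIV. partial_Q i F z * partial_P i G z - partial_P i F z * partial_Q i G z)"

text \<open>The class \<open>C\<^sup>k\<close> on an open set \<open>S\<close> of a finite-dimensional space, by recursion on \<open>k\<close>
  through all directional derivatives. The definition is only meaningful for open \<open>S\<close>.\<close>

fun Ck_on :: "nat \<Rightarrow> 'a::euclidean_space set \<Rightarrow> ('a \<Rightarrow> 'b::real_normed_vector) \<Rightarrow> bool" where
  "Ck_on 0 S f \<longleftrightarrow> continuous_on S f"
| "Ck_on (Suc k) S f \<longleftrightarrow> (\<forall>x\<in>S. f differentiable (at x)) \<and>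
     (\<forall>v. Ck_on k S (\<lambda>x. frechet_derivative f (at x) v))"

definition smooth_on :: "'a::euclidean_space set \<Rightarrow> ('a \<Rightarrow> 'b::real_normed_vector) \<Rightarrow> bool" where
  "smooth_on S f \<longleftrightarrow> (\<forall>k. Ck_on k S f)"

text \<open>Maps are total functions in HOL; only the values of \<open>\<Phi>\<close> on \<open>U\<close> matter here.\<close>

definition symplectic_diffeo :: "'n::finite phase set \<Rightarrow> ('n phase \<Rightarrow> 'n phase) \<Rightarrow> bool" where
  "symplectic_diffeo U \<Phi> \<longleftrightarrow>
     open U \<and> open (\<Phi> ` U) \<and> inj_on \<Phi> U \<and>
     smooth_on U \<Phi> \<and> smooth_on (\<Phi> ` U) (inv_into U \<Phi>) \<and>
     (\<forall>z\<in>U. \<forall>u v. symplectic_form (frechet_derivative \<Phi> (at z) u) (frechet_derivative \<Phi> (at z) v)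
                   = symplectic_form u v)"


section \<open>Birkhoff normal forms\<close>

text \<open>Polynomials in \<open>(Q, P)\<close> are identified with the functions they induce. Over the reals this
  loses nothing, and homogeneity can be read off from the function; the zero polynomial is
  homogeneous of every degree.\<close>

definition homogeneous_polynomial :: "nat \<Rightarrow> ('n::finite phase \<Rightarrow> real) \<Rightarrow> bool" where
  "homogeneous_polynomial r F \<longleftrightarrow>
     real_polynomial_function F \<and> (\<forall>c z. F (c *\<^sub>R z) = c ^ r * F z)"

text \<open>\<open>K\<close> is a Birkhoff normal form of order \<open>s\<close> of the Hamiltonian \<open>H\<close> with quadratic part \<open>H2\<close>;
  \<open>Kr r\<close> is the part of \<open>K\<close> of degree \<open>r\<close>.\<close>

definition birkhoff_normal_form ::
    "('n::finite phase \<Rightarrow> real) \<Rightarrow> ('n phase \<Rightarrow> real) \<Rightarrow> nat \<Rightarrow> ('n phase \<Rightarrow> real) \<Rightarrow> bool" where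
  "birkhoff_normal_form H2 H s K \<longleftrightarrow>
     (\<exists>Kr. K = (\<lambda>z. H2 z + (\<Sum>r=3..s. Kr r z)) \<and>
           (\<forall>r\<in>{3..s}. homogeneous_polynomial r (Kr r) \<and> (\<forall>z. poisson_bracket H2 (Kr r) z = 0))) \<and>
     (\<exists>U \<Phi>. 0 \<in> U \<and> symplectic_diffeo U \<Phi> \<and> \<Phi> 0 = 0 \<and> (\<Phi> has_derivative id) (at 0) \<and>
            (\<lambda>z. H (\<Phi> z) - K z) \<in> O[nhds 0](\<lambda>z. norm z ^ (s + 1)))"


section \<open>The FPU lattice with fixed endpoints\<close>

text \<open>The coordinates \<open>Q\<^sub>1, \<dots>, Q\<^sub>n\<close> are the components of a vector in \<open>real ^ 'n\<close>; a bijection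
  \<open>\<kappa> :: 'n \<Rightarrow> nat\<close> onto \<open>{1..n}\<close>, \<open>n = CARD('n)\<close>, attaches to every index its wave number.\<close>

definition Omega :: "('n::finite \<Rightarrow> nat) \<Rightarrow> 'n \<Rightarrow> real" where
  "Omega \<kappa> i = 2 * sin (real (\<kappa> i) * pi / (2 * real CARD('n) + 2))"

text \<open>\<open>mode_sum \<kappa> Q j\<close> is the position \<open>q\<^sub>j\<close> (and \<open>mode_sum \<kappa> P j\<close> the momentum \<open>p\<^sub>j\<close>). It is periodic
  in \<open>j\<close> with period \<open>N = 2n + 2\<close>, so sums over \<open>\<int>/N\<int>\<close> become sums over \<open>j < N\<close>.\<close>

definition mode_sum :: "('n::finite \<Rightarrow> nat) \<Rightarrow> real ^ 'n \<Rightarrow> nat \<Rightarrow> real" where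
  "mode_sum \<kappa> x j = 1 / sqrt (real CARD('n) + 1) *
     (\<Sum>i\<in>UNIV. sin (real j * real (\<kappa> i) * pi / (real CARD('n) + 1)) * x $ i)"

definition linear_energy :: "('n::finite \<Rightarrow> nat) \<Rightarrow> 'n \<Rightarrow> 'n phase \<Rightarrow> real" where
  "linear_energy \<kappa> i z = 1/2 * ((snd z $ i)\<^sup>2 + (Omega \<kappa> i)\<^sup>2 * (fst z $ i)\<^sup>2)"

definition fpu_H2 :: "('n::finite \<Rightarrow> nat) \<Rightarrow> 'n phase \<Rightarrow> real" where
  "fpu_H2 \<kappa> z = (\<Sum>i\<in>UNIV. linear_energy \<kappa> i z)"

definition fpu_H3 :: "real \<Rightarrow> ('n::finite \<Rightarrow> nat) \<Rightarrow> 'n phase \<Rightarrow> real" where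
  "fpu_H3 \<alpha> \<kappa> z = \<alpha> / fact 3 *
     (\<Sum>j<2 * CARD('n) + 2. (mode_sum \<kappa> (fst z) (j + 1) - mode_sum \<kappa> (fst z) j) ^ 3)"

definition fpu_H4 :: "real \<Rightarrow> ('n::finite \<Rightarrow> nat) \<Rightarrow> 'n phase \<Rightarrow> real" where
  "fpu_H4 \<beta> \<kappa> z = \<beta> / fact 4 *
     (\<Sum>j<2 * CARD('n) + 2. (mode_sum \<kappa> (fst z) (j + 1) - mode_sum \<kappa> (fst z) j) ^ 4)"

definition fpu_H :: "real \<Rightarrow> real \<Rightarrow> ('n::finite \<Rightarrow> nat) \<Rightarrow> 'n phase \<Rightarrow> real" where
  "fpu_H \<alpha> \<beta> \<kappa> z = fpu_H2 \<kappa> z + fpu_H3 \<alpha> \<kappa> z + fpu_H4 \<beta> \<kappa> z"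


subsection \<open>Agreement with the lattice Hamiltonian\<close>

text \<open>The remaining lemmas are not needed for any definition. They confirm that \<open>mode_sum\<close>
  parametrises the fixed-endpoint subspace of the periodic lattice, and that \<open>symplectic_form\<close> and
  \<open>fpu_H\<close> are the restrictions of the symplectic form and the Hamiltonian of that lattice.\<close>

definition fpu_W :: "real \<Rightarrow> real \<Rightarrow> real \<Rightarrow> real" where
  "fpu_W \<alpha> \<beta> x = 1 / fact 2 * x\<^sup>2 + \<alpha> / fact 3 * x ^ 3 + \<beta> / fact 4 * x ^ 4"

lemma mode_sum_periodic:
  "mode_sum (\<kappa> :: 'n::finite \<Rightarrow> nat) x (j + (2 * CARD('n) + 2)) = mode_sum \<kappa> x j"
proof -
  have "sin (real (j + (2 * CARD('n) + 2)) * real (\<kappa> i) * pi / (real CARD('n) + 1))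
      = sin (real j * real (\<kappa> i) * pi / (real CARD('n) + 1))" for i
  proof -
    have "real (j + (2 * CARD('n) + 2)) * real (\<kappa> i) * pi / (real CARD('n) + 1)
        = real j * real (\<kappa> i) * pi / (real CARD('n) + 1) + 2 * pi * real (\<kappa> i)"
      by (simp add: field_simps)
    then show ?thesis
      by (simp only: sin_add) (simp add: sin_integer_2pi cos_integer_2pi)
  qed
  then show ?thesis
    by (simp only: mode_sum_def)
qed

lemma mode_sum_odd:
  assumes "j \<le> 2 * CARD('n) + 2"
  shows "mode_sum (\<kappa> :: 'n::finite \<Rightarrow> nat) x (2 * CARD('n) + 2 - j) = - mode_sum \<kappa> x j"
proof -
  have "sin (real (2 * CARD('n) + 2 - j) * real (\<kappa> i) * pi / (real CARD('n) + 1))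
      = - sin (real j * real (\<kappa> i) * pi / (real CARD('n) + 1))" for i
  proof -
    have "real (2 * CARD('n) + 2 - j) * real (\<kappa> i) * pi / (real CARD('n) + 1)
        = 2 * pi * real (\<kappa> i) - real j * real (\<kappa> i) * pi / (real CARD('n) + 1)"
      using assms by (simp add: of_nat_diff field_simps)
    then show ?thesis
      by (simp add: sin_diff sin_integer_2pi cos_integer_2pi)
  qed
  then show ?thesis
    by (simp add: mode_sum_def sum_negf)
qed

lemma sum_cos_eq_0:
  fixes d :: real and N :: nat
  assumes "d \<in> \<int>" "d \<noteq> 0" "\<bar>d\<bar> < real N"
  shows "(\<Sum>j<N. cos (real j * (2 * pi * d / real N) + \<phi>)) = 0"
proof -
  define \<theta> where "\<theta> = 2 * pi * d / real N"
  have N: "real N > 0" using assms by linarith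
  have tele: "2 * sin (\<theta>/2) * (\<Sum>j<M. cos (real j * \<theta> + \<phi>))
      = sin (real M * \<theta> - \<theta>/2 + \<phi>) - sin (- \<theta>/2 + \<phi>)" for M
  proof (induction M)
    case (Suc M)
    have "2 * sin (\<theta>/2) * cos (real M * \<theta> + \<phi>)
        = sin (real M * \<theta> + \<phi> + \<theta>/2) - sin (real M * \<theta> + \<phi> - \<theta>/2)"
      by (simp add: sin_add sin_diff)
    then show ?case using Suc
      by (simp add: algebra_simps)
  qed simp
  have "real N * \<theta> = 2 * pi * d" using N by (simp add: \<theta>_def)
  moreover have "sin (2 * pi * d - \<theta>/2 + \<phi>) = sin (- \<theta>/2 + \<phi>)"
  proof -
    have "2 * pi * d - \<theta>/2 + \<phi> = (- \<theta>/2 + \<phi>) + 2 * pi * d" by simp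
    then show ?thesis
      by (simp only: sin_add) (simp add: sin_integer_2pi cos_integer_2pi assms)
  qed
  ultimately have "2 * sin (\<theta>/2) * (\<Sum>j<N. cos (real j * \<theta> + \<phi>)) = 0"
    using tele[of N] by simp
  moreover have "sin (\<theta>/2) \<noteq> 0"
  proof -
    have b: "\<theta>/2 = pi * (d / real N)" by (simp add: \<theta>_def)
    have "\<bar>d / real N\<bar> < 1" using assms N by simp
    then have "pi * (- 1) < \<theta>/2" "\<theta>/2 < pi * 1"
      unfolding b by (auto simp only: abs_less_iff intro!: mult_strict_left_mono pi_gt_zero)
    then have "- pi < \<theta>/2" "\<theta>/2 < pi" by simp_all
    moreover have "\<theta>/2 \<noteq> 0" unfolding b using assms N by simp
    ultimately show ?thesis using sin_eq_0_pi by blast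
  qed
  ultimately show ?thesis by (simp add: \<theta>_def)
qed

lemma sum_bilinear_orthogonal:
  fixes f :: "'n::finite \<Rightarrow> nat \<Rightarrow> real"
  assumes "\<And>i i'. (\<Sum>j<N. f i j * f i' j) = (if i = i' then M else 0)"
  shows "(\<Sum>j<N. (\<Sum>i\<in>UNIV. f i j * x i) * (\<Sum>i\<in>UNIV. f i j * y i)) = M * (\<Sum>i\<in>UNIV. x i * y i)"
proof -
  have "(\<Sum>j<N. (\<Sum>i\<in>UNIV. f i j * x i) * (\<Sum>i\<in>UNIV. f i j * y i))
      = (\<Sum>j<N. \<Sum>i\<in>UNIV. \<Sum>i'\<in>UNIV. x i * y i' * (f i j * f i' j))"
    by (simp add: sum_product mult_ac)
  also have "\<dots> = (\<Sum>i\<in>UNIV. \<Sum>j<N. \<Sum>i'\<in>UNIV. x i * y i' * (f i j * f i' j))"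
    by (rule sum.swap)
  also have "\<dots> = (\<Sum>i\<in>UNIV. \<Sum>i'\<in>UNIV. \<Sum>j<N. x i * y i' * (f i j * f i' j))"
    by (intro sum.cong refl sum.swap)
  also have "\<dots> = (\<Sum>i\<in>UNIV. \<Sum>i'\<in>UNIV. if i = i' then x i * y i' * M else 0)"
    by (intro sum.cong refl) (simp add: sum_distrib_left[symmetric] assms)
  also have "\<dots> = M * (\<Sum>i\<in>UNIV. x i * y i)"
    by (simp add: sum_distrib_left mult_ac)
  finally show ?thesis .
qed

context
  fixes \<kappa> :: "'n::finite \<Rightarrow> nat"
  assumes \<kappa>: "bij_betw \<kappa> UNIV {1..CARD('n)}"
begin

lemma wave_number_bounds: "1 \<le> \<kappa> i" "\<kappa> i \<le> CARD('n)"
  using bij_betwE[OF \<kappa>] by auto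

lemma wave_number_eq: "\<kappa> i = \<kappa> i' \<longleftrightarrow> i = i'"
  using \<kappa> by (auto simp: bij_betw_def inj_def)

lemma sum_cos_plus:
  "(\<Sum>j<2 * CARD('n) + 2. cos (real j * (real (\<kappa> i) + real (\<kappa> i')) * pi / (real CARD('n) + 1) + \<phi>)) = 0"
proof -
  have "(\<Sum>j<2 * CARD('n) + 2. cos (real j *
      (2 * pi * (real (\<kappa> i) + real (\<kappa> i')) / real (2 * CARD('n) + 2)) + \<phi>)) = 0"
    using wave_number_bounds[of i] wave_number_bounds[of i'] by (intro sum_cos_eq_0) auto
  moreover have "real j * (2 * pi * (real (\<kappa> i) + real (\<kappa> i')) / real (2 * CARD('n) + 2))
      = real j * (real (\<kappa> i) + real (\<kappa> i')) * pi / (real CARD('n) + 1)" for j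
    by (simp add: divide_simps)
  ultimately show ?thesis by (simp only:)
qed

lemma sum_cos_minus:
  "(\<Sum>j<2 * CARD('n) + 2. cos (real j * (real (\<kappa> i) - real (\<kappa> i')) * pi / (real CARD('n) + 1) + \<phi>))
    = (if i = i' then (2 * real CARD('n) + 2) * cos \<phi> else 0)"
proof (cases "i = i'")
  case False
  have "(\<Sum>j<2 * CARD('n) + 2. cos (real j *
      (2 * pi * (real (\<kappa> i) - real (\<kappa> i')) / real (2 * CARD('n) + 2)) + \<phi>)) = 0"
    using wave_number_bounds[of i] wave_number_bounds[of i'] False wave_number_eq[of i i']
    by (intro sum_cos_eq_0) auto
  moreover have "real j * (2 * pi * (real (\<kappa> i) - real (\<kappa> i')) / real (2 * CARD('n) + 2))
      = real j * (real (\<kappa> i) - real (\<kappa> i')) * pi / (real CARD('n) + 1)" for j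
    by (simp add: divide_simps)
  ultimately show ?thesis using False by (simp only: if_False)
qed simp

lemma sin_orthogonal:
  "(\<Sum>j<2 * CARD('n) + 2. sin (real j * real (\<kappa> i) * pi / (real CARD('n) + 1)) *
       sin (real j * real (\<kappa> i') * pi / (real CARD('n) + 1)))
    = (if i = i' then real CARD('n) + 1 else 0)"
proof -
  have "sin (real j * real (\<kappa> i) * pi / (real CARD('n) + 1)) *
        sin (real j * real (\<kappa> i') * pi / (real CARD('n) + 1))
      = 1/2 * cos (real j * (real (\<kappa> i) - real (\<kappa> i')) * pi / (real CARD('n) + 1) + 0)
      - 1/2 * cos (real j * (real (\<kappa> i) + real (\<kappa> i')) * pi / (real CARD('n) + 1) + 0)" for j
    by (simp add: sin_times_sin diff_divide_distrib add_divide_distrib algebra_simps)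
  then show ?thesis
    by (simp only: sum_subtractf sum_distrib_left[symmetric] sum_cos_plus sum_cos_minus) simp
qed

lemma cos_orthogonal:
  "(\<Sum>j<2 * CARD('n) + 2. cos ((2 * real j + 1) * real (\<kappa> i) * pi / (2 * real CARD('n) + 2)) *
       cos ((2 * real j + 1) * real (\<kappa> i') * pi / (2 * real CARD('n) + 2)))
    = (if i = i' then real CARD('n) + 1 else 0)"
proof -
  have "cos ((2 * real j + 1) * real (\<kappa> i) * pi / (2 * real CARD('n) + 2)) *
        cos ((2 * real j + 1) * real (\<kappa> i') * pi / (2 * real CARD('n) + 2))
      = 1/2 * cos (real j * (real (\<kappa> i) - real (\<kappa> i')) * pi / (real CARD('n) + 1)
                     + (real (\<kappa> i) - real (\<kappa> i')) * pi / (2 * real CARD('n) + 2))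
      + 1/2 * cos (real j * (real (\<kappa> i) + real (\<kappa> i')) * pi / (real CARD('n) + 1)
                     + (real (\<kappa> i) + real (\<kappa> i')) * pi / (2 * real CARD('n) + 2))" for j
  proof -
    have split: "(2 * real j + 1) * a * pi / (2 * real CARD('n) + 2)
        = real j * a * pi / (real CARD('n) + 1) + a * pi / (2 * real CARD('n) + 2)" for a
      by (simp add: divide_simps) (simp add: algebra_simps)
    have "cos A * cos B = 1/2 * cos (A - B) + 1/2 * cos (A + B)" for A B :: real
      by (simp add: cos_times_cos add_divide_distrib)
    moreover have "(2 * real j + 1) * a * pi / c - (2 * real j + 1) * b * pi / c
          = (2 * real j + 1) * (a - b) * pi / c"
        "(2 * real j + 1) * a * pi / c + (2 * real j + 1) * b * pi / c
          = (2 * real j + 1) * (a + b) * pi / c" for a b c :: real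
      by (simp_all add: algebra_simps add_divide_distrib diff_divide_distrib)
    ultimately show ?thesis
      by (simp only: split[symmetric])
  qed
  then show ?thesis
    by (simp only: sum.distrib sum_distrib_left[symmetric] sum_cos_plus sum_cos_minus) simp
qed

lemma mode_sum_inner:
  "(\<Sum>j<2 * CARD('n) + 2. mode_sum \<kappa> x j * mode_sum \<kappa> y j) = (\<Sum>i\<in>UNIV. x $ i * y $ i)"
proof -
  have s: "(1 / sqrt (real CARD('n) + 1) * a) * (1 / sqrt (real CARD('n) + 1) * b)
      = 1 / (real CARD('n) + 1) * (a * b)" for a b
    by simp
  have "(\<Sum>j<2 * CARD('n) + 2. mode_sum \<kappa> x j * mode_sum \<kappa> y j)
      = 1 / (real CARD('n) + 1) * (\<Sum>j<2 * CARD('n) + 2.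
         (\<Sum>i\<in>UNIV. sin (real j * real (\<kappa> i) * pi / (real CARD('n) + 1)) * x $ i) *
         (\<Sum>i\<in>UNIV. sin (real j * real (\<kappa> i) * pi / (real CARD('n) + 1)) * y $ i))"
    by (simp only: mode_sum_def s sum_distrib_left[symmetric])
  also have "\<dots> = (\<Sum>i\<in>UNIV. x $ i * y $ i)"
    by (subst sum_bilinear_orthogonal[OF sin_orthogonal]) (simp add: add_nonneg_eq_0_iff)
  finally show ?thesis .
qed

lemma mode_sum_diff:
  "mode_sum \<kappa> x (j + 1) - mode_sum \<kappa> x j = 1 / sqrt (real CARD('n) + 1) *
     (\<Sum>i\<in>UNIV. cos ((2 * real j + 1) * real (\<kappa> i) * pi / (2 * real CARD('n) + 2)) * (Omega \<kappa> i * x $ i))"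
proof -
  have "sin (real (j + 1) * real (\<kappa> i) * pi / (real CARD('n) + 1))
      - sin (real j * real (\<kappa> i) * pi / (real CARD('n) + 1))
      = cos ((2 * real j + 1) * real (\<kappa> i) * pi / (2 * real CARD('n) + 2)) * Omega \<kappa> i" for i
  proof -
    have a: "real (j + 1) * real (\<kappa> i) * pi / (real CARD('n) + 1)
        = (2 * real j + 1) * real (\<kappa> i) * pi / (2 * real CARD('n) + 2)
          + real (\<kappa> i) * pi / (2 * real CARD('n) + 2)"
      by (simp add: divide_simps) (simp add: algebra_simps)
    have b: "real j * real (\<kappa> i) * pi / (real CARD('n) + 1)
        = (2 * real j + 1) * real (\<kappa> i) * pi / (2 * real CARD('n) + 2)
          - real (\<kappa> i) * pi / (2 * real CARD('n) + 2)"
      by (simp add: divide_simps) (simp add: algebra_simps)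
    show ?thesis
      unfolding a b Omega_def by (simp only: sin_add sin_diff)
  qed
  then show ?thesis
    unfolding mode_sum_def right_diff_distrib[symmetric] sum_subtractf[symmetric]
      left_diff_distrib[symmetric] by (simp add: mult.assoc)
qed

lemma mode_sum_diff_inner:
  "(\<Sum>j<2 * CARD('n) + 2. (mode_sum \<kappa> x (j + 1) - mode_sum \<kappa> x j)\<^sup>2)
    = (\<Sum>i\<in>UNIV. (Omega \<kappa> i)\<^sup>2 * (x $ i)\<^sup>2)"
proof -
  have s: "(1 / sqrt (real CARD('n) + 1) * a) * (1 / sqrt (real CARD('n) + 1) * b)
      = 1 / (real CARD('n) + 1) * (a * b)" for a b
    by simp
  have "(\<Sum>j<2 * CARD('n) + 2. (mode_sum \<kappa> x (j + 1) - mode_sum \<kappa> x j)\<^sup>2)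
      = 1 / (real CARD('n) + 1) * (\<Sum>j<2 * CARD('n) + 2.
         (\<Sum>i\<in>UNIV. cos ((2 * real j + 1) * real (\<kappa> i) * pi / (2 * real CARD('n) + 2)) * (Omega \<kappa> i * x $ i)) *
         (\<Sum>i\<in>UNIV. cos ((2 * real j + 1) * real (\<kappa> i) * pi / (2 * real CARD('n) + 2)) * (Omega \<kappa> i * x $ i)))"
    by (simp only: mode_sum_diff power2_eq_square s sum_distrib_left[symmetric])
  also have "\<dots> = (\<Sum>i\<in>UNIV. (Omega \<kappa> i)\<^sup>2 * (x $ i)\<^sup>2)"
    by (subst sum_bilinear_orthogonal[OF cos_orthogonal])
      (simp add: add_nonneg_eq_0_iff power2_eq_square mult_ac)
  finally show ?thesis .
qed

lemma symplectic_form_eq_lattice: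
  "symplectic_form u v = (\<Sum>j<2 * CARD('n) + 2.
     mode_sum \<kappa> (fst u) j * mode_sum \<kappa> (snd v) j - mode_sum \<kappa> (snd u) j * mode_sum \<kappa> (fst v) j)"
  by (simp only: symplectic_form_def sum_subtractf mode_sum_inner)

lemma fpu_H_eq_lattice:
  "fpu_H \<alpha> \<beta> \<kappa> (Q, P) = (\<Sum>j<2 * CARD('n) + 2.
     1/2 * (mode_sum \<kappa> P j)\<^sup>2 + fpu_W \<alpha> \<beta> (mode_sum \<kappa> Q (j + 1) - mode_sum \<kappa> Q j))"
proof -
  have "(\<Sum>j<2 * CARD('n) + 2. 1/2 * (mode_sum \<kappa> P j)\<^sup>2) = (\<Sum>i\<in>UNIV. 1/2 * (P $ i)\<^sup>2)"
    using mode_sum_inner[of P P] by (simp only: power2_eq_square sum_distrib_left[symmetric])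
  moreover have "(\<Sum>j<2 * CARD('n) + 2. 1 / fact 2 * (mode_sum \<kappa> Q (j + 1) - mode_sum \<kappa> Q j)\<^sup>2)
      = (\<Sum>i\<in>UNIV. 1/2 * ((Omega \<kappa> i)\<^sup>2 * (Q $ i)\<^sup>2))"
    by (simp only: sum_distrib_left[symmetric] mode_sum_diff_inner fact_2)
  ultimately show ?thesis
    by (simp only: fpu_H_def fpu_H2_def linear_energy_def fpu_H3_def fpu_H4_def fpu_W_def sum.distrib
        sum_distrib_left[symmetric] distrib_left fst_conv snd_conv)
qed

end

end

theory Submission
  imports Defs
begin

text \<open>A product of three or four mode coordinates occurs in \<open>H\<^sub>3\<close> or \<open>H\<^sub>4\<close> only if some signed sum of
  its wave numbers is divisible by \<open>N = 2n + 2\<close>, and this selection rule survives Poisson brackets.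
  In the eigencoordinates \<open>P\<^sub>k \<plusminus> i \<Omega>\<^sub>k Q\<^sub>k\<close> the bracket with \<open>H\<^sub>2\<close> multiplies a monomial by \<open>i\<close> times the
  signed sum of its frequencies. So everything rests on the solutions of
  \<open>\<plusminus> \<Omega>\<^sub>k \<plusminus> \<Omega>\<^sub>l \<plusminus> \<Omega>\<^sub>m \<plusminus> \<Omega>\<^sub>p = 0\<close> under the selection rule: there must be none with three terms, and
  with four terms they must cancel in pairs, in which case the monomial commutes with every \<open>E\<^sub>k\<close>.

  Up to a factor, the frequencies are \<open>z - 1/z\<close> for roots of unity \<open>z\<close>, and by the selection rule the
  product of the \<open>z\<close> is \<open>1\<close> or \<open>-1\<close>. For three terms, and for four terms with product \<open>1\<close>, the
  equation factors. For four terms with product \<open>-1\<close> it reads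
  \<open>(1 + z\<^sub>1 z\<^sub>2) (1 + z\<^sub>1 z\<^sub>3) (1 + z\<^sub>1 z\<^sub>4) = 2 (1 - z\<^sub>1\<^sup>2)\<close>, and comparing the \<open>2\<close>-adic valuations of both
  sides leaves only cancelling pairs.

  The transformation is a composition of the polynomial shears \<open>z \<mapsto> z + c d \<omega>(v, z)\<^sup>d\<^sup>-\<^sup>1 v\<close>, the time-one
  maps of the Hamiltonians \<open>c \<omega>(v, z)\<^sup>d\<close>, because every homogeneous polynomial of degree at most four is
  a sum of such powers.\<close>

section \<open>Divisibility in rings of cyclotomic integers\<close>

text \<open>Extend 1 to a basis of the complex numbers over the rationals. The functional fixes
  every rational number, so its denominators on a finitely generated group bound those of the
  rationals in that group.\<close>

lemma rational_functional_exists: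
  "\<exists>\<psi>::complex \<Rightarrow> rat. \<psi> 1 = 1 \<and> (\<forall>x y. \<psi> (x + y) = \<psi> x + \<psi> y) \<and> (\<forall>q x. \<psi> (of_rat q * x) = q * \<psi> x)"
proof -
  interpret rat_cx: vector_space_pair "\<lambda>(q::rat) (x::complex). of_rat q * x" "\<lambda>(q::rat) (x::rat). q * x"
    by unfold_locales (auto simp: algebra_simps of_rat_add of_rat_mult)
  have "rat_cx.vs1.independent {1::complex}"
    using rat_cx.vs1.independent_insert[of 1 "{}"] by auto
  from rat_cx.linear_independent_extend[OF this, of "\<lambda>_. 1"]
  obtain g where g: "Vector_Spaces.linear (\<lambda>(q::rat) (x::complex). of_rat q * x) (\<lambda>(q::rat) (x::rat). q * x) g"
    "g 1 = 1" by auto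
  interpret l: Vector_Spaces.linear "\<lambda>(q::rat) (x::complex). of_rat q * x" "\<lambda>(q::rat) (x::rat). q * x" g
    by (rule g)
  show ?thesis using g l.add l.scale by blast
qed

text \<open>For \<open>M > 0\<close> this is Z[zeta] with zeta a primitive \<open>M\<close>-th root
  of unity. As the additive group generated by all the roots it is visibly finitely generated;
  closure under products follows because the roots form a group.\<close>

inductive_set cyclotomic_ring :: "nat \<Rightarrow> complex set" for M where
  zero: "0 \<in> cyclotomic_ring M"
| plus: "x \<in> cyclotomic_ring M \<Longrightarrow> \<eta> ^ M = 1 \<Longrightarrow> x + \<eta> \<in> cyclotomic_ring M"
| minus: "x \<in> cyclotomic_ring M \<Longrightarrow> \<eta> ^ M = 1 \<Longrightarrow> x - \<eta> \<in> cyclotomic_ring M"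

lemma cyclotomic_ring_root: "\<eta> ^ M = 1 \<Longrightarrow> \<eta> \<in> cyclotomic_ring M"
  using cyclotomic_ring.plus[OF cyclotomic_ring.zero, of \<eta> M] by simp

lemma cyclotomic_ring_1: "1 \<in> cyclotomic_ring M"
  by (rule cyclotomic_ring_root) simp

lemma cyclotomic_ring_add:
  assumes "y \<in> cyclotomic_ring M" "x \<in> cyclotomic_ring M"
  shows "x + y \<in> cyclotomic_ring M"
  using assms(1)
proof induction
  case (plus y \<eta>)
  then show ?case using cyclotomic_ring.plus[of "x + y" M \<eta>] by (simp add: add.assoc)
next
  case (minus y \<eta>)
  then show ?case using cyclotomic_ring.minus[of "x + y" M \<eta>] by (simp add: add_diff_eq)
qed (use assms in simp)

lemma cyclotomic_ring_uminus: "x \<in> cyclotomic_ring M \<Longrightarrow> - x \<in> cyclotomic_ring M"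
proof (induction rule: cyclotomic_ring.induct)
  case (plus y \<eta>)
  then show ?case using cyclotomic_ring.minus[of "- y" M \<eta>] by simp
next
  case (minus y \<eta>)
  then show ?case using cyclotomic_ring.plus[of "- y" M \<eta>] by (simp add: add.commute)
qed (use cyclotomic_ring.zero in simp)

lemma cyclotomic_ring_diff:
  "x \<in> cyclotomic_ring M \<Longrightarrow> y \<in> cyclotomic_ring M \<Longrightarrow> x - y \<in> cyclotomic_ring M"
  using cyclotomic_ring_add[OF cyclotomic_ring_uminus, of y M x] by simp

lemma cyclotomic_ring_mult_root:
  assumes "\<xi> ^ M = 1" "x \<in> cyclotomic_ring M"
  shows "x * \<xi> \<in> cyclotomic_ring M"
  using assms(2)
proof induction
  case (plus y \<eta>)
  then show ?case
    using cyclotomic_ring.plus[of "y * \<xi>" M "\<eta> * \<xi>"] assms(1) by (simp add: distrib_right power_mult_distrib)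
next
  case (minus y \<eta>)
  then show ?case
    using cyclotomic_ring.minus[of "y * \<xi>" M "\<eta> * \<xi>"] assms(1) by (simp add: left_diff_distrib power_mult_distrib)
qed (simp add: cyclotomic_ring.zero)

lemma cyclotomic_ring_mult:
  assumes "y \<in> cyclotomic_ring M" "x \<in> cyclotomic_ring M"
  shows "x * y \<in> cyclotomic_ring M"
  using assms(1)
  by induction (auto simp: distrib_left right_diff_distrib cyclotomic_ring.zero assms(2)
      intro!: cyclotomic_ring_add cyclotomic_ring_diff cyclotomic_ring_mult_root)

lemma cyclotomic_ring_of_nat: "of_nat n \<in> cyclotomic_ring M"
  by (induction n) (auto intro: cyclotomic_ring.zero cyclotomic_ring_add cyclotomic_ring_1)

lemma cyclotomic_ring_power: "x \<in> cyclotomic_ring M \<Longrightarrow> x ^ k \<in> cyclotomic_ring M"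
  by (induction k) (auto intro: cyclotomic_ring_mult cyclotomic_ring_1)

lemma cyclotomic_ring_sum:
  "(\<And>j. j \<in> A \<Longrightarrow> f j \<in> cyclotomic_ring M) \<Longrightarrow> sum f A \<in> cyclotomic_ring M"
  by (induction A rule: infinite_finite_induct) (auto intro: cyclotomic_ring.zero cyclotomic_ring_add)

text \<open>A rational functional has bounded denominators on a finitely generated group, so the group
  cannot contain all the numbers \<open>2\<^sup>-\<^sup>r\<close>.\<close>

lemma half_notin_cyclotomic_ring:
  assumes "M > 0"
  shows "1 / 2 \<notin> cyclotomic_ring M"
proof
  assume half: "1 / 2 \<in> cyclotomic_ring M"
  obtain \<psi> :: "complex \<Rightarrow> rat" where \<psi>: "\<psi> 1 = 1" "\<And>x y. \<psi> (x + y) = \<psi> x + \<psi> y"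
    "\<And>q x. \<psi> (of_rat q * x) = q * \<psi> x"
    using rational_functional_exists by blast
  define D where "D = (\<Prod>\<eta> | \<eta> ^ M = 1. snd (quotient_of (\<psi> \<eta>)))"
  have fin: "finite {\<eta>::complex. \<eta> ^ M = 1}"
    by (rule finite_roots_unity) (use assms in auto)
  have D0: "D > 0" unfolding D_def by (rule prod_pos) (simp add: quotient_of_denom_pos')
  have root: "of_int D * \<psi> \<eta> \<in> \<int>" if "\<eta> ^ M = 1" for \<eta>
  proof -
    obtain a b where q: "quotient_of (\<psi> \<eta>) = (a, b)" by force
    have "snd (quotient_of (\<psi> \<eta>)) dvd D"
      unfolding D_def by (rule dvd_prodI) (use fin that in auto)
    then obtain c where c: "D = b * c" using q by auto
    have "b > 0" using quotient_of_denom_pos[OF q] .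
    then have "of_int D * \<psi> \<eta> = of_int (c * a)"
      using quotient_of_div[OF q] c by simp
    then show ?thesis by (simp only: Ints_of_int)
  qed
  have m: "\<psi> (- x) = - \<psi> x" for x using \<psi>(3)[of "-1" x] by (simp add: of_rat_minus)
  have int: "of_int D * \<psi> x \<in> \<int>" if "x \<in> cyclotomic_ring M" for x
    using that
  proof induction
    case zero
    then show ?case using \<psi>(3)[of 0 1] by simp
  next
    case (plus x \<eta>)
    then show ?case using root[of \<eta>] by (simp add: \<psi>(2) distrib_left)
  next
    case (minus x \<eta>)
    have "\<psi> (x - \<eta>) = \<psi> x - \<psi> \<eta>" using \<psi>(2)[of x "- \<eta>"] m by simp
    then show ?case using root[of \<eta>] minus by (simp add: right_diff_distrib)
  qed
  \<comment> \<open>Now \<open>2 ^ r > D\<close>, so \<open>D\<close> cannot clear the denominator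
    of \<open>(1 / 2) ^ r\<close>.\<close>
  define r where "r = nat D"
  have "of_int D * \<psi> ((1 / 2) ^ r) \<in> \<int>" by (intro int cyclotomic_ring_power half)
  moreover have "\<psi> ((1 / 2) ^ r) = (1 / 2) ^ r"
    using \<psi>(3)[of "(1/2) ^ r" 1] \<psi>(1) by (simp add: of_rat_power of_rat_divide)
  ultimately obtain k where "of_int D * (1 / 2) ^ r = (of_int k :: rat)" by (auto elim: Ints_cases)
  then have "of_int D = (of_int (k * 2 ^ r) :: rat)" by (simp add: field_simps)
  then have k: "D = k * 2 ^ r" by (simp only: of_int_eq_iff)
  then have "k > 0" using D0 by (simp add: zero_less_mult_iff)
  then have "2 ^ r \<le> D" using k by simp
  moreover have "int r < 2 ^ r" using of_nat_less_two_power[of r] by simp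
  ultimately show False using D0 by (simp add: r_def)
qed

section \<open>Divisibility and 2-adic valuations in the cyclotomic ring\<close>

definition ring_dvd :: "nat \<Rightarrow> complex \<Rightarrow> complex \<Rightarrow> bool" where
  "ring_dvd M x y \<longleftrightarrow> (\<exists>r\<in>cyclotomic_ring M. y = x * r)"

lemma ring_dvd_trans: "ring_dvd M x y \<Longrightarrow> ring_dvd M y z \<Longrightarrow> ring_dvd M x z"
  unfolding ring_dvd_def by (metis cyclotomic_ring_mult mult.assoc)

lemma ring_dvd_mult: "ring_dvd M x y \<Longrightarrow> ring_dvd M x' y' \<Longrightarrow> ring_dvd M (x * x') (y * y')"
  unfolding ring_dvd_def by clarify (metis cyclotomic_ring_mult mult.assoc mult.left_commute)

lemma ring_dvd_refl: "ring_dvd M x x"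
  unfolding ring_dvd_def using cyclotomic_ring_1 by force

lemma ring_dvd_multR: "r \<in> cyclotomic_ring M \<Longrightarrow> ring_dvd M x y \<Longrightarrow> ring_dvd M x (y * r)"
  unfolding ring_dvd_def by (metis cyclotomic_ring_mult mult.assoc)

lemma ring_dvd_power: "ring_dvd M x y \<Longrightarrow> ring_dvd M (x ^ k) (y ^ k)"
  by (induction k) (auto intro: ring_dvd_mult ring_dvd_refl)

lemma ring_dvd_cancel: "c \<noteq> 0 \<Longrightarrow> ring_dvd M (c * x) (c * y) \<Longrightarrow> ring_dvd M x y"
  unfolding ring_dvd_def by (auto simp: mult.assoc)

text \<open>Subtracting an integer from the quotient would put \<open>1 / 2\<close> into the ring.
  Comparisons of valuations end in this contradiction.\<close>

lemma not_ring_dvd_2_odd: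
  assumes "M > 0" "odd n"
  shows "\<not> ring_dvd M 2 (of_nat n)"
proof
  assume "ring_dvd M 2 (of_nat n)"
  then obtain r where r: "r \<in> cyclotomic_ring M" "of_nat n = 2 * r" unfolding ring_dvd_def by blast
  obtain k where k: "n = 2 * k + 1" using assms(2) by (auto elim: oddE)
  have "r - of_nat k = 1 / 2" using r(2) k by (simp add: field_simps)
  then show False
    using half_notin_cyclotomic_ring[OF assms(1)] cyclotomic_ring_diff[OF r(1) cyclotomic_ring_of_nat[of k]]
    by metis
qed

lemma ring_dvd_1_diff_power:
  assumes "x \<in> cyclotomic_ring M"
  shows "ring_dvd M (1 - x) (1 - x ^ k)"
  unfolding ring_dvd_def one_diff_power_eq
  using assms by (auto intro!: bexI cyclotomic_ring_sum cyclotomic_ring_power)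

text \<open>Since \<open>x\<close> has order \<open>2 ^ Suc k\<close>, the 2-adic valuation of
  \<open>1 - x\<close> is \<open>1 / 2 ^ k\<close>; this is the bound from above. The induction
  passes to \<open>x\<^sup>2\<close>, because \<open>(1 - x)\<^sup>2\<close> divides
  \<open>1 - x\<^sup>2\<close>.\<close>

lemma ring_dvd_2_of_minus_1_root:
  assumes "x \<in> cyclotomic_ring M" "x ^ (2 ^ k) = -1"
  shows "ring_dvd M ((1 - x) ^ (2 ^ k)) 2"
  using assms
proof (induction k arbitrary: x)
  case 0
  then show ?case using ring_dvd_refl by simp
next
  case (Suc k)
  have "ring_dvd M ((1 - x\<^sup>2) ^ (2 ^ k)) 2"
    using Suc by (intro Suc.IH) (auto simp: cyclotomic_ring_power power_mult[symmetric] mult.commute)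
  moreover have "ring_dvd M ((1 - x)\<^sup>2) (1 - x\<^sup>2)"
  proof -
    \<comment> \<open>As \<open>x ^ 2 ^ Suc k = -1\<close>, the number \<open>1 + x\<close> is one
      minus a power of \<open>x\<close>.\<close>
    have "ring_dvd M (1 - x) (1 - x ^ (1 + 2 ^ Suc k))"
      by (intro ring_dvd_1_diff_power Suc)
    then have "ring_dvd M (1 - x) (1 + x)" using Suc.prems by (simp only: power_add) simp
    then have "ring_dvd M ((1 - x) * (1 - x)) ((1 - x) * (1 + x))"
      by (intro ring_dvd_mult ring_dvd_refl)
    then show ?thesis by (simp add: power2_eq_square algebra_simps)
  qed
  from ring_dvd_power[OF this, of "2 ^ k"]
  have "ring_dvd M ((1 - x) ^ 2 ^ Suc k) ((1 - x\<^sup>2) ^ 2 ^ k)" by (simp add: power_mult[symmetric])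
  ultimately show ?case using ring_dvd_trans by blast
qed

text \<open>Raising \<open>x\<close> to the power \<open>2 ^ k\<close> leaves a root
  \<open>y \<noteq> 1\<close> of odd order. Its first \<open>m\<close> powers sum to zero, so
  \<open>m\<close> is the sum of the \<open>1 - y ^ j\<close>, all multiples of
  \<open>1 - y\<close>. In other words, \<open>1 - x\<close> has valuation zero at 2.\<close>

lemma ring_dvd_odd:
  assumes x: "x ^ M = 1" "M > 0" "\<And>k. x ^ (2 ^ k) \<noteq> 1"
  shows "\<exists>n. odd n \<and> ring_dvd M (1 - x) (of_nat n)"
proof -
  obtain k m where m: "M = 2 ^ k * m" "odd m"
    using assms(2) by (metis mult.commute multiplicity_decompose' not_gr_zero numeral_One one_less_numeral_iff
        semiring_norm(76) two_is_prime_nat dvd_def not_prime_unit)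
  define y where "y = x ^ (2 ^ k)"
  have y: "y \<noteq> 1" "y ^ m = 1" using x m by (auto simp: y_def power_mult[symmetric])
  have R: "x \<in> cyclotomic_ring M" by (rule cyclotomic_ring_root) fact
  then have Ry: "y \<in> cyclotomic_ring M" unfolding y_def by (rule cyclotomic_ring_power)
  have "(\<Sum>j<m. y ^ j) = 0" using y geometric_sum[of y m] by simp
  then have "of_nat m = (\<Sum>j<m. 1 - y ^ j)" by (simp add: sum_subtractf)
  also have "\<dots> = (1 - y) * (\<Sum>j<m. \<Sum>i<j. y ^ i)"
    by (simp add: sum_distrib_left one_diff_power_eq)
  finally have "ring_dvd M (1 - y) (of_nat m)"
    unfolding ring_dvd_def using Ry by (auto intro!: bexI cyclotomic_ring_sum cyclotomic_ring_power)
  moreover have "ring_dvd M (1 - x) (1 - y)"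
    unfolding y_def by (rule ring_dvd_1_diff_power[OF R])
  ultimately show ?thesis using m(2) ring_dvd_trans by blast
qed

text \<open>Squaring is additive modulo 2, so \<open>(1 - x) ^ 2 ^ k\<close> is congruent to
  \<open>1 - x ^ 2 ^ k\<close>. This bounds the valuation of \<open>1 - x\<close> from
  below.\<close>

lemma ring_dvd_2_1_diff:
  assumes "x \<in> cyclotomic_ring M" "x ^ (2 ^ k) = 1"
  shows "ring_dvd M 2 ((1 - x) ^ (2 ^ k))"
proof -
  have "\<exists>r\<in>cyclotomic_ring M. (1 - x) ^ (2 ^ k) = 1 - x ^ (2 ^ k) + 2 * r"
    using assms(1)
  proof (induction k arbitrary: x)
    case 0
    then show ?case using cyclotomic_ring.zero by force
  next
    case (Suc k)
    obtain r where r: "r \<in> cyclotomic_ring M" "(1 - x) ^ (2 ^ k) = 1 - x ^ (2 ^ k) + 2 * r"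
      using Suc by blast
    define s where "s = x ^ 2 ^ k"
    have s: "s \<in> cyclotomic_ring M" unfolding s_def using Suc.prems by (rule cyclotomic_ring_power)
    define t where "t = s * s - s + of_nat 2 * (r * (1 - s)) + of_nat 2 * (r * r)"
    have "(1 - x) ^ (2 ^ Suc k) = ((1 - x) ^ (2 ^ k))\<^sup>2" by (simp add: power_mult mult.commute[of 2])
    also have "\<dots> = 1 - s\<^sup>2 + 2 * t"
      unfolding r(2) s_def[symmetric] t_def by (simp add: power2_eq_square algebra_simps)
    also have "s\<^sup>2 = x ^ (2 ^ Suc k)" by (simp add: s_def power_mult mult.commute[of 2])
    finally have "(1 - x) ^ (2 ^ Suc k) = 1 - x ^ (2 ^ Suc k) + 2 * t" .
    moreover have "t \<in> cyclotomic_ring M"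
      unfolding t_def using r(1) s
      by (intro cyclotomic_ring_add cyclotomic_ring_diff cyclotomic_ring_mult cyclotomic_ring_of_nat cyclotomic_ring_1)
    ultimately show ?case by blast
  qed
  then show ?thesis using assms(2) unfolding ring_dvd_def by auto
qed


text \<open>The number \<open>w / 4\<close> bounds the 2-adic valuation of \<open>1 + p\<close>; the
  fourth power makes the bound an integer. The valuation is 1/2 if \<open>p\<close> has order 4, at
  most 1/4 for higher powers of two, and 0 for all other orders. Orders 1 and 2 are excluded by
  \<open>p\<^sup>2 \<noteq> 1\<close>.\<close>

lemma ring_dvd_1_plus:
  assumes M: "even M" "M > 0" and p: "p ^ M = 1" "p\<^sup>2 \<noteq> 1"
  shows "\<exists>n w. odd n \<and> ring_dvd M ((1 + p) ^ 4) (2 ^ w * of_nat n) \<and> w \<le> 2 \<and>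
     (w = 2 \<longrightarrow> p\<^sup>2 = -1) \<and> (w \<noteq> 0 \<longrightarrow> (\<exists>k. p ^ (2 ^ k) = 1))"
proof (cases "\<exists>k. p ^ (2 ^ k) = 1")
  case True
  define k where "k = (LEAST k. p ^ (2 ^ k) = 1)"
  have k1: "p ^ (2 ^ k) = 1" unfolding k_def using True by (rule LeastI_ex)
  have k2: "p ^ (2 ^ j) \<noteq> 1" if "j < k" for j using that not_less_Least unfolding k_def by blast
  have "k > 1" using k1 p(2) by (cases "k = 0"; cases "k = 1") auto
  then have "k = Suc (Suc (k - 2))" by simp
  then obtain l where l: "k = Suc (Suc l)" ..
  have "(p ^ (2 ^ Suc l))\<^sup>2 = 1" using k1 l by (simp add: power_mult[symmetric] mult_ac)
  then have neg: "p ^ (2 ^ Suc l) = -1" using k2[of "Suc l"] l by (auto simp: power2_eq_1_iff)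
  have R: "- p \<in> cyclotomic_ring M" using p(1) by (intro cyclotomic_ring_uminus cyclotomic_ring_root)
  have d: "ring_dvd M ((1 + p) ^ (2 ^ Suc l)) 2"
    using ring_dvd_2_of_minus_1_root[OF R, of "Suc l"] neg by (simp add: power_mult)
  show ?thesis
  proof (cases l)
    case 0
    have "ring_dvd M ((1 + p) ^ 4) (2 ^ 2 * of_nat 1)"
      using ring_dvd_mult[OF d d] 0 by (simp add: power2_eq_square power4_eq_xxxx mult.assoc)
    then show ?thesis using neg 0 True by (intro exI[of _ 1] exI[of _ 2]) auto
  next
    case (Suc l')
    have "(1 + p) ^ (2 ^ Suc l) = (1 + p) ^ 4 * (1 + p) ^ (2 ^ Suc l - 4)"
      unfolding power_add[symmetric] Suc by simp
    moreover have "(1 + p) ^ (2 ^ Suc l - 4) \<in> cyclotomic_ring M"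
      using p(1) by (intro cyclotomic_ring_power cyclotomic_ring_add cyclotomic_ring_1 cyclotomic_ring_root)
    ultimately have "ring_dvd M ((1 + p) ^ 4) ((1 + p) ^ (2 ^ Suc l))"
      using ring_dvd_multR[OF _ ring_dvd_refl] by metis
    then have "ring_dvd M ((1 + p) ^ 4) (2 ^ 1 * of_nat 1)"
      using d ring_dvd_trans by fastforce
    then show ?thesis using True by (intro exI[of _ 1] exI[of _ 1]) auto
  qed
next
  case False
  have "(- p) ^ (2 ^ k) \<noteq> 1" for k
  proof
    assume "(- p) ^ (2 ^ k) = 1"
    then have "((- p) ^ (2 ^ k))\<^sup>2 = 1" by simp
    then have "p ^ (2 ^ Suc k) = 1" by (simp add: power_mult[symmetric] mult_ac)
    then show False using False by blast
  qed
  moreover have "(- p) ^ M = 1" using M(1) p(1) by simp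
  ultimately obtain n where n: "odd n" "ring_dvd M (1 - (- p)) (of_nat n)"
    using ring_dvd_odd[of "- p" M] M(2) by blast
  have "ring_dvd M ((1 + p) ^ 4) (2 ^ 0 * of_nat (n ^ 4))" using ring_dvd_power[OF n(2), of 4] by simp
  then show ?thesis using n(1) by (intro exI[of _ "n ^ 4"] exI[of _ 0]) auto
qed

section \<open>Resonances among the frequencies\<close>

text \<open>Suppose no pair cancels and compare valuations in the identity \<open>key\<close>. On
  the left at most one factor has valuation 1/2 and the others at most 1/4, so the total is at most
  1; on the right it is at least 1. If some factor on the left has valuation 0, the left total is
  below 1. Otherwise all three products have 2-power order, hence so does \<open>z1\<^sup>2\<close>,
  and \<open>1 - z1\<^sup>2\<close> makes the right side exceed 1.\<close>

lemma umklapp_resonance_pair: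
  assumes M: "even M" "M > 0" and r: "z1 ^ M = 1" "z2 ^ M = 1" "z3 ^ M = 1" "z4 ^ M = 1"
    and prod: "z1 * z2 * z3 * z4 = (-1 :: complex)"
    and sum: "z1 - 1 / z1 + (z2 - 1 / z2) + (z3 - 1 / z3) + (z4 - 1 / z4) = 0"
    and nt: "z1\<^sup>2 \<noteq> 1"
  shows "z1 * z2 = 1 \<or> z1 * z3 = 1 \<or> z1 * z4 = 1 \<or> z2 * z3 = 1 \<or> z2 * z4 = 1 \<or> z3 * z4 = 1 \<or>
    z1 = - z2 \<or> z1 = - z3 \<or> z1 = - z4 \<or> z2 = - z3 \<or> z2 = - z4 \<or> z3 = - z4"
proof (rule ccontr)
  assume contr: "\<not> ?thesis"
  have nz: "z1 \<noteq> 0" "z2 \<noteq> 0" "z3 \<noteq> 0" "z4 \<noteq> 0" using prod by auto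
  \<comment> \<open>Two products of order 4 force \<open>b = c\<close> and \<open>d = a\<close>. The
    resonance equation then factors and yields an excluded pair.\<close>
  have two_quarter: False
    if "a * b * c * d = -1" "a - 1 / a + (b - 1 / b) + (c - 1 / c) + (d - 1 / d) = 0"
      "(a * b)\<^sup>2 = -1" "(a * c)\<^sup>2 = -1" "a \<noteq> - b" "a * b \<noteq> 1" "b \<noteq> - c" for a b c d :: complex
  proof -
    have nz: "a \<noteq> 0" "b \<noteq> 0" "c \<noteq> 0" "d \<noteq> 0" using that(1) by auto
    have "a\<^sup>2 * b\<^sup>2 = a\<^sup>2 * c\<^sup>2" using that(3,4) by (simp add: power_mult_distrib)
    then have "b\<^sup>2 = c\<^sup>2" using nz by simp
    then have bc: "b = c" using that(7) by (auto simp: power2_eq_iff)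
    have "a * b * b * d = a * b * b * a" using that(1,3) bc by (simp add: power2_eq_square algebra_simps)
    then have "d = a" using nz by simp
    then have "2 * (a - 1 / a + (b - 1 / b)) = 0" using that(2) bc by (simp add: algebra_simps)
    then have "a - 1 / a + (b - 1 / b) = 0" by (simp only: mult_eq_0_iff) simp
    then have "(a + b) * (a * b - 1) = 0" using nz by (simp add: field_simps)
    then show False using that(5,6) by (auto simp: eq_neg_iff_add_eq_0)
  qed
  have comp: "c * d = 1" if "a * b * c * d = -1" "a * b = -1" for a b c d :: complex
    using that by (simp add: mult.assoc)
  have sq: "(a * b)\<^sup>2 \<noteq> 1" if "a * b * c * d = -1" "a * b \<noteq> 1" "c * d \<noteq> 1" for a b c d :: complex
    using comp[OF that(1)] that(2,3) by (auto simp only: power2_eq_1_iff)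
  have perm: "z1 * z3 * z2 * z4 = -1" "z1 * z4 * z2 * z3 = -1" using prod by (simp_all only: mult_ac)
  have p: "(z1 * z2)\<^sup>2 \<noteq> 1" "(z1 * z3)\<^sup>2 \<noteq> 1" "(z1 * z4)\<^sup>2 \<noteq> 1"
    by (rule sq[OF prod] sq[OF perm(1)] sq[OF perm(2)]; use contr in blast)+
  \<comment> \<open>With product \<open>-1\<close> each \<open>1 / zi\<close> is minus the product
    of the other three, so the resonance equation says e1 + e3 = 0 for the elementary symmetric
    polynomials. The left side expands to \<open>2 * (1 - z1\<^sup>2)\<close> plus \<open>z1\<close>
    times e1 + e3.\<close>
  have key: "(1 + z1 * z2) * (1 + z1 * z3) * (1 + z1 * z4) = 2 * (1 - z1\<^sup>2)"
  proof -
    have inv: "1 / z1 = - (z2 * z3 * z4)" "1 / z2 = - (z1 * z3 * z4)" "1 / z3 = - (z1 * z2 * z4)"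
      "1 / z4 = - (z1 * z2 * z3)"
      using prod nz by (simp_all add: field_simps eq_neg_iff_add_eq_0)
    show ?thesis using sum prod unfolding inv by algebra
  qed
  have pM: "(z1 * z2) ^ M = 1" "(z1 * z3) ^ M = 1" "(z1 * z4) ^ M = 1"
    using r by (simp_all add: power_mult_distrib)
  obtain n2 w2 where 2: "odd n2" "ring_dvd M ((1 + z1 * z2) ^ 4) (2 ^ w2 * of_nat n2)" "w2 \<le> 2"
    "w2 = 2 \<longrightarrow> (z1 * z2)\<^sup>2 = -1" "w2 \<noteq> 0 \<longrightarrow> (\<exists>k. (z1 * z2) ^ (2 ^ k) = 1)"
    using ring_dvd_1_plus[OF M pM(1) p(1)] by blast
  obtain n3 w3 where 3: "odd n3" "ring_dvd M ((1 + z1 * z3) ^ 4) (2 ^ w3 * of_nat n3)" "w3 \<le> 2"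
    "w3 = 2 \<longrightarrow> (z1 * z3)\<^sup>2 = -1" "w3 \<noteq> 0 \<longrightarrow> (\<exists>k. (z1 * z3) ^ (2 ^ k) = 1)"
    using ring_dvd_1_plus[OF M pM(2) p(2)] by blast
  obtain n4 w4 where 4: "odd n4" "ring_dvd M ((1 + z1 * z4) ^ 4) (2 ^ w4 * of_nat n4)" "w4 \<le> 2"
    "w4 = 2 \<longrightarrow> (z1 * z4)\<^sup>2 = -1" "w4 \<noteq> 0 \<longrightarrow> (\<exists>k. (z1 * z4) ^ (2 ^ k) = 1)"
    using ring_dvd_1_plus[OF M pM(3) p(3)] by blast
  have "\<not> (w2 = 2 \<and> w3 = 2)"
    using two_quarter[of z1 z2 z3 z4] 2(4) 3(4) prod sum contr by auto
  moreover have "\<not> (w2 = 2 \<and> w4 = 2)"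
    using two_quarter[of z1 z2 z4 z3] 2(4) 4(4) prod sum contr by (auto simp: algebra_simps)
  moreover have "\<not> (w3 = 2 \<and> w4 = 2)"
    using two_quarter[of z1 z3 z4 z2] 3(4) 4(4) prod sum contr by (auto simp: algebra_simps)
  ultimately have w4: "w2 + w3 + w4 \<le> 4" "w2 = 0 \<or> w3 = 0 \<or> w4 = 0 \<Longrightarrow> w2 + w3 + w4 \<le> 3"
    using 2(3) 3(3) 4(3) by linarith+
  define n where "n = n2 * n3 * n4"
  define u where "u = (1 - z1\<^sup>2) ^ 4"
  have n: "odd n" using 2(1) 3(1) 4(1) by (simp add: n_def)
  have uR: "u \<in> cyclotomic_ring M"
    unfolding u_def using r(1)
    by (intro cyclotomic_ring_power cyclotomic_ring_diff cyclotomic_ring_1 cyclotomic_ring_root)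
  have "ring_dvd M ((1 + z1 * z2) ^ 4 * (1 + z1 * z3) ^ 4 * (1 + z1 * z4) ^ 4)
      ((2 ^ w2 * of_nat n2) * (2 ^ w3 * of_nat n3) * (2 ^ w4 * of_nat n4))"
    by (intro ring_dvd_mult 2 3 4)
  moreover have "(1 + z1 * z2) ^ 4 * (1 + z1 * z3) ^ 4 * (1 + z1 * z4) ^ 4 = 2 ^ 4 * u"
    unfolding u_def power_mult_distrib[symmetric] key ..
  moreover have "(2 ^ w2 * of_nat n2) * (2 ^ w3 * of_nat n3) * (2 ^ w4 * of_nat n4)
      = (2 ^ (w2 + w3 + w4) * of_nat n :: complex)"
    by (simp add: n_def power_add)
  ultimately have div: "ring_dvd M (2 ^ 4 * u) (2 ^ (w2 + w3 + w4) * of_nat n)" by simp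
  have div': "ring_dvd M (2 ^ 4 * u) (2 ^ k * of_nat n)" if "w2 + w3 + w4 \<le> k" for k
  proof -
    have "ring_dvd M (2 ^ 4 * u) (2 ^ (w2 + w3 + w4) * of_nat n * of_nat (2 ^ (k - (w2 + w3 + w4))))"
      by (rule ring_dvd_multR[OF cyclotomic_ring_of_nat div])
    also have "2 ^ (w2 + w3 + w4) * of_nat n * of_nat (2 ^ (k - (w2 + w3 + w4)))
       = (2 ^ (w2 + w3 + w4 + (k - (w2 + w3 + w4))) * of_nat n :: complex)"
      by (simp only: power_add) simp
    also have "w2 + w3 + w4 + (k - (w2 + w3 + w4)) = k" using that by simp
    finally show ?thesis .
  qed
  show False
  proof (cases "w2 = 0 \<or> w3 = 0 \<or> w4 = 0")
    case True
    have "ring_dvd M (2 ^ 3 * (2 * u)) (2 ^ 3 * of_nat n)" using div'[OF w4(2)[OF True]] by simp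
    then have "ring_dvd M (2 * u) (of_nat n)" by (rule ring_dvd_cancel[rotated]) simp
    moreover have "ring_dvd M 2 (2 * u)" by (rule ring_dvd_multR[OF uR ring_dvd_refl])
    ultimately show False using not_ring_dvd_2_odd[OF M(2) n] ring_dvd_trans by blast
  next
    case False
    have "\<exists>k. (z1\<^sup>2) ^ (2 ^ k) = 1"
    proof -
      obtain k2 k3 k4 where k: "(z1 * z2) ^ (2 ^ k2) = 1" "(z1 * z3) ^ (2 ^ k3) = 1" "(z1 * z4) ^ (2 ^ k4) = 1"
        using False 2(5) 3(5) 4(5) by auto
      \<comment> \<open>The summand 1 makes \<open>2 ^ k\<close> even, which later removes the sign
        of \<open>- (z1\<^sup>2)\<close>.\<close>
      define k where "k = k2 + k3 + k4 + 1"
      have up: "x ^ (2 ^ j) = 1" if "x ^ (2 ^ i) = 1" "i \<le> j" for x :: complex and i j :: nat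
      proof -
        have "(2::nat) ^ j = 2 ^ i * 2 ^ (j - i)" using that(2) by (simp flip: power_add)
        then show ?thesis using that(1) by (simp add: power_mult)
      qed
      have "(z1 * z2) ^ (2 ^ k) = 1" "(z1 * z3) ^ (2 ^ k) = 1" "(z1 * z4) ^ (2 ^ k) = 1"
        by (rule up[OF k(1)] up[OF k(2)] up[OF k(3)]; simp add: k_def)+
      then have "((z1 * z2) * (z1 * z3) * (z1 * z4)) ^ (2 ^ k) = 1" by (simp add: power_mult_distrib)
      moreover have "(z1 * z2) * (z1 * z3) * (z1 * z4) = - (z1\<^sup>2)"
        using prod by (simp add: power2_eq_square) algebra
      ultimately have "(- (z1\<^sup>2)) ^ (2 ^ k) = 1" by simp
      then have "(z1\<^sup>2) ^ (2 ^ k) = 1" by (simp add: k_def)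
      then show ?thesis ..
    qed
    then obtain k where k: "(z1\<^sup>2) ^ (2 ^ k) = 1" ..
    \<comment> \<open>A power of \<open>1 - z1\<^sup>2\<close> is thus divisible by 2, so 2 divides
      a power of \<open>u\<close>, which in turn divides a power of the odd number
      \<open>n\<close>.\<close>
    have "ring_dvd M 2 ((1 - z1\<^sup>2) ^ (2 ^ k))"
      using r(1) by (intro ring_dvd_2_1_diff cyclotomic_ring_power cyclotomic_ring_root k)
    from ring_dvd_power[OF this, of 4]
    have "ring_dvd M (2 ^ 4) (u ^ (2 ^ k))" by (simp add: u_def power_mult[symmetric] mult.commute)
    moreover have "ring_dvd M 2 (2 ^ 4)"
      using ring_dvd_multR[OF cyclotomic_ring_of_nat[of 8] ring_dvd_refl, of M 2] by simp
    moreover have "ring_dvd M (u ^ (2 ^ k)) (of_nat (n ^ (2 ^ k)))"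
    proof -
      have "ring_dvd M u (of_nat n)" using div'[OF w4(1)] by (rule ring_dvd_cancel[rotated]) simp
      from ring_dvd_power[OF this, of "2 ^ k"] show ?thesis by simp
    qed
    ultimately have "ring_dvd M 2 (of_nat (n ^ (2 ^ k)))" using ring_dvd_trans by blast
    then show False using not_ring_dvd_2_odd[OF M(2), of "n ^ (2 ^ k)"] n by simp
  qed
qed


text \<open>The angles lie strictly between 0 and \<open>pi / 2\<close>: positivity of the sine
  there determines the signs, injectivity the wave numbers.\<close>

lemma sign_sin_eq:
  fixes k l N :: nat and s t :: real
  assumes "0 < k" "2 * k < N" "0 < l" "2 * l < N" "s \<in> {1, -1}" "t \<in> {1, -1}"
    and "s * sin (real k * pi / real N) = - (t * sin (real l * pi / real N))"
  shows "k = l \<and> s = - t"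
proof -
  have bnd: "0 < real j * pi / real N \<and> real j * pi / real N < pi / 2" if "0 < j" "2 * j < N" for j
  proof -
    have "real j / real N < 1 / 2" using that by (simp add: field_simps)
    then have "pi * (real j / real N) < pi * (1 / 2)" by (intro mult_strict_left_mono) auto
    then have "real j * pi / real N < pi / 2" by (simp add: mult.commute)
    then show ?thesis using that by simp
  qed
  have pos: "sin (real j * pi / real N) > 0" if "0 < j" "2 * j < N" for j
    using bnd[OF that] pi_gt_zero by (intro sin_gt_zero) linarith+
  have "sin (real k * pi / real N) > 0" "sin (real l * pi / real N) > 0"
    using pos assms by auto
  then have s: "s = - t" and eq: "sin (real k * pi / real N) = sin (real l * pi / real N)"
    using assms(5-7) by auto
  have inj: "x = y" if "0 < x \<and> x < pi / 2" "0 < y \<and> y < pi / 2" "sin x = sin y" for x y :: real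
    by (rule sin_inj_pi) (use that in linarith)+
  have "real k * pi / real N = real l * pi / real N"
    by (rule inj[OF bnd[OF assms(1,2)] bnd[OF assms(3,4)] eq])
  moreover have "real N \<noteq> 0" using assms(2) by simp
  ultimately have "k = l" by simp
  then show ?thesis using s by simp
qed

text \<open>The sign \<open>s\<close> is that of the frequency and \<open>e\<close> that of the wave number; they are independent, since
  sine modes have no direction of propagation. Replacing \<open>z\<close> by \<open>-1/z\<close> preserves \<open>z - 1/z\<close>, which therefore
  depends on \<open>s\<close> only, while products of waves depend up to sign on the \<open>e\<close> only.\<close>

definition wave :: "nat \<Rightarrow> nat \<Rightarrow> int \<Rightarrow> real \<Rightarrow> complex" where
  "wave N k e s = of_int e * of_real s * cis (of_int e * real k * pi / real N)"

lemma wave_facts: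
  assumes "0 < k" "2 * k < N" "e \<in> {1, -1}" "s \<in> {1, -1}"
  shows wave_root: "wave N k e s ^ (2 * N) = 1"
    and wave_diff: "wave N k e s - 1 / wave N k e s = 2 * \<i> * of_real (s * sin (real k * pi / real N))"
    and wave_ne: "wave N k e s \<noteq> 1" "wave N k e s \<noteq> -1" "wave N k e s \<noteq> 0"
proof -
  have "cis (of_int e * real k * pi / real N) ^ (2 * N) = cis (2 * pi * of_int (e * int k))"
  proof -
    have "real (2 * N) * (of_int e * real k * pi / real N) = 2 * pi * of_int (e * int k)"
      using assms(2) by (simp add: field_simps)
    then show ?thesis unfolding Complex.DeMoivre by (rule arg_cong)
  qed
  also have "\<dots> = 1" by (rule cis_multiple_2pi) simp
  finally show "wave N k e s ^ (2 * N) = 1"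
    using assms(3,4) by (auto simp: wave_def power_mult_distrib power_mult)
  show d: "wave N k e s - 1 / wave N k e s = 2 * \<i> * of_real (s * sin (real k * pi / real N))"
  proof -
    have sin: "cis x - cis (- x) = 2 * \<i> * of_real (sin x)" for x by (simp add: complex_eq_iff)
    have "1 / (of_int e * of_real s * cis x) = of_int e * of_real s * cis (- x)" for x
      using assms(3,4) by (auto simp: divide_inverse cis_inverse)
    then have "wave N k e s - 1 / wave N k e s
        = of_int e * of_real s * (2 * \<i> * of_real (sin (of_int e * real k * pi / real N)))"
      by (simp only: wave_def sin[symmetric] right_diff_distrib)
    then show ?thesis using assms(3) by auto
  qed
  have "0 < real k * pi / real N" "real k * pi / real N < pi"
    using assms by (auto simp: field_simps)
  then have "sin (real k * pi / real N) \<noteq> 0" using sin_gt_zero by force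
  then have "wave N k e s - 1 / wave N k e s \<noteq> 0" unfolding d using assms(4) by auto
  then show "wave N k e s \<noteq> 1" "wave N k e s \<noteq> -1" "wave N k e s \<noteq> 0" by auto
qed

lemma cis_pi_int_cases: "cis (pi * of_int m) = 1 \<or> cis (pi * of_int m) = -1"
proof (cases "even m")
  case True
  then obtain l where "m = 2 * l" ..
  then have "cis (pi * of_int m) = cis (2 * pi * of_int l)" by (simp add: mult_ac)
  then show ?thesis by (simp add: cis_multiple_2pi)
next
  case False
  then obtain l where "m = 2 * l + 1" ..
  then have "pi * of_int m = 2 * pi * of_int l + pi" by (simp add: algebra_simps)
  then have "cis (pi * of_int m) = cis (2 * pi * of_int l) * cis pi" by (simp only: cis_mult)
  then show ?thesis by (simp add: cis_multiple_2pi cis_pi)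
qed

text \<open>The selection rule makes the product of the three waves 1 or -1, so every inverse is, up
  to that sign, a product of the other two waves. The resonance equation then factors as the product
  of the \<open>zi - 1\<close>, respectively of the \<open>zi + 1\<close>, and no wave equals 1 or
  -1.\<close>

lemma three_wave_nonresonance:
  fixes k1 k2 k3 N :: nat and e1 e2 e3 :: int and s1 s2 s3 :: real
  assumes k: "0 < k1" "2 * k1 < N" "0 < k2" "2 * k2 < N" "0 < k3" "2 * k3 < N"
    and e: "e1 \<in> {1, -1}" "e2 \<in> {1, -1}" "e3 \<in> {1, -1}"
    and s: "s1 \<in> {1, -1}" "s2 \<in> {1, -1}" "s3 \<in> {1, -1}"
    and dvd: "int N dvd e1 * int k1 + e2 * int k2 + e3 * int k3"
  shows "s1 * sin (real k1 * pi / real N) + s2 * sin (real k2 * pi / real N) + s3 * sin (real k3 * pi / real N) \<noteq> 0"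
proof
  assume "s1 * sin (real k1 * pi / real N) + s2 * sin (real k2 * pi / real N) + s3 * sin (real k3 * pi / real N) = 0"
  then have "2 * \<i> * of_real (s1 * sin (real k1 * pi / real N) + s2 * sin (real k2 * pi / real N)
     + s3 * sin (real k3 * pi / real N)) = 0" by (simp only:) simp
  define z1 z2 z3 where z: "z1 = wave N k1 e1 s1" "z2 = wave N k2 e2 s2" "z3 = wave N k3 e3 s3"
  note w = wave_facts[OF k(1,2) e(1) s(1), folded z] wave_facts[OF k(3,4) e(2) s(2), folded z]
    wave_facts[OF k(5,6) e(3) s(3), folded z]
  have sum: "z1 - 1 / z1 + (z2 - 1 / z2) + (z3 - 1 / z3) = 0"
    using \<open>2 * \<i> * _ = 0\<close> unfolding w(2) w(7) w(12) by (simp add: algebra_simps)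
  obtain m where m: "e1 * int k1 + e2 * int k2 + e3 * int k3 = int N * m" using dvd by blast
  have "cis (of_int e1 * real k1 * pi / real N) * cis (of_int e2 * real k2 * pi / real N)
      * cis (of_int e3 * real k3 * pi / real N) = cis (pi / real N * of_int (e1 * int k1 + e2 * int k2 + e3 * int k3))"
    by (simp add: cis_mult algebra_simps add_divide_distrib)
  also have "\<dots> = cis (pi * of_int m)" unfolding m using k(2) by simp
  finally have "z1 * z2 * z3 = of_int (e1 * e2 * e3) * of_real (s1 * s2 * s3) * cis (pi * of_int m)"
    by (simp add: z wave_def mult_ac)
  then have "z1 * z2 * z3 = 1 \<or> z1 * z2 * z3 = -1" using e s cis_pi_int_cases[of m] by auto
  then show False
  proof
    assume p: "z1 * z2 * z3 = 1"
    then have inv: "1 / z1 = z2 * z3" "1 / z2 = z1 * z3" "1 / z3 = z1 * z2" using w by (simp_all add: field_simps)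
    have "(z1 - 1) * (z2 - 1) * (z3 - 1) = 0" using sum p unfolding inv by algebra
    then show False using w by simp
  next
    assume p: "z1 * z2 * z3 = -1"
    then have inv: "1 / z1 = - (z2 * z3)" "1 / z2 = - (z1 * z3)" "1 / z3 = - (z1 * z2)"
      using w by (simp_all add: field_simps eq_neg_iff_add_eq_0)
    have "(z1 + 1) * (z2 + 1) * (z3 + 1) = 0" using sum p unfolding inv by algebra
    then show False using w by (simp add: eq_neg_iff_add_eq_0[symmetric])
  qed
qed

text \<open>One cancelling pair suffices, as the equation then makes the other two terms cancel. For
  product 1 the pair comes from a factorization into the three terms \<open>z1 * zj - 1\<close>;
  product -1 is the valuation argument.\<close>

lemma four_wave_resonance:
  fixes k1 k2 k3 k4 N :: nat and e1 e2 e3 e4 :: int and s1 s2 s3 s4 :: real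
  assumes k: "0 < k1" "2 * k1 < N" "0 < k2" "2 * k2 < N" "0 < k3" "2 * k3 < N" "0 < k4" "2 * k4 < N"
    and e: "e1 \<in> {1, -1}" "e2 \<in> {1, -1}" "e3 \<in> {1, -1}" "e4 \<in> {1, -1}"
    and s: "s1 \<in> {1, -1}" "s2 \<in> {1, -1}" "s3 \<in> {1, -1}" "s4 \<in> {1, -1}"
    and dvd: "int N dvd e1 * int k1 + e2 * int k2 + e3 * int k3 + e4 * int k4"
    and res: "s1 * sin (real k1 * pi / real N) + s2 * sin (real k2 * pi / real N)
      + s3 * sin (real k3 * pi / real N) + s4 * sin (real k4 * pi / real N) = 0"
  shows "k1 = k2 \<and> s1 = - s2 \<and> k3 = k4 \<and> s3 = - s4 \<or> k1 = k3 \<and> s1 = - s3 \<and> k2 = k4 \<and> s2 = - s4 \<or>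
    k1 = k4 \<and> s1 = - s4 \<and> k2 = k3 \<and> s2 = - s3"
proof -
  define x1 x2 x3 x4 where x: "x1 = s1 * sin (real k1 * pi / real N)" "x2 = s2 * sin (real k2 * pi / real N)"
    "x3 = s3 * sin (real k3 * pi / real N)" "x4 = s4 * sin (real k4 * pi / real N)"
  define z1 z2 z3 z4 where z: "z1 = wave N k1 e1 s1" "z2 = wave N k2 e2 s2" "z3 = wave N k3 e3 s3" "z4 = wave N k4 e4 s4"
  note w = wave_facts[OF k(1,2) e(1) s(1), folded z x] wave_facts[OF k(3,4) e(2) s(2), folded z x]
    wave_facts[OF k(5,6) e(3) s(3), folded z x] wave_facts[OF k(7,8) e(4) s(4), folded z x]
  have "2 * \<i> * of_real (x1 + x2 + x3 + x4) = 0" using res unfolding x by (simp only:) simp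
  then have sum: "z1 - 1 / z1 + (z2 - 1 / z2) + (z3 - 1 / z3) + (z4 - 1 / z4) = 0"
    unfolding w(2) w(7) w(12) w(17) by (simp add: algebra_simps)
  obtain m where m: "e1 * int k1 + e2 * int k2 + e3 * int k3 + e4 * int k4 = int N * m" using dvd by blast
  have "cis (of_int e1 * real k1 * pi / real N) * cis (of_int e2 * real k2 * pi / real N)
      * cis (of_int e3 * real k3 * pi / real N) * cis (of_int e4 * real k4 * pi / real N)
      = cis (pi / real N * of_int (e1 * int k1 + e2 * int k2 + e3 * int k3 + e4 * int k4))"
    by (simp add: cis_mult algebra_simps add_divide_distrib)
  also have "\<dots> = cis (pi * of_int m)" unfolding m using k(2) by simp
  finally have "z1 * z2 * z3 * z4 = of_int (e1 * e2 * e3 * e4) * of_real (s1 * s2 * s3 * s4) * cis (pi * of_int m)"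
    by (simp add: z wave_def mult_ac)
  then have prod: "z1 * z2 * z3 * z4 = 1 \<or> z1 * z2 * z3 * z4 = -1" using e s cis_pi_int_cases[of m] by auto
  \<comment> \<open>The function \<open>z - 1 / z\<close> changes sign both under inversion and
    under negation, so either kind of pair gives opposite frequencies.\<close>
  have pair: "a = - b" if "u - 1 / u = 2 * \<i> * of_real a" "v - 1 / v = 2 * \<i> * of_real b"
    "u * v = 1 \<or> u = - v" "u \<noteq> 0" "v \<noteq> 0" for u v a b
  proof -
    have "u - 1 / u = - (v - 1 / v)" using that(3-5) by (auto simp: field_simps)
    then have "2 * \<i> * complex_of_real a = 2 * \<i> * complex_of_real (- b)" unfolding that(1,2) by simp
    moreover have "2 * \<i> \<noteq> 0" by simp
    ultimately have "complex_of_real a = complex_of_real (- b)" by (simp only: mult_cancel_left) blast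
    then show ?thesis by (simp only: of_real_eq_iff)
  qed
  have "z1 * z2 = 1 \<or> z1 * z3 = 1 \<or> z1 * z4 = 1 \<or> z2 * z3 = 1 \<or> z2 * z4 = 1 \<or> z3 * z4 = 1 \<or>
    z1 = - z2 \<or> z1 = - z3 \<or> z1 = - z4 \<or> z2 = - z3 \<or> z2 = - z4 \<or> z3 = - z4"
    using prod
  proof
    assume p: "z1 * z2 * z3 * z4 = 1"
    then have inv: "1 / z1 = z2 * z3 * z4" "1 / z2 = z1 * z3 * z4" "1 / z3 = z1 * z2 * z4" "1 / z4 = z1 * z2 * z3"
      using w by (simp_all add: field_simps)
    have "(z1 * z2 - 1) * (z1 * z3 - 1) * (z1 * z4 - 1) = 0" using sum p unfolding inv by algebra
    then show ?thesis by auto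
  next
    assume "z1 * z2 * z3 * z4 = -1"
    moreover have "z1\<^sup>2 \<noteq> 1" using w by (simp add: power2_eq_1_iff)
    ultimately show ?thesis
      using umklapp_resonance_pair[of "2 * N" z1 z2 z3 z4] sum w k(2) by auto
  qed
  then have "x1 = - x2 \<or> x1 = - x3 \<or> x1 = - x4 \<or> x2 = - x3 \<or> x2 = - x4 \<or> x3 = - x4"
    using pair[OF w(2) w(7)] pair[OF w(2) w(12)] pair[OF w(2) w(17)] pair[OF w(7) w(12)]
      pair[OF w(7) w(17)] pair[OF w(12) w(17)] w by auto
  then have "x1 = - x2 \<and> x3 = - x4 \<or> x1 = - x3 \<and> x2 = - x4 \<or> x1 = - x4 \<and> x2 = - x3"
    using res unfolding x[symmetric] by linarith
  then show ?thesis
    unfolding x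
    using sign_sin_eq[OF k(1,2) k(3,4) s(1) s(2)] sign_sin_eq[OF k(5,6) k(7,8) s(3) s(4)]
      sign_sin_eq[OF k(1,2) k(5,6) s(1) s(3)] sign_sin_eq[OF k(3,4) k(7,8) s(2) s(4)]
      sign_sin_eq[OF k(1,2) k(7,8) s(1) s(4)] sign_sin_eq[OF k(3,4) k(5,6) s(2) s(3)] by blast
qed

section \<open>Hamiltonian vectors and Poisson brackets\<close>

lemma symplectic_form_linear:
  "symplectic_form (x + y) z = symplectic_form x z + symplectic_form y z"
  "symplectic_form x (y + z) = symplectic_form x y + symplectic_form x z"
  "symplectic_form (r *\<^sub>R x) z = r * symplectic_form x z"
  "symplectic_form x (r *\<^sub>R z) = r * symplectic_form x z"
  "symplectic_form (x - y) z = symplectic_form x z - symplectic_form y z"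
  "symplectic_form (- x) z = - symplectic_form x z"
  by (simp_all add: symplectic_form_def sum_distrib_left algebra_simps
      flip: sum.distrib sum_subtractf sum_negf)

lemma symplectic_form_self: "symplectic_form x x = 0"
  by (simp add: symplectic_form_def)

lemma symplectic_form_antisym: "symplectic_form x z = - symplectic_form z x"
  unfolding symplectic_form_def sum_negf[symmetric] by (intro sum.cong refl) simp

lemma bounded_linear_symplectic_form: "bounded_linear (symplectic_form v)"
  by (rule linear_conv_bounded_linear[THEN iffD1], rule linearI) (simp_all add: symplectic_form_linear)

lemmas symplectic_form_has_derivative [derivative_intros] =
  bounded_linear.has_derivative[OF bounded_linear_symplectic_form]

definition hamiltonian_vector :: "('n::finite phase \<Rightarrow> real) \<Rightarrow> 'n phase" where
  "hamiltonian_vector G' = (\<chi> i. G' (0, axis i 1), \<chi> i. - G' (axis i 1, 0))"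

text \<open>Functions of \<open>symplectic_form v\<close> alone therefore have a Hamiltonian vector
  field along the fixed direction \<open>v\<close>, and their flows are shears.\<close>

lemma hamiltonian_vector_symplectic_form: "hamiltonian_vector (\<lambda>w. r * symplectic_form v w) = r *\<^sub>R v"
  by (simp add: hamiltonian_vector_def symplectic_form_def prod_eq_iff vec_eq_iff axis_def if_distrib
      if_distribR sum_negf cong: if_cong)

lemma linear_phase_expand:
  fixes F' :: "'n::finite phase \<Rightarrow> real"
  assumes "linear F'"
  shows "F' w = (\<Sum>i\<in>UNIV. fst w $ i * F' (axis i 1, 0) + snd w $ i * F' (0, axis i 1))"
proof -
  interpret linear F' by fact
  have "w = (\<Sum>i\<in>UNIV. fst w $ i *\<^sub>R (axis i 1, 0) + snd w $ i *\<^sub>R (0, axis i 1))"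
    by (simp add: prod_eq_iff fst_sum snd_sum vec_eq_iff axis_def if_distrib cong: if_cong)
  then have "F' w = F' (\<Sum>i\<in>UNIV. fst w $ i *\<^sub>R (axis i 1, 0) + snd w $ i *\<^sub>R (0, axis i 1))" by simp
  also have "\<dots> = (\<Sum>i\<in>UNIV. fst w $ i * F' (axis i 1, 0) + snd w $ i * F' (0, axis i 1))"
    by (simp only: sum add scale real_scaleR_def)
  finally show ?thesis .
qed

text \<open>The bracket becomes a directional derivative, the form in which Taylor expansion along a
  shear produces it.\<close>

lemma poisson_bracket_eq:
  assumes F: "(F has_derivative F') (at z)" and G: "(G has_derivative G') (at z)"
  shows "poisson_bracket F G z = F' (hamiltonian_vector G')"
proof -
  have "poisson_bracket F G z
      = (\<Sum>i\<in>UNIV. F' (axis i 1, 0) * G' (0, axis i 1) - F' (0, axis i 1) * G' (axis i 1, 0))"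
    unfolding poisson_bracket_def partial_Q_def partial_P_def
      frechet_derivative_at[OF F, symmetric] frechet_derivative_at[OF G, symmetric] ..
  also have "\<dots> = F' (hamiltonian_vector G')"
    by (subst linear_phase_expand[OF has_derivative_linear[OF F]])
      (simp add: hamiltonian_vector_def mult.commute)
  finally show ?thesis .
qed

lemma poisson_bracket_antisym: "poisson_bracket F G z = - poisson_bracket G F z"
  by (simp add: poisson_bracket_def sum_negf[symmetric] algebra_simps)

lemma frechet_derivative_add:
  assumes "F differentiable (at z)" "G differentiable (at z)"
  shows "frechet_derivative (\<lambda>z. F z + G z) (at z) = (\<lambda>w. frechet_derivative F (at z) w + frechet_derivative G (at z) w)"
  by (rule frechet_derivative_at[symmetric], rule has_derivative_add)
    (use assms frechet_derivative_works in blast)+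

lemma poisson_bracket_add_left:
  assumes "F differentiable (at z)" "G differentiable (at z)"
  shows "poisson_bracket (\<lambda>z. F z + G z) K z = poisson_bracket F K z + poisson_bracket G K z"
  using assms
  by (simp add: poisson_bracket_def partial_Q_def partial_P_def frechet_derivative_add
      sum.distrib[symmetric] algebra_simps)

lemma poisson_bracket_add_right:
  assumes "F differentiable (at z)" "G differentiable (at z)"
  shows "poisson_bracket K (\<lambda>z. F z + G z) z = poisson_bracket K F z + poisson_bracket K G z"
  using poisson_bracket_add_left[OF assms, of K]
  by (simp add: poisson_bracket_antisym[of K])

lemma poisson_bracket_cmult_left:
  assumes "F differentiable (at z)"
  shows "poisson_bracket (\<lambda>z. c * F z) K z = c * poisson_bracket F K z"
proof -
  have "frechet_derivative (\<lambda>z. c * F z) (at z) = (\<lambda>w. c * frechet_derivative F (at z) w)"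
    by (rule frechet_derivative_at[symmetric], rule has_derivative_mult_right)
      (use assms frechet_derivative_works in blast)
  then show ?thesis
    by (simp add: poisson_bracket_def partial_Q_def partial_P_def sum_distrib_left algebra_simps)
qed

lemma poisson_bracket_cmult_right:
  assumes "F differentiable (at z)"
  shows "poisson_bracket K (\<lambda>z. c * F z) z = c * poisson_bracket K F z"
  using poisson_bracket_cmult_left[OF assms, of c K] by (simp add: poisson_bracket_antisym[of K])

lemma poisson_bracket_const: "poisson_bracket (\<lambda>z. c) K z = 0"
  by (simp add: poisson_bracket_def partial_Q_def partial_P_def frechet_derivative_const)

section \<open>Polynomials sorted by the modes of their monomials\<close>

text \<open>\<open>modal K F\<close>: the monomials of \<open>F\<close> have their list of mode indices in \<open>K\<close>, for a suitable order of
  the factors.\<close>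

inductive modal :: "'n::finite list set \<Rightarrow> ('n phase \<Rightarrow> real) \<Rightarrow> bool" where
  zero: "modal K (\<lambda>z. 0)"
| const: "[] \<in> K \<Longrightarrow> modal K (\<lambda>z. c)"
| mult: "modal {ks. k # ks \<in> K} F \<Longrightarrow> modal K (\<lambda>z. (a * fst z $ k + b * snd z $ k) * F z)"
| add: "modal K F \<Longrightarrow> modal K G \<Longrightarrow> modal K (\<lambda>z. F z + G z)"

abbreviation "homog d \<equiv> modal {ks. length ks = d}"

lemma modal_mono: "modal K F \<Longrightarrow> K \<subseteq> L \<Longrightarrow> modal L F"
proof (induction arbitrary: L rule: modal.induct)
  case (mult k K F a b)
  show ?case by (rule modal.mult, rule mult.IH) (use mult.prems in auto)
qed (auto intro: modal.zero modal.const modal.add)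

lemma modal_mult':
  assumes "modal K F" "\<And>ks. ks \<in> K \<Longrightarrow> k # ks \<in> L"
  shows "modal L (\<lambda>z. (a * fst z $ k + b * snd z $ k) * F z)"
proof -
  have "K \<subseteq> {ks. k # ks \<in> L}" using assms(2) by blast
  from modal.mult[OF modal_mono[OF assms(1) this]] show ?thesis .
qed

lemma modal_append:
  "modal K F \<Longrightarrow> modal L G \<Longrightarrow> modal {ks @ ls |ks ls. ks \<in> K \<and> ls \<in> L} (\<lambda>z. F z * G z)"
proof (induction rule: modal.induct)
  case (const K c)
  have "modal L (\<lambda>z. c * G z)" using const.prems
  proof (induction rule: modal.induct)
    case (mult k L G a b)
    show ?case using modal.mult[OF mult.IH, of a b] by (simp add: mult_ac)
  next
    case (add L F G)
    show ?case using modal.add[OF add.IH] by (simp add: distrib_left)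
  qed (auto intro: modal.zero modal.const modal.add)
  then show ?case by (rule modal_mono) (use const in force)
next
  case (mult k K F a b)
  then have "modal {ks @ ls |ks ls. k # ks \<in> K \<and> ls \<in> L} (\<lambda>z. F z * G z)" by simp
  then show ?case unfolding mult.assoc
    by (rule modal_mult') (force intro: exI[of _ "_ # _"])
next
  case (add K F1 F2)
  then show ?case using modal.add by (fastforce simp: distrib_right)
qed (auto intro: modal.zero modal.const modal.add)

lemma modal_cmult: "modal K F \<Longrightarrow> modal K (\<lambda>z. c * F z)"
  by (rule modal_mono[OF modal_append[OF modal.const[of "{[]}" c]]]) auto

lemma modal_sum: "(\<And>i. i \<in> A \<Longrightarrow> modal K (f i)) \<Longrightarrow> modal K (\<lambda>z. \<Sum>i\<in>A. f i z)"
  by (induction A rule: infinite_finite_induct) (auto intro: modal.zero modal.const modal.add)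

lemma modal_empty: "modal K F \<Longrightarrow> K = {} \<Longrightarrow> F z = 0"
  by (induction rule: modal.induct) auto

lemma bounded_linear_mode:
  "bounded_linear (\<lambda>z::'n::finite phase. a * fst z $ k + b * snd z $ k)"
  by (intro bounded_linear_add bounded_linear_const_mult bounded_linear_compose[OF bounded_linear_vec_nth]
      bounded_linear_fst bounded_linear_snd)

lemma modal_polynomial: "modal K F \<Longrightarrow> real_polynomial_function F"
  by (induction rule: modal.induct)
    (auto intro: real_polynomial_function.intros(2-4) real_polynomial_function.intros(1)[OF bounded_linear_mode])

lemma modal_differentiable: "modal K F \<Longrightarrow> F differentiable (at z)"
  using modal_polynomial differentiable_at_real_polynomial_function by blast

lemma modal_has_derivative: "modal K F \<Longrightarrow> (F has_derivative frechet_derivative F (at z)) (at z)"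
  using modal_differentiable frechet_derivative_works by blast

lemma modal_homogeneous:
  "modal K F \<Longrightarrow> K \<subseteq> {ks. length ks = d} \<Longrightarrow> F (c *\<^sub>R z) = c ^ d * F z"
proof (induction arbitrary: d rule: modal.induct)
  case (mult k K F a b)
  show ?case
  proof (cases d)
    case 0
    then have "{ks. k # ks \<in> K} = {}" using mult.prems by auto
    then show ?thesis using modal_empty[OF mult.hyps] by simp
  next
    case (Suc d')
    have "F (c *\<^sub>R z) = c ^ d' * F z" using mult.prems Suc by (intro mult.IH) auto
    then show ?thesis by (simp add: Suc algebra_simps)
  qed
qed (auto simp: distrib_left)

lemma homog_homogeneous_polynomial: "homog d F \<Longrightarrow> homogeneous_polynomial d F"
  unfolding homogeneous_polynomial_def using modal_polynomial modal_homogeneous by blast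

lemma mode_product_derivative:
  assumes "modal K F"
  shows "frechet_derivative (\<lambda>z. (a * fst z $ k + b * snd z $ k) * F z) (at z) w
    = (a * fst w $ k + b * snd w $ k) * F z + (a * fst z $ k + b * snd z $ k) * frechet_derivative F (at z) w"
proof -
  have "((\<lambda>z. (a * fst z $ k + b * snd z $ k) * F z) has_derivative
    (\<lambda>w. (a * fst z $ k + b * snd z $ k) * frechet_derivative F (at z) w + (a * fst w $ k + b * snd w $ k) * F z)) (at z)"
    by (rule has_derivative_mult[OF bounded_linear_imp_has_derivative[OF bounded_linear_mode]
        modal_has_derivative[OF assms]])
  from frechet_derivative_at[OF this, symmetric] show ?thesis by simp
qed

text \<open>Multisets are compared because differentiation may strike a factor at any position of
  the list.\<close>

definition remove_mode :: "'n \<Rightarrow> 'n list set \<Rightarrow> 'n list set" where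
  "remove_mode i K = {ks'. \<exists>ks\<in>K. mset ks = add_mset i (mset ks')}"

lemma modal_derivative:
  assumes "modal K F" and e: "\<And>k. k \<noteq> i \<Longrightarrow> fst e $ k = 0 \<and> snd e $ k = 0"
  shows "modal (remove_mode i K) (\<lambda>z. frechet_derivative F (at z) e)"
  using assms(1)
proof induction
  case (mult k K F a b)
  have 1: "modal (remove_mode i K) (\<lambda>z. (a * fst e $ k + b * snd e $ k) * F z)"
  proof (cases "k = i")
    case True
    show ?thesis
      by (intro modal_cmult modal_mono[OF mult.hyps]) (force simp: remove_mode_def True)
  next
    case False
    then show ?thesis using e by (simp add: modal.zero)
  qed
  have 2: "modal (remove_mode i K) (\<lambda>z. (a * fst z $ k + b * snd z $ k) * frechet_derivative F (at z) e)"
    by (rule modal_mult'[OF mult.IH]) (force simp: remove_mode_def)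
  show ?case unfolding mode_product_derivative[OF mult.hyps] by (rule modal.add[OF 1 2])
next
  case (add K F G)
  have "frechet_derivative (\<lambda>z. F z + G z) (at z) e = frechet_derivative F (at z) e + frechet_derivative G (at z) e" for z
    by (simp add: frechet_derivative_add modal_differentiable[OF add.hyps(1)] modal_differentiable[OF add.hyps(2)])
  then show ?case using modal.add[OF add.IH] by simp
qed (auto simp: frechet_derivative_const intro: modal.zero)

text \<open>Every term of the bracket differentiates both arguments with respect to the same mode
  \<open>i\<close>, so it removes one common index from the two lists and joins what is
  left.\<close>

lemma modal_poisson_bracket:
  assumes "modal K F" "modal L G"
    and "\<And>i ks ls. ks \<in> remove_mode i K \<Longrightarrow> ls \<in> remove_mode i L \<Longrightarrow> ks @ ls \<in> M"
  shows "modal M (poisson_bracket F G)"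
proof -
  have "modal M (\<lambda>z. frechet_derivative F (at z) e * frechet_derivative G (at z) e')"
    if "\<And>k. k \<noteq> i \<Longrightarrow> fst e $ k = 0 \<and> snd e $ k = 0" "\<And>k. k \<noteq> i \<Longrightarrow> fst e' $ k = 0 \<and> snd e' $ k = 0" for i e e'
    by (rule modal_mono[OF modal_append[OF modal_derivative[OF assms(1), of i e] modal_derivative[OF assms(2), of i e']]])
      (use that assms(3) in blast)+
  note * = this
  have "modal M (\<lambda>z. partial_Q i F z * partial_P i G z)" "modal M (\<lambda>z. partial_P i F z * partial_Q i G z)" for i
    unfolding partial_Q_def partial_P_def by (rule *[of i]; simp add: axis_def)+
  then have "modal M (\<lambda>z. \<Sum>i\<in>UNIV. partial_Q i F z * partial_P i G z + (-1) * (partial_P i F z * partial_Q i G z))"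
    by (intro modal_sum modal.add modal_cmult)
  then show ?thesis unfolding poisson_bracket_def by simp
qed

lemma homog_poisson_bracket: "homog (Suc p) F \<Longrightarrow> homog (Suc q) G \<Longrightarrow> homog (p + q) (poisson_bracket F G)"
  by (erule modal_poisson_bracket, assumption)
    (auto simp: remove_mode_def dest!: arg_cong[of "mset _" _ size])

lemma mode_eq_symplectic_form:
  "a * fst z $ k + b * snd z $ k = symplectic_form (axis k b, - axis k a) z"
  by (simp add: symplectic_form_def axis_def if_distrib if_distribR sum_subtractf sum_negf cong: if_cong)

lemma modal_symplectic_form_mult:
  assumes "homog d F"
  shows "homog (Suc d) (\<lambda>z. symplectic_form v z * F z)"
proof -
  have "homog (Suc d) (\<lambda>z. \<Sum>i\<in>UNIV. (- snd v $ i * fst z $ i + fst v $ i * snd z $ i) * F z)"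
    by (intro modal_sum modal_mult'[OF assms]) simp
  moreover have "symplectic_form v z * F z = (\<Sum>i\<in>UNIV. (- snd v $ i * fst z $ i + fst v $ i * snd z $ i) * F z)" for z
    unfolding symplectic_form_def sum_distrib_right by (intro sum.cong refl) (simp add: algebra_simps)
  ultimately show ?thesis by simp
qed

lemma homog_power: "homog d (\<lambda>z. c * symplectic_form v z ^ d)"
proof (induction d)
  case 0
  then show ?case by (simp add: modal.const)
next
  case (Suc d)
  show ?case using modal_symplectic_form_mult[OF Suc, of v] by (simp add: mult_ac)
qed

section \<open>Polarization: forms of degree at most four as sums of powers of linear forms\<close>

inductive power_sum :: "nat \<Rightarrow> ('n::finite phase \<Rightarrow> real) \<Rightarrow> bool" for d where
  zero: "power_sum d (\<lambda>z. 0)"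
| add: "power_sum d F \<Longrightarrow> power_sum d (\<lambda>z. F z + c * symplectic_form v z ^ d)"

lemma power_sum_homog: "power_sum d F \<Longrightarrow> homog d F"
  by (induction rule: power_sum.induct) (auto intro: modal.zero modal.add homog_power)

lemma power_sum_plus:
  assumes "power_sum d F" "power_sum d G"
  shows "power_sum d (\<lambda>z. F z + G z)"
  using assms(2)
proof induction
  case (add G c v)
  then show ?case using power_sum.add[of d "\<lambda>z. F z + G z" c v] by (simp add: add.assoc)
qed (use assms(1) in simp)

lemma power_sum_1: "power_sum d (\<lambda>z. c * symplectic_form v z ^ d)"
  using power_sum.add[OF power_sum.zero, of d c v] by simp

text \<open>Polarization identities write a linear form times the \<open>d\<close>-th power of
  another as a combination of powers of their combinations. As the symplectic form is nondegenerate,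
  \<open>symplectic_form v\<close> ranges over all linear forms.\<close>

lemma power_sum_linear_mult:
  assumes "power_sum d F" "d \<le> 3"
  shows "power_sum (Suc d) (\<lambda>z. symplectic_form u z * F z)"
  using assms(1)
proof induction
  case zero
  then show ?case by (simp add: power_sum.zero)
next
  case (add F c v)
  let ?w = "\<lambda>x y z. symplectic_form (x *\<^sub>R u + y *\<^sub>R v) z ^ Suc d"
  have "power_sum (Suc d) (\<lambda>z. symplectic_form u z * (c * symplectic_form v z ^ d))"
  proof -
    have "d = 0 \<or> d = 1 \<or> d = 2 \<or> d = 3" using assms(2) by linarith
    \<comment> \<open>Four powers suffice for every degree up to 4; the lower degrees are padded
      with zero coefficients.\<close>
    moreover have "power_sum (Suc d) (\<lambda>z. c1 * ?w x1 y1 z + c2 * ?w x2 y2 z + c3 * ?w x3 y3 z + c4 * ?w x4 y4 z)"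
      for c1 c2 c3 c4 x1 x2 x3 x4 y1 y2 y3 y4
      by (intro power_sum_plus power_sum_1)
    moreover have "symplectic_form u z * (c * symplectic_form v z ^ d)
       = c * ?w 1 0 z + 0 * ?w 0 0 z + 0 * ?w 0 0 z + 0 * ?w 0 0 z" if "d = 0" for z
      using that by (simp add: symplectic_form_linear)
    moreover have "symplectic_form u z * (c * symplectic_form v z ^ d)
       = c / 4 * ?w 1 1 z + (- c / 4) * ?w 1 (-1) z + 0 * ?w 0 0 z + 0 * ?w 0 0 z" if "d = 1" for z
      using that by (simp add: symplectic_form_linear power2_eq_square field_simps)
    moreover have "symplectic_form u z * (c * symplectic_form v z ^ d)
       = c / 6 * ?w 1 1 z + c / 6 * ?w 1 (-1) z + (- c / 3) * ?w 1 0 z + 0 * ?w 0 0 z" if "d = 2" for z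
      using that by (simp add: symplectic_form_linear power2_eq_square power3_eq_cube field_simps)
    moreover have "symplectic_form u z * (c * symplectic_form v z ^ d)
       = c / 48 * ?w 1 2 z + (- c / 48) * ?w (-1) 2 z + (- c / 24) * ?w 1 1 z + c / 24 * ?w (-1) 1 z" if "d = 3" for z
      using that by (simp add: symplectic_form_linear power4_eq_xxxx power3_eq_cube field_simps)
    ultimately show ?thesis by (elim disjE) (simp_all only:)
  qed
  from power_sum_plus[OF add.IH this] show ?case by (simp only: distrib_left)
qed

lemma modal_power_sum:
  "modal K F \<Longrightarrow> K \<subseteq> {ks. length ks = d} \<Longrightarrow> d \<le> 4 \<Longrightarrow> power_sum d F"
proof (induction arbitrary: d rule: modal.induct)
  case (mult k K F a b)
  show ?case
  proof (cases d)
    case 0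
    then have "{ks. k # ks \<in> K} = {}" using mult.prems by auto
    then have "F z = 0" for z using modal_empty[OF mult.hyps] by simp
    then show ?thesis by (simp add: power_sum.zero)
  next
    case (Suc d')
    have "power_sum d' F" using mult.prems Suc by (intro mult.IH) auto
    then show ?thesis unfolding Suc mode_eq_symplectic_form
      by (rule power_sum_linear_mult) (use mult.prems Suc in simp)
  qed
next
  case (const K c)
  then have "d = 0" by auto
  then show ?case using power_sum_1[of 0 c 0] by simp
qed (auto intro: power_sum.zero power_sum_plus)

section \<open>Symplectic shears and their action on jets\<close>

lemma real_polynomial_directional_derivative:
  fixes f :: "'a::euclidean_space \<Rightarrow> real"
  shows "real_polynomial_function f \<Longrightarrow> real_polynomial_function (\<lambda>x. frechet_derivative f (at x) v)"
proof (induction rule: real_polynomial_function.induct)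
  case (linear f)
  then show ?case
    by (simp add: frechet_derivative_at[OF bounded_linear_imp_has_derivative[OF linear], symmetric]
        real_polynomial_function.intros(2))
next
  case (const c)
  then show ?case by (simp add: frechet_derivative_const real_polynomial_function.intros(2))
next
  case (add f g)
  have "frechet_derivative (\<lambda>x. f x + g x) (at x) v = frechet_derivative f (at x) v + frechet_derivative g (at x) v" for x
    by (subst frechet_derivative_at[OF has_derivative_add, symmetric])
      (auto simp: frechet_derivative_works[symmetric] add.hyps intro!: differentiable_at_real_polynomial_function)
  then show ?case using add.IH by (simp add: real_polynomial_function.intros(3))
next
  case (mult f g)
  have "frechet_derivative (\<lambda>x. f x * g x) (at x) v = f x * frechet_derivative g (at x) v + frechet_derivative f (at x) v * g x" for x
    by (subst frechet_derivative_at[OF has_derivative_mult, symmetric])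
      (auto simp: frechet_derivative_works[symmetric] mult.hyps intro!: differentiable_at_real_polynomial_function)
  then show ?case using mult
    by (simp add: real_polynomial_function.intros(3,4))
qed

lemma polynomial_directional_derivative:
  fixes f :: "'a::euclidean_space \<Rightarrow> 'b::euclidean_space"
  assumes "polynomial_function f"
  shows "polynomial_function (\<lambda>x. frechet_derivative f (at x) v)"
proof -
  have d: "(f has_derivative frechet_derivative f (at x)) (at x)" for x
    using differentiable_at_polynomial_function[OF assms] frechet_derivative_works by blast
  show ?thesis unfolding polynomial_function_def
  proof (intro allI impI)
    fix l :: "'b \<Rightarrow> real"
    assume l: "bounded_linear l"
    have "real_polynomial_function (\<lambda>x. frechet_derivative (l \<circ> f) (at x) v)"
      using assms l by (intro real_polynomial_directional_derivative) (auto simp: polynomial_function_def)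
    moreover have "frechet_derivative (l \<circ> f) (at x) = l \<circ> frechet_derivative f (at x)" for x
      using frechet_derivative_at[OF bounded_linear.has_derivative[OF l d[of x]]] by (simp add: o_def)
    ultimately show "real_polynomial_function (l \<circ> (\<lambda>x. frechet_derivative f (at x) v))"
      by (simp add: o_def)
  qed
qed

lemma smooth_on_polynomial:
  fixes f :: "'a::euclidean_space \<Rightarrow> 'b::euclidean_space"
  assumes "polynomial_function f"
  shows "smooth_on S f"
proof -
  have "Ck_on k S f" for k
    using assms
  proof (induction k arbitrary: f)
    case 0
    then show ?case by (simp add: continuous_on_polymonial_function)
  next
    case (Suc k)
    then show ?case by (simp add: differentiable_at_polynomial_function polynomial_directional_derivative)
  qed
  then show ?thesis by (simp add: smooth_on_def)
qed

section \<open>Polynomial symplectic automorphisms and shears\<close>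

definition polynomial_symplectic :: "('n::finite phase \<Rightarrow> 'n phase) \<Rightarrow> bool" where
  "polynomial_symplectic \<Phi> \<longleftrightarrow> polynomial_function \<Phi> \<and>
     (\<exists>\<Psi>. polynomial_function \<Psi> \<and> (\<forall>z. \<Psi> (\<Phi> z) = z) \<and> (\<forall>z. \<Phi> (\<Psi> z) = z)) \<and>
     (\<forall>z u w. symplectic_form (frechet_derivative \<Phi> (at z) u) (frechet_derivative \<Phi> (at z) w)
        = symplectic_form u w) \<and>
     \<Phi> 0 = 0 \<and> (\<Phi> has_derivative id) (at 0)"

text \<open>The inverse is required to be polynomial too, so it is smooth and the map is a
  diffeomorphism of the whole phase space; compositions need no shrinking neighbourhoods.\<close>

lemma polynomial_symplectic_diffeo:
  assumes "polynomial_symplectic \<Phi>"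
  shows "symplectic_diffeo UNIV \<Phi>"
proof -
  obtain \<Psi> where \<Psi>: "polynomial_function \<Psi>" "\<And>z. \<Psi> (\<Phi> z) = z" "\<And>z. \<Phi> (\<Psi> z) = z"
    using assms unfolding polynomial_symplectic_def by blast
  have inj: "inj \<Phi>" by (metis \<Psi>(2) injI)
  have surj: "range \<Phi> = UNIV" by (metis \<Psi>(3) surjI)
  have "inv_into UNIV \<Phi> = \<Psi>" by (metis \<Psi>(3) inj ext inv_f_f)
  then show ?thesis
    unfolding symplectic_diffeo_def surj
    using assms inj \<Psi>(1) by (auto simp: polynomial_symplectic_def smooth_on_polynomial)
qed

lemma polynomial_symplectic_id: "polynomial_symplectic (\<lambda>z. z)"
  unfolding polynomial_symplectic_def
  by (auto simp: frechet_derivative_ident has_derivative_ident id_def)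

lemma polynomial_symplectic_comp:
  assumes F: "polynomial_symplectic F" and G: "polynomial_symplectic G"
  shows "polynomial_symplectic (F \<circ> G)"
proof -
  obtain F' where F': "polynomial_function F'" "\<And>z. F' (F z) = z" "\<And>z. F (F' z) = z"
    using F unfolding polynomial_symplectic_def by blast
  obtain G' where G': "polynomial_function G'" "\<And>z. G' (G z) = z" "\<And>z. G (G' z) = z"
    using G unfolding polynomial_symplectic_def by blast
  have d: "(F has_derivative frechet_derivative F (at z)) (at z)" "(G has_derivative frechet_derivative G (at z)) (at z)" for z
    using F G unfolding polynomial_symplectic_def
    by (metis differentiable_at_polynomial_function frechet_derivative_works)+
  have 1: "frechet_derivative (F \<circ> G) (at z) = frechet_derivative F (at (G z)) \<circ> frechet_derivative G (at z)" for z
    by (rule frechet_derivative_at[symmetric], rule diff_chain_at; rule d)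
  have 2: "(F \<circ> G has_derivative id) (at 0)"
    using diff_chain_at[of G id 0 F id] F G by (simp add: polynomial_symplectic_def)
  have "polynomial_function (G' \<circ> F')" "polynomial_function (F \<circ> G)"
    using F G F' G' by (auto intro!: polynomial_function_compose simp: polynomial_symplectic_def)
  moreover have symp: "symplectic_form (frechet_derivative F (at z) u) (frechet_derivative F (at z) w) = symplectic_form u w"
    "symplectic_form (frechet_derivative G (at z) u) (frechet_derivative G (at z) w) = symplectic_form u w" for z u w
    using F G unfolding polynomial_symplectic_def by blast+
  moreover have "(G' \<circ> F') ((F \<circ> G) z) = z" "(F \<circ> G) ((G' \<circ> F') z) = z" for z
    by (simp_all add: F' G')
  ultimately show ?thesis
    unfolding polynomial_symplectic_def 1
    using F G 2 symp unfolding polynomial_symplectic_def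
    by (intro conjI exI[of _ "G' \<circ> F'"]) simp_all
qed

definition shear :: "'n::finite phase \<Rightarrow> real \<Rightarrow> nat \<Rightarrow> 'n phase \<Rightarrow> 'n phase" where
  "shear v c d z = z + (c * symplectic_form v z ^ d) *\<^sub>R v"

lemma shear_has_derivative:
  "(shear v c d has_derivative (\<lambda>w. w + (c * (real d * symplectic_form v w * symplectic_form v z ^ (d - 1))) *\<^sub>R v)) (at z)"
  unfolding shear_def[abs_def]
  by (auto intro!: derivative_eq_intros simp: mult_ac)

text \<open>From \<open>symplectic_form v v = 0\<close> it follows that
  \<open>symplectic_form v\<close> is constant along the shear, so negating \<open>c\<close> inverts
  it. The derivative adds to \<open>w\<close> a multiple of \<open>v\<close> proportional to
  \<open>symplectic_form v w\<close>, and the cross terms cancel by antisymmetry. The condition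
  \<open>d \<ge> 2\<close> makes the derivative at 0 the identity.\<close>

lemma polynomial_symplectic_shear:
  assumes "d \<ge> 2"
  shows "polynomial_symplectic (shear v c d)"
proof -
  have poly: "polynomial_function (shear v c d)" for c
    unfolding shear_def[abs_def]
    by (intro polynomial_function_add polynomial_function_mult polynomial_function_const polynomial_function_id)
      (auto simp: real_polynomial_function_eq[symmetric]
        intro!: real_polynomial_function.intros(2-4) real_polynomial_function_power
        real_polynomial_function.intros(1)[OF bounded_linear_symplectic_form])
  have inv: "shear v (- c) d (shear v c d z) = z" for c z
    by (simp add: shear_def symplectic_form_linear symplectic_form_self)
  have "symplectic_form (frechet_derivative (shear v c d) (at z) u) (frechet_derivative (shear v c d) (at z) w)
        = symplectic_form u w" for z u w
    using symplectic_form_antisym[of u v]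
    by (simp add: frechet_derivative_at[OF shear_has_derivative, symmetric] symplectic_form_linear
        symplectic_form_self algebra_simps)
  moreover have "(shear v c d has_derivative id) (at 0)"
    using shear_has_derivative[of v c d 0] assms
    by (simp add: id_def symplectic_form_def power_0_left)
  moreover have "shear v c d 0 = 0" using assms by (simp add: shear_def symplectic_form_def)
  ultimately show ?thesis
    unfolding polynomial_symplectic_def
    using poly inv[of c] inv[of "- c"] by (auto intro!: exI[of _ "shear v (- c) d"])
qed

section \<open>Order estimates and Taylor expansion near the origin\<close>

lemma norm_power_bigo: "n \<le> m \<Longrightarrow> (\<lambda>z::'a::real_normed_vector. norm z ^ m) \<in> O[nhds 0](\<lambda>z. norm z ^ n)"
proof (rule bigoI[of _ 1])
  assume "n \<le> m"
  have "\<forall>\<^sub>F z::'a in nhds 0. norm z < 1"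
    using eventually_nhds_metric[of "\<lambda>z::'a. norm z < 1" 0] by (auto intro!: exI[of _ 1])
  then show "\<forall>\<^sub>F z::'a in nhds 0. norm (norm z ^ m) \<le> 1 * norm (norm z ^ n)"
    by eventually_elim (simp add: power_decreasing \<open>n \<le> m\<close>)
qed

lemma norm_power_bigo_trans:
  "f \<in> O[nhds 0](\<lambda>z::'a::real_normed_vector. norm z ^ m) \<Longrightarrow> n \<le> m \<Longrightarrow> f \<in> O[nhds 0](\<lambda>z. norm z ^ n)"
  using landau_o.big_trans norm_power_bigo by blast

lemma norm_power_bigo_mult:
  "f \<in> O[nhds 0](\<lambda>z::'a::real_normed_vector. norm z ^ m) \<Longrightarrow> g \<in> O[nhds 0](\<lambda>z. norm z ^ n) \<Longrightarrow> m + n = p \<Longrightarrow>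
    (\<lambda>z. f z * g z :: real) \<in> O[nhds 0](\<lambda>z. norm z ^ p)"
  using landau_o.big_mult[of f "nhds 0" "\<lambda>z. norm z ^ m" g "\<lambda>z. norm z ^ n"] by (auto simp: power_add)

lemma bounded_linear_bigo:
  assumes "bounded_linear l" "(\<lambda>z. norm (h z)) \<in> O[nhds 0](\<lambda>z::'a::real_normed_vector. norm z ^ m)"
  shows "(\<lambda>z. l (h z) :: real) \<in> O[nhds 0](\<lambda>z. norm z ^ m)"
proof -
  obtain K where K: "\<And>x. norm (l x) \<le> norm x * K" using bounded_linear.bounded[OF assms(1)] by blast
  have "(\<lambda>z. l (h z)) \<in> O[nhds 0](\<lambda>z. norm (h z))"
    by (rule bigoI[of _ K]) (use K in \<open>auto simp: mult.commute\<close>)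
  then show ?thesis using assms(2) landau_o.big_trans by blast
qed

text \<open>Each derivative costs one degree and each factor \<open>h\<close> contributes
  \<open>Suc e\<close>, so every order of the expansion gains \<open>e\<close>. The three estimates
  are proved together because the second and third for a product with a linear factor rest on the
  preceding ones for the other factor.\<close>

lemma modal_taylor:
  assumes "modal K F" "K \<subseteq> {ks. length ks = d}"
    and h: "(\<lambda>z. norm (h z)) \<in> O[nhds 0](\<lambda>z. norm z ^ Suc e)"
  shows "F \<in> O[nhds 0](\<lambda>z. norm z ^ d) \<and>
    (\<lambda>z. F (z + h z) - F z) \<in> O[nhds 0](\<lambda>z. norm z ^ (d + e)) \<and>
    (\<lambda>z. F (z + h z) - F z - frechet_derivative F (at z) (h z)) \<in> O[nhds 0](\<lambda>z. norm z ^ (d + 2 * e))"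
  using assms(1,2)
proof (induction arbitrary: d rule: modal.induct)
  case (const K c)
  then have "d = 0" by auto
  then show ?case by (simp add: frechet_derivative_const)
next
  case (mult k K F a b)
  define l where "l z = a * fst z $ k + b * snd z $ k" for z :: "'a phase"
  have l: "bounded_linear l" using bounded_linear_mode[of a k b] by (simp add: l_def[abs_def])
  have add: "l (x + y) = l x + l y" for x y by (simp add: l_def algebra_simps)
  have lh: "(\<lambda>z. l (h z)) \<in> O[nhds 0](\<lambda>z. norm z ^ Suc e)" by (rule bounded_linear_bigo[OF l h])
  have l1: "l \<in> O[nhds 0](\<lambda>z. norm z ^ 1)" using bounded_linear_bigo[OF l, of "\<lambda>z. z" 1] by simp
  have D: "frechet_derivative (\<lambda>z. l z * F z) (at z) w = l w * F z + l z * frechet_derivative F (at z) w" for z w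
    unfolding l_def by (rule mode_product_derivative[OF mult.hyps])
  show ?case
  proof (cases d)
    case 0
    then have "{ks. k # ks \<in> K} = {}" using mult.prems by auto
    then have "F = (\<lambda>z. 0)" using modal_empty[OF mult.hyps] by blast
    then show ?thesis by (simp add: frechet_derivative_const)
  next
    case (Suc d')
    have "{ks. k # ks \<in> K} \<subseteq> {ks. length ks = d'}" using mult.prems Suc by auto
    note IH = mult.IH[OF this]
    have 1: "(\<lambda>z. l z * F z) \<in> O[nhds 0](\<lambda>z. norm z ^ d)"
      by (rule norm_power_bigo_mult[OF l1]) (use IH Suc in auto)
    have "(\<lambda>z. l z * (F (z + h z) - F z) + l (h z) * (F (z + h z) - F z) + l (h z) * F z) \<in> O[nhds 0](\<lambda>z. norm z ^ (d + e))"
      by (intro sum_in_bigo(1) norm_power_bigo_mult[OF l1, of _ "d' + e"]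
          norm_power_bigo_trans[OF norm_power_bigo_mult[OF lh _ refl], of _ d']
          norm_power_bigo_trans[OF norm_power_bigo_mult[OF lh _ refl], of _ "d' + e"])
        (use IH Suc in auto)
    moreover have "l z * (F (z + h z) - F z) + l (h z) * (F (z + h z) - F z) + l (h z) * F z
      = l (z + h z) * F (z + h z) - l z * F z" for z by (simp add: add algebra_simps)
    ultimately have 2: "(\<lambda>z. l (z + h z) * F (z + h z) - l z * F z) \<in> O[nhds 0](\<lambda>z. norm z ^ (d + e))" by simp
    have "(\<lambda>z. l z * (F (z + h z) - F z - frechet_derivative F (at z) (h z)) + l (h z) * (F (z + h z) - F z))
      \<in> O[nhds 0](\<lambda>z. norm z ^ (d + 2 * e))"
      by (intro sum_in_bigo(1) norm_power_bigo_mult[OF l1, of _ "d' + 2 * e"] norm_power_bigo_mult[OF lh, of _ "d' + e"])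
        (use IH Suc in auto)
    moreover have "l z * (F (z + h z) - F z - frechet_derivative F (at z) (h z)) + l (h z) * (F (z + h z) - F z)
      = l (z + h z) * F (z + h z) - l z * F z - frechet_derivative (\<lambda>z. l z * F z) (at z) (h z)" for z
      unfolding add D by (simp add: algebra_simps)
    ultimately have 3: "(\<lambda>z. l (z + h z) * F (z + h z) - l z * F z - frechet_derivative (\<lambda>z. l z * F z) (at z) (h z))
      \<in> O[nhds 0](\<lambda>z. norm z ^ (d + 2 * e))" by simp
    show ?thesis using 1 2 3 by (simp add: l_def)
  qed
next
  case (add K F G)
  note IH = add.IH(1)[OF add.prems] add.IH(2)[OF add.prems]
  have D: "frechet_derivative (\<lambda>z. F z + G z) (at z) w = frechet_derivative F (at z) w + frechet_derivative G (at z) w" for z w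
    by (simp add: frechet_derivative_add modal_differentiable[OF add.hyps(1)] modal_differentiable[OF add.hyps(2)])
  have "(\<lambda>z. (F (z + h z) - F z) + (G (z + h z) - G z)) \<in> O[nhds 0](\<lambda>z. norm z ^ (d + e))"
    "(\<lambda>z. (F (z + h z) - F z - frechet_derivative F (at z) (h z)) +
       (G (z + h z) - G z - frechet_derivative G (at z) (h z))) \<in> O[nhds 0](\<lambda>z. norm z ^ (d + 2 * e))"
    "(\<lambda>z. F z + G z) \<in> O[nhds 0](\<lambda>z. norm z ^ d)"
    using IH by (auto intro: sum_in_bigo)
  then show ?case by (simp add: D algebra_simps)
qed (simp add: frechet_derivative_const)


section \<open>The action of shears on four-jets\<close>

definition jet4 :: "('n::finite phase \<Rightarrow> real) \<Rightarrow> ('n phase \<Rightarrow> real) \<Rightarrow> ('n phase \<Rightarrow> real) \<Rightarrow> ('n phase \<Rightarrow> real) \<Rightarrow> bool" where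
  "jet4 A2 A3 A4 H \<longleftrightarrow> (\<lambda>z. H z - (A2 z + A3 z + A4 z)) \<in> O[nhds 0](\<lambda>z. norm z ^ 5)"

lemma shear_increment_bigo:
  "(\<lambda>z. norm ((c * symplectic_form v z ^ d) *\<^sub>R v)) \<in> O[nhds 0](\<lambda>z. norm z ^ d)"
proof -
  have 1: "symplectic_form v \<in> O[nhds 0](\<lambda>z. norm z ^ 1)"
    using bounded_linear_bigo[OF bounded_linear_symplectic_form, of "\<lambda>z. z" 1] by simp
  have "(\<lambda>z. symplectic_form v z ^ d) \<in> O[nhds 0](\<lambda>z. norm z ^ d)"
    using landau_o.big_power[OF 1, of d] by simp
  then show ?thesis by (simp add: abs_mult)
qed

lemma shear_filterlim:
  assumes "d \<ge> 1"
  shows "filterlim (shear v c d) (nhds 0) (nhds 0)"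
proof -
  have "isCont (shear v c d) 0" using shear_has_derivative has_derivative_continuous by blast
  moreover have "shear v c d 0 = 0" using assms by (simp add: shear_def symplectic_form_def)
  ultimately show ?thesis using tendsto_at_iff_tendsto_nhds[of "shear v c d" 0] by (simp add: isCont_def)
qed

lemma shear_norm_bigo:
  assumes "d \<ge> 1"
  shows "(\<lambda>z. norm (shear v c d z)) \<in> O[nhds 0](\<lambda>z. norm z)"
proof -
  have "(\<lambda>z. norm z + norm ((c * symplectic_form v z ^ d) *\<^sub>R v)) \<in> O[nhds 0](\<lambda>z. norm z ^ 1)"
    by (intro sum_in_bigo norm_power_bigo_trans[OF shear_increment_bigo]) (use assms in auto)
  moreover have "(\<lambda>z. norm (shear v c d z)) \<in> O[nhds 0](\<lambda>z. norm z + norm ((c * symplectic_form v z ^ d) *\<^sub>R v))"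
  proof (intro landau_o.big_mono always_eventually allI)
    fix z
    have "norm (shear v c d z) \<le> norm z + norm ((c * symplectic_form v z ^ d) *\<^sub>R v)"
      unfolding shear_def by (rule norm_triangle_ineq)
    then show "norm (norm (shear v c d z)) \<le> norm (norm z + norm ((c * symplectic_form v z ^ d) *\<^sub>R v))"
      by simp
  qed
  ultimately show ?thesis using landau_o.big_trans by fastforce
qed

text \<open>A shear is \<open>O\<close> of the norm of its argument, so the remainder of order 5
  survives composition, and only the three explicit forms remain to be expanded.\<close>

lemma jet4_shear:
  assumes "jet4 A2 A3 A4 H" "d \<ge> 1"
    and "(\<lambda>z. A2 (shear v c d z) + A3 (shear v c d z) + A4 (shear v c d z) - (B2 z + B3 z + B4 z)) \<in> O[nhds 0](\<lambda>z. norm z ^ 5)"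
  shows "jet4 B2 B3 B4 (H \<circ> shear v c d)"
proof -
  let ?s = "shear v c d"
  have "(\<lambda>z. H (?s z) - (A2 (?s z) + A3 (?s z) + A4 (?s z))) \<in> O[nhds 0](\<lambda>z. norm (?s z) ^ 5)"
    by (rule landau_o.big.compose[OF assms(1)[unfolded jet4_def] shear_filterlim[OF assms(2)]])
  moreover have "(\<lambda>z. norm (?s z) ^ 5) \<in> O[nhds 0](\<lambda>z. norm z ^ 5)"
    by (rule landau_o.big_power[OF shear_norm_bigo[OF assms(2)]])
  ultimately have "(\<lambda>z. H (?s z) - (A2 (?s z) + A3 (?s z) + A4 (?s z))) \<in> O[nhds 0](\<lambda>z. norm z ^ 5)"
    by (rule landau_o.big_trans)
  from sum_in_bigo(1)[OF this assms(3)] show ?thesis by (simp add: jet4_def algebra_simps)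
qed

lemma power_hamiltonian_derivative:
  "((\<lambda>z. c * symplectic_form v z ^ Suc d) has_derivative
    (\<lambda>w. (c * real (Suc d) * symplectic_form v z ^ d) * symplectic_form v w)) (at z)"
  by (rule has_derivative_eq_rhs, rule has_derivative_mult_right, rule has_derivative_power,
      rule bounded_linear_imp_has_derivative[OF bounded_linear_symplectic_form])
    (simp add: mult_ac del: of_nat_Suc)

lemma poisson_bracket_power:
  assumes "(F has_derivative F') (at z)"
  shows "poisson_bracket F (\<lambda>z. c * symplectic_form v z ^ Suc d) z
     = F' ((c * real (Suc d) * symplectic_form v z ^ d) *\<^sub>R v)"
  unfolding poisson_bracket_eq[OF assms power_hamiltonian_derivative] hamiltonian_vector_symplectic_form ..

text \<open>Along a line \<open>A2\<close> expands exactly to second order, with \<open>B z\<close>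
  as its derivative at \<open>z\<close>. The FPU frequencies enter only later, through the
  homological equation.\<close>

locale quadratic_hamiltonian =
  fixes B :: "'n::finite phase \<Rightarrow> 'n phase \<Rightarrow> real" and A2 :: "'n phase \<Rightarrow> real"
  assumes bilinear: "bounded_bilinear B" and sym: "B x y = B y x"
    and A2_eq: "A2 z = B z z / 2" and A2_homog: "homog 2 A2"
begin

sublocale B: bounded_bilinear B by (rule bilinear)

lemma A2_derivative: "(A2 has_derivative B z) (at z)"
proof -
  have "((\<lambda>z. B z z / 2) has_derivative (\<lambda>w. (B z w + B w z) / 2)) (at z)"
    by (intro bounded_linear.has_derivative[OF bounded_linear_divide] B.FDERIV has_derivative_ident)
  moreover have "(\<lambda>w. (B z w + B w z) / 2) = B z"
    by (rule ext) (subst sym[of _ z], simp)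
  ultimately show ?thesis unfolding A2_eq[abs_def] by simp
qed

lemma A2_shift: "A2 (z + g *\<^sub>R v) = A2 z + g * B z v + g\<^sup>2 * A2 v"
  by (simp only: A2_eq B.add_left B.add_right B.scaleR_left B.scaleR_right sym[of v z]) (simp add: power2_eq_square field_simps)

text \<open>The shear is the time-one flow of \<open>f\<close>, and its displacement is quadratic.
  Up to degree 4 the expansion therefore reaches second order in \<open>A2\<close>, first order in
  \<open>A3\<close> and order zero in \<open>A4\<close>.\<close>

lemma jet4_cubic_shear:
  fixes c v defines "f \<equiv> \<lambda>z. c * symplectic_form v z ^ 3"
  assumes A3: "homog 3 A3" and A4: "homog 4 A4" and jet: "jet4 A2 A3 A4 H"
  shows "jet4 A2 (\<lambda>z. A3 z + poisson_bracket A2 f z)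
    (\<lambda>z. A4 z + poisson_bracket A3 f z + poisson_bracket (poisson_bracket A2 f) f z / 2) (H \<circ> shear v (3 * c) 2)"
proof (rule jet4_shear[OF jet])
  define h where "h z = (3 * c * symplectic_form v z ^ 2) *\<^sub>R v" for z
  have s: "shear v (3 * c) 2 z = z + h z" for z by (simp add: shear_def h_def)
  have h: "(\<lambda>z. norm (h z)) \<in> O[nhds 0](\<lambda>z. norm z ^ Suc 1)"
    using shear_increment_bigo[of "3 * c" v 2] by (simp add: h_def numeral_2_eq_2)
  have br: "poisson_bracket F f z = F' (h z)" if "(F has_derivative F') (at z)" for F F' z
    using poisson_bracket_power[OF that, of c v 2] by (simp add: f_def h_def mult_ac numeral_3_eq_3 numeral_2_eq_2)
  have b2: "poisson_bracket A2 f = (\<lambda>z. 3 * c * symplectic_form v z ^ 2 * B z v)"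
    by (rule ext) (simp add: br[OF A2_derivative] h_def B.scaleR_right)
  have "((\<lambda>z. 3 * c * symplectic_form v z ^ 2 * B z v) has_derivative
      (\<lambda>w. 3 * c * symplectic_form v z ^ 2 * B w v + 3 * c * (2 * symplectic_form v z * symplectic_form v w) * B z v)) (at z)" for z
    by (auto intro!: derivative_eq_intros B.FDERIV simp: B.zero_right)
  note d = this
  \<comment> \<open>Since \<open>symplectic_form v\<close> is constant along \<open>v\<close>, only
    the factor \<open>B z v\<close> is differentiated. Half of the result is exactly the quadratic
    term of \<open>A2_shift\<close>.\<close>
  have b22: "poisson_bracket (poisson_bracket A2 f) f z = 2 * (3 * c * symplectic_form v z ^ 2)\<^sup>2 * A2 v" for z
    unfolding b2 br[OF d] by (simp add: h_def B.scaleR_left symplectic_form_linear symplectic_form_self A2_eq power2_eq_square)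
  have e2: "A2 (z + h z) = A2 z + poisson_bracket A2 f z + poisson_bracket (poisson_bracket A2 f) f z / 2" for z
    unfolding b22 by (simp add: b2 h_def A2_shift)
  have "(\<lambda>z. A3 (z + h z) - A3 z - poisson_bracket A3 f z) \<in> O[nhds 0](\<lambda>z. norm z ^ 5)"
    using modal_taylor[OF A3 order_refl h] by (simp add: br[OF modal_has_derivative[OF A3]])
  moreover have "(\<lambda>z. A4 (z + h z) - A4 z) \<in> O[nhds 0](\<lambda>z. norm z ^ 5)"
    using modal_taylor[OF A4 order_refl h] by simp
  ultimately have "(\<lambda>z. (A3 (z + h z) - A3 z - poisson_bracket A3 f z) + (A4 (z + h z) - A4 z)) \<in> O[nhds 0](\<lambda>z. norm z ^ 5)"
    by (rule sum_in_bigo)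
  then show "(\<lambda>z. A2 (shear v (3 * c) 2 z) + A3 (shear v (3 * c) 2 z) + A4 (shear v (3 * c) 2 z) -
      (A2 z + (A3 z + poisson_bracket A2 f z) +
        (A4 z + poisson_bracket A3 f z + poisson_bracket (poisson_bracket A2 f) f z / 2))) \<in> O[nhds 0](\<lambda>z. norm z ^ 5)"
    unfolding s e2 by (simp add: algebra_simps)
qed simp

text \<open>The displacement is now cubic: the second-order term in \<open>A2\<close> and the
  first-order term in \<open>A4\<close> both have degree 6.\<close>

lemma jet4_quartic_shear:
  fixes c v defines "f \<equiv> \<lambda>z. c * symplectic_form v z ^ 4"
  assumes A4: "homog 4 A4" and jet: "jet4 A2 (\<lambda>z. 0) A4 H"
  shows "jet4 A2 (\<lambda>z. 0) (\<lambda>z. A4 z + poisson_bracket A2 f z) (H \<circ> shear v (4 * c) 3)"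
proof (rule jet4_shear[OF jet])
  define h where "h z = (4 * c * symplectic_form v z ^ 3) *\<^sub>R v" for z
  have s: "shear v (4 * c) 3 z = z + h z" for z by (simp add: shear_def h_def)
  have h: "(\<lambda>z. norm (h z)) \<in> O[nhds 0](\<lambda>z. norm z ^ Suc 2)"
    using shear_increment_bigo[of "4 * c" v 3] by (simp add: h_def numeral_3_eq_3)
  have br: "poisson_bracket F f z = F' (h z)" if "(F has_derivative F') (at z)" for F F' z
    using poisson_bracket_power[OF that, of c v 3] by (simp add: f_def h_def mult_ac eval_nat_numeral)
  have "(\<lambda>z. A2 (z + h z) - A2 z - poisson_bracket A2 f z) \<in> O[nhds 0](\<lambda>z. norm z ^ (2 + 2 * 2))"
    using modal_taylor[OF A2_homog order_refl h] by (simp add: br[OF modal_has_derivative[OF A2_homog]])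
  then have "(\<lambda>z. A2 (z + h z) - A2 z - poisson_bracket A2 f z) \<in> O[nhds 0](\<lambda>z. norm z ^ 5)"
    by (rule norm_power_bigo_trans) simp
  moreover have "(\<lambda>z. A4 (z + h z) - A4 z) \<in> O[nhds 0](\<lambda>z. norm z ^ 5)"
    by (rule norm_power_bigo_trans[of _ "4 + 2"]) (use modal_taylor[OF A4 order_refl h] in auto)
  ultimately have "(\<lambda>z. (A2 (z + h z) - A2 z - poisson_bracket A2 f z) + (A4 (z + h z) - A4 z)) \<in> O[nhds 0](\<lambda>z. norm z ^ 5)"
    by (rule sum_in_bigo)
  then show "(\<lambda>z. A2 (shear v (4 * c) 3 z) + 0 + A4 (shear v (4 * c) 3 z) -
      (A2 z + 0 + (A4 z + poisson_bracket A2 f z))) \<in> O[nhds 0](\<lambda>z. norm z ^ 5)"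
    unfolding s by (simp add: algebra_simps)
qed simp

lemma homog_bracket_2: "homog 3 F \<Longrightarrow> homog 3 (poisson_bracket A2 F)"
  "homog 4 F \<Longrightarrow> homog 4 (poisson_bracket A2 F)"
  using homog_poisson_bracket[of 1 A2 2 F] homog_poisson_bracket[of 1 A2 3 F] A2_homog
  by (simp_all add: eval_nat_numeral)

lemma homog_bracket_3: "homog 3 F \<Longrightarrow> homog 3 G \<Longrightarrow> homog 4 (poisson_bracket F G)"
  using homog_poisson_bracket[of 2 F 2 G] by (simp add: eval_nat_numeral)

text \<open>One shear per power: at degree 4 their effects simply add up. The map must be chosen
  before \<open>A4\<close> and \<open>H\<close>, so that the induction can apply it to the jet left
  by the other shears.\<close>

lemma quartic_transformation:
  assumes "power_sum 4 F"
  shows "\<exists>\<Phi>. polynomial_symplectic \<Phi> \<and> (\<forall>A4 H. homog 4 A4 \<longrightarrow> jet4 A2 (\<lambda>z. 0) A4 H \<longrightarrow>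
     jet4 A2 (\<lambda>z. 0) (\<lambda>z. A4 z + poisson_bracket A2 F z) (H \<circ> \<Phi>))"
  using assms
proof induction
  case zero
  show ?case
    using polynomial_symplectic_id
    by (intro exI[of _ "\<lambda>z. z"]) (simp add: o_def poisson_bracket_antisym[of A2] poisson_bracket_const)
next
  case (add F c v)
  obtain \<Phi> where \<Phi>: "polynomial_symplectic \<Phi>" "\<And>A4 H. homog 4 A4 \<Longrightarrow> jet4 A2 (\<lambda>z. 0) A4 H \<Longrightarrow>
     jet4 A2 (\<lambda>z. 0) (\<lambda>z. A4 z + poisson_bracket A2 F z) (H \<circ> \<Phi>)" using add.IH by blast
  let ?f = "\<lambda>z. c * symplectic_form v z ^ 4" and ?s = "shear v (4 * c) 3"
  have F: "homog 4 F" by (rule power_sum_homog[OF add.hyps])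
  show ?case
  proof (intro exI[of _ "\<Phi> \<circ> ?s"] conjI allI impI)
    show "polynomial_symplectic (\<Phi> \<circ> ?s)"
      by (intro polynomial_symplectic_comp \<Phi>(1) polynomial_symplectic_shear) simp
    fix A4 H assume A: "homog 4 A4" "jet4 A2 (\<lambda>z. 0) A4 H"
    have "jet4 A2 (\<lambda>z. 0) (\<lambda>z. (A4 z + poisson_bracket A2 F z) + poisson_bracket A2 ?f z) ((H \<circ> \<Phi>) \<circ> ?s)"
      by (intro jet4_quartic_shear modal.add \<Phi>(2) A homog_bracket_2 F)
    moreover have "poisson_bracket A2 (\<lambda>z. F z + ?f z) z = poisson_bracket A2 F z + poisson_bracket A2 ?f z" for z
      by (intro poisson_bracket_add_right modal_differentiable[OF F] modal_differentiable[OF homog_power])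
    ultimately show "jet4 A2 (\<lambda>z. 0) (\<lambda>z. A4 z + poisson_bracket A2 (\<lambda>z. F z + ?f z) z) (H \<circ> (\<Phi> \<circ> ?s))"
      by (simp add: o_assoc add.assoc)
  qed
qed

text \<open>Composing the shears symmetrically makes the terms of second order in the generators add up
  to half the iterated bracket with their sum, without commutators of the single generators.\<close>

lemma cubic_transformation:
  assumes "power_sum 3 F"
  shows "\<exists>\<Phi>. polynomial_symplectic \<Phi> \<and> (\<forall>A3 A4 H. homog 3 A3 \<longrightarrow> homog 4 A4 \<longrightarrow> jet4 A2 A3 A4 H \<longrightarrow>
     jet4 A2 (\<lambda>z. A3 z + poisson_bracket A2 F z)
       (\<lambda>z. A4 z + poisson_bracket A3 F z + poisson_bracket (poisson_bracket A2 F) F z / 2) (H \<circ> \<Phi>))"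
  using assms
proof induction
  case zero
  have "poisson_bracket G (\<lambda>z. 0) = (\<lambda>z. 0)" for G :: "'n phase \<Rightarrow> real"
    by (rule ext) (simp add: poisson_bracket_antisym[of G] poisson_bracket_const)
  then show ?case
    using polynomial_symplectic_id by (intro exI[of _ "\<lambda>z. z"]) (simp add: o_def)
next
  case (add F c v)
  obtain \<Phi> where \<Phi>: "polynomial_symplectic \<Phi>" "\<And>A3 A4 H. homog 3 A3 \<Longrightarrow> homog 4 A4 \<Longrightarrow> jet4 A2 A3 A4 H \<Longrightarrow>
     jet4 A2 (\<lambda>z. A3 z + poisson_bracket A2 F z)
       (\<lambda>z. A4 z + poisson_bracket A3 F z + poisson_bracket (poisson_bracket A2 F) F z / 2) (H \<circ> \<Phi>)"
    using add.IH by blast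
  \<comment> \<open>Half of the new power: its shear is applied on both sides of \<Phi>.\<close>
  define g where "g = (\<lambda>z. c / 2 * symplectic_form v z ^ 3)"
  define s where "s = shear v (3 * (c / 2)) 2"
  have F: "homog 3 F" by (rule power_sum_homog[OF add.hyps])
  have g: "homog 3 g" unfolding g_def by (rule homog_power)
  have step: "jet4 A2 (\<lambda>z. A3 z + poisson_bracket A2 g z)
       (\<lambda>z. A4 z + poisson_bracket A3 g z + poisson_bracket (poisson_bracket A2 g) g z / 2) (H \<circ> s)"
    if "homog 3 A3" "homog 4 A4" "jet4 A2 A3 A4 H" for A3 A4 H
    using jet4_cubic_shear[OF that, of "c / 2" v] by (simp only: g_def s_def)
  have brl: "poisson_bracket (\<lambda>z. G1 z + G2 z) K = (\<lambda>z. poisson_bracket G1 K z + poisson_bracket G2 K z)"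
    if "homog 3 G1" "homog 3 G2" for G1 G2 K
    by (intro ext poisson_bracket_add_left modal_differentiable[OF that(1)] modal_differentiable[OF that(2)])
  have br: "poisson_bracket K (\<lambda>z. F z + c * symplectic_form v z ^ 3) = (\<lambda>z. poisson_bracket K F z + 2 * poisson_bracket K g z)" for K
  proof
    fix z
    have "poisson_bracket K (\<lambda>z. F z + 2 * g z) z = poisson_bracket K F z + poisson_bracket K (\<lambda>z. 2 * g z) z"
      by (intro poisson_bracket_add_right modal_differentiable[OF F] modal_differentiable[OF modal_cmult[OF g]])
    also have "poisson_bracket K (\<lambda>z. 2 * g z) z = 2 * poisson_bracket K g z"
      by (intro poisson_bracket_cmult_right modal_differentiable[OF g])
    finally show "poisson_bracket K (\<lambda>z. F z + c * symplectic_form v z ^ 3) z = poisson_bracket K F z + 2 * poisson_bracket K g z"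
      by (simp add: g_def)
  qed
  have br2: "poisson_bracket (\<lambda>z. 2 * poisson_bracket A2 g z) K = (\<lambda>z. 2 * poisson_bracket (poisson_bracket A2 g) K z)" for K
    by (intro ext poisson_bracket_cmult_left modal_differentiable[OF homog_bracket_2(1)[OF g]])
  show ?case
  proof (intro exI[of _ "(s \<circ> \<Phi>) \<circ> s"] conjI allI impI)
    show "polynomial_symplectic (s \<circ> \<Phi> \<circ> s)"
      unfolding s_def by (intro polynomial_symplectic_comp \<Phi>(1) polynomial_symplectic_shear) simp_all
    fix A3 A4 H assume A: "homog 3 A3" "homog 4 A4" "jet4 A2 A3 A4 H"
    note hom = A homog_bracket_2(1)[OF F] homog_bracket_2(1)[OF g] modal.add modal_cmult[where c = "1/2"]
      homog_bracket_3[OF _ F] homog_bracket_3[OF _ g]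
    have half: "homog 4 (\<lambda>z. G z / 2)" if "homog 4 G" for G
      using modal_cmult[OF that, of "1 / 2"] by simp
    define B3 where "B3 = (\<lambda>z. A3 z + poisson_bracket A2 g z)"
    define B4 where "B4 = (\<lambda>z. A4 z + poisson_bracket A3 g z + poisson_bracket (poisson_bracket A2 g) g z / 2)"
    have B: "homog 3 B3" "homog 4 B4" unfolding B3_def B4_def by (intro hom half)+
    define C3 where "C3 = (\<lambda>z. B3 z + poisson_bracket A2 F z)"
    define C4 where "C4 = (\<lambda>z. B4 z + poisson_bracket B3 F z + poisson_bracket (poisson_bracket A2 F) F z / 2)"
    have C: "homog 3 C3" "homog 4 C4" unfolding C3_def C4_def by (intro hom half B)+
    \<comment> \<open>Writing the bracket as { , }, the three second-order contributions together
      with {{A2,g},F} and {{A2,F},g} add up to half of {{A2,F+2g},F+2g}.\<close>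
    have "jet4 A2 (\<lambda>z. C3 z + poisson_bracket A2 g z)
        (\<lambda>z. C4 z + poisson_bracket C3 g z + poisson_bracket (poisson_bracket A2 g) g z / 2) (((H \<circ> s) \<circ> \<Phi>) \<circ> s)"
      by (intro step C) (unfold C3_def C4_def, intro \<Phi>(2) B, unfold B3_def B4_def, intro step A)
    moreover have "poisson_bracket B3 K = (\<lambda>z. poisson_bracket A3 K z + poisson_bracket (poisson_bracket A2 g) K z)" for K
      unfolding B3_def by (intro brl hom)
    moreover have "poisson_bracket C3 K = (\<lambda>z. poisson_bracket B3 K z + poisson_bracket (poisson_bracket A2 F) K z)" for K
      unfolding C3_def by (intro brl hom B)
    moreover have "poisson_bracket (\<lambda>z. poisson_bracket A2 F z + 2 * poisson_bracket A2 g z) K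
        = (\<lambda>z. poisson_bracket (poisson_bracket A2 F) K z + 2 * poisson_bracket (poisson_bracket A2 g) K z)" for K
      by (subst brl[OF homog_bracket_2(1)[OF F] modal_cmult[OF homog_bracket_2(1)[OF g]]]) (simp only: br2)
    ultimately show "jet4 A2 (\<lambda>z. A3 z + poisson_bracket A2 (\<lambda>z. F z + c * symplectic_form v z ^ 3) z)
       (\<lambda>z. A4 z + poisson_bracket A3 (\<lambda>z. F z + c * symplectic_form v z ^ 3) z +
          poisson_bracket (poisson_bracket A2 (\<lambda>z. F z + c * symplectic_form v z ^ 3)) (\<lambda>z. F z + c * symplectic_form v z ^ 3) z / 2)
       (H \<circ> (s \<circ> \<Phi> \<circ> s))"
      by (simp add: br B3_def B4_def C3_def C4_def o_assoc algebra_simps add_divide_distrib)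
  qed
qed

end

section \<open>The selection rule and the homological equation\<close>

text \<open>The modes in \<open>A\<close> are counted with sign \<open>+\<close>, those in \<open>B\<close> with sign \<open>-\<close>.\<close>

definition admissible :: "('n::finite \<Rightarrow> nat) \<Rightarrow> 'n multiset \<Rightarrow> bool" where
  "admissible \<kappa> M \<longleftrightarrow> (\<exists>A B. M = A + B \<and>
     int (2 * CARD('n) + 2) dvd (\<Sum>i\<in>#A. int (\<kappa> i)) - (\<Sum>i\<in>#B. int (\<kappa> i)))"

abbreviation admissible_lists :: "('n::finite \<Rightarrow> nat) \<Rightarrow> nat \<Rightarrow> 'n list set" where
  "admissible_lists \<kappa> d \<equiv> {ks. length ks = d \<and> admissible \<kappa> (mset ks)}"

text \<open>Exchanging \<open>A\<close> and \<open>B\<close> negates the signed sum and preserves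
  divisibility, so the distinguished mode may always be given the sign +.\<close>

lemma admissible_add_mset:
  fixes \<kappa> :: "'n::finite \<Rightarrow> nat"
  assumes "admissible \<kappa> (add_mset i M)"
  obtains A B where "M = A + B"
    "int (2 * CARD('n) + 2) dvd int (\<kappa> i) + (\<Sum>i\<in>#A. int (\<kappa> i)) - (\<Sum>i\<in>#B. int (\<kappa> i))"
proof -
  obtain A B where AB: "add_mset i M = A + B"
    "int (2 * CARD('n) + 2) dvd (\<Sum>i\<in>#A. int (\<kappa> i)) - (\<Sum>i\<in>#B. int (\<kappa> i))"
    using assms unfolding admissible_def by blast
  have "i \<in># A + B" using AB(1) by (metis union_single_eq_member)
  then consider A' where "A = add_mset i A'" | B' where "B = add_mset i B'"
    by (metis insert_DiffM union_iff)
  then show ?thesis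
  proof cases
    case 1
    then have "M = A' + B" using AB(1) by simp
    then show ?thesis using AB(2) 1 by (intro that) simp_all
  next
    case 2
    then have "M = B' + A" using AB(1) by (simp add: add.commute)
    moreover have "int (2 * CARD('n) + 2) dvd - ((\<Sum>i\<in>#A. int (\<kappa> i)) - (\<Sum>i\<in>#B. int (\<kappa> i)))"
      using AB(2) by (simp only: dvd_minus_iff)
    then have "int (2 * CARD('n) + 2) dvd int (\<kappa> i) + (\<Sum>i\<in>#B'. int (\<kappa> i)) - (\<Sum>i\<in>#A. int (\<kappa> i))"
      using 2 by (simp add: algebra_simps)
    ultimately show ?thesis by (rule that)
  qed
qed

text \<open>Give the common mode the sign + in both signed sums and subtract them; the mode cancels.
  Hence brackets respect the selection rule.\<close>

lemma admissible_contract: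
  fixes \<kappa> :: "'n::finite \<Rightarrow> nat"
  assumes "admissible \<kappa> (add_mset i M)" "admissible \<kappa> (add_mset i L)"
  shows "admissible \<kappa> (M + L)"
proof -
  obtain A B where 1: "M = A + B"
    "int (2 * CARD('n) + 2) dvd int (\<kappa> i) + (\<Sum>i\<in>#A. int (\<kappa> i)) - (\<Sum>i\<in>#B. int (\<kappa> i))"
    using admissible_add_mset[OF assms(1)] .
  obtain C D where 2: "L = C + D"
    "int (2 * CARD('n) + 2) dvd int (\<kappa> i) + (\<Sum>i\<in>#C. int (\<kappa> i)) - (\<Sum>i\<in>#D. int (\<kappa> i))"
    using admissible_add_mset[OF assms(2)] .
  have "M + L = (A + D) + (B + C)" using 1(1) 2(1) by (simp add: add_ac)
  moreover have "int (2 * CARD('n) + 2) dvd (\<Sum>i\<in>#A + D. int (\<kappa> i)) - (\<Sum>i\<in>#B + C. int (\<kappa> i))"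
    using dvd_diff[OF 1(2) 2(2)] by (simp add: algebra_simps)
  ultimately show ?thesis unfolding admissible_def by blast
qed

text \<open>Turns the two-part splitting of a multiset into one sign per list position, as the
  resonance lemmas require.\<close>

lemma signs_of_partition:
  "mset ks = A + B \<Longrightarrow> \<exists>es. length es = length ks \<and> set es \<subseteq> {1, -1} \<and>
     (\<Sum>(e, k)\<leftarrow>zip es ks. e * int (\<kappa> k)) = (\<Sum>i\<in>#A. int (\<kappa> i)) - (\<Sum>i\<in>#B. int (\<kappa> i))"
proof (induction ks arbitrary: A B)
  case (Cons k ks)
  have "k \<in># A + B" using Cons.prems by (metis mset.simps(2) union_single_eq_member)
  then consider A' where "A = add_mset k A'" | B' where "B = add_mset k B'"
    by (metis insert_DiffM union_iff)
  then show ?case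
  proof cases
    case 1
    then have "mset ks = A' + B" using Cons.prems by simp
    from Cons.IH[OF this] obtain es where "length es = length ks" "set es \<subseteq> {1, -1}"
      "(\<Sum>(e, k)\<leftarrow>zip es ks. e * int (\<kappa> k)) = (\<Sum>i\<in>#A'. int (\<kappa> i)) - (\<Sum>i\<in>#B. int (\<kappa> i))" by blast
    then show ?thesis using 1 by (intro exI[of _ "1 # es"]) simp
  next
    case 2
    then have "mset ks = A + B'" using Cons.prems by simp
    from Cons.IH[OF this] obtain es where "length es = length ks" "set es \<subseteq> {1, -1}"
      "(\<Sum>(e, k)\<leftarrow>zip es ks. e * int (\<kappa> k)) = (\<Sum>i\<in>#A. int (\<kappa> i)) - (\<Sum>i\<in>#B'. int (\<kappa> i))" by blast
    then show ?thesis using 2 by (intro exI[of _ "(-1) # es"]) simp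
  qed
qed simp

section \<open>The selection rule for lattice sums\<close>

lemma sum_cos_odd_multiples:
  fixes x :: int and N :: nat
  assumes "\<not> int N dvd x" "N > 0"
  shows "(\<Sum>j<N. cos ((2 * real j + 1) * of_int x * pi / real N)) = 0"
proof -
  define t where "t = of_int x * pi / real N"
  \<comment> \<open>Multiplied by \<open>2 * sin t\<close>, the sum telescopes. At
    \<open>M = N\<close> the right side is the sine of a multiple of \<open>2 * pi\<close>, whereas
    \<open>sin t\<close> vanishes only if \<open>N\<close> divides \<open>x\<close>.\<close>
  have tele: "2 * sin t * (\<Sum>j<M. cos ((2 * real j + 1) * t)) = sin (2 * real M * t)" for M
  proof (induction M)
    case (Suc M)
    have "2 * sin t * cos ((2 * real M + 1) * t) = sin ((2 * real M + 1) * t + t) - sin ((2 * real M + 1) * t - t)"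
      by (simp only: sin_add sin_diff) simp
    also have "\<dots> = sin (2 * real (Suc M) * t) - sin (2 * real M * t)" by (simp add: algebra_simps)
    finally show ?case using Suc by (simp add: distrib_left)
  qed simp
  have "sin (2 * real N * t) = 0"
  proof -
    have "2 * real N * t = of_int (2 * x) * pi" using assms(2) by (simp add: t_def)
    then show ?thesis unfolding sin_zero_iff_int2 by blast
  qed
  then have "2 * sin t * (\<Sum>j<N. cos ((2 * real j + 1) * t)) = 0" using tele[of N] by (simp only:)
  moreover have "sin t \<noteq> 0"
  proof
    assume "sin t = 0"
    then obtain i :: int where "t = of_int i * pi" unfolding sin_zero_iff_int2 by blast
    then have "of_int x = (of_int (i * int N) :: real)" using assms(2) by (simp add: t_def field_simps)
    then have "x = i * int N" by (simp only: of_int_eq_iff)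
    then show False using assms(1) by simp
  qed
  ultimately have "(\<Sum>j<N. cos ((2 * real j + 1) * t)) = 0" by (simp only: mult_eq_0_iff) simp
  then show ?thesis by (simp add: t_def mult.assoc)
qed

text \<open>Product-to-sum formulas split the product into cosines of signed sums, each of which has
  lattice sum zero. The extra frequency \<open>x\<close> accumulates the signs already chosen in the
  induction.\<close>

lemma sum_cos_products:
  fixes \<kappa> :: "'n \<Rightarrow> nat" and x :: int
  assumes "N > 0" "\<And>A B. mset ks = A + B \<Longrightarrow> \<not> int N dvd x + (\<Sum>i\<in>#A. int (\<kappa> i)) - (\<Sum>i\<in>#B. int (\<kappa> i))"
  shows "(\<Sum>j<N. cos ((2 * real j + 1) * of_int x * pi / real N) *
     (\<Prod>k\<leftarrow>ks. cos ((2 * real j + 1) * real (\<kappa> k) * pi / real N))) = 0"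
  using assms(2)
proof (induction ks arbitrary: x)
  case Nil
  then show ?case using sum_cos_odd_multiples[of N x] assms(1) by simp
next
  case (Cons k ks)
  let ?P = "\<lambda>j. \<Prod>k\<leftarrow>ks. cos ((2 * real j + 1) * real (\<kappa> k) * pi / real N)"
  let ?c = "\<lambda>j y. cos ((2 * real j + 1) * of_int y * pi / real N)"
  have "?c j x * cos ((2 * real j + 1) * real (\<kappa> k) * pi / real N) = (?c j (x + int (\<kappa> k)) + ?c j (x - int (\<kappa> k))) / 2" for j
    unfolding cos_times_cos by (simp add: algebra_simps add_divide_distrib diff_divide_distrib)
  then have "?c j x * (\<Prod>k\<leftarrow>k # ks. cos ((2 * real j + 1) * real (\<kappa> k) * pi / real N))
    = (?c j (x + int (\<kappa> k)) * ?P j) / 2 + (?c j (x - int (\<kappa> k)) * ?P j) / 2" for j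
    by (simp only: list.map prod_list.Cons mult.assoc[symmetric] add_divide_distrib distrib_right times_divide_eq_left)
  then have "(\<Sum>j<N. ?c j x * (\<Prod>k\<leftarrow>k # ks. cos ((2 * real j + 1) * real (\<kappa> k) * pi / real N)))
    = (\<Sum>j<N. (?c j (x + int (\<kappa> k)) * ?P j) / 2 + (?c j (x - int (\<kappa> k)) * ?P j) / 2)"
    by (intro sum.cong refl)
  also have "\<dots> = (\<Sum>j<N. ?c j (x + int (\<kappa> k)) * ?P j) / 2 + (\<Sum>j<N. ?c j (x - int (\<kappa> k)) * ?P j) / 2"
    by (simp only: sum.distrib sum_divide_distrib)
  also have "(\<Sum>j<N. ?c j (x + int (\<kappa> k)) * ?P j) = 0"
  proof (rule Cons.IH)
    fix A B assume "mset ks = A + B"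
    then have "mset (k # ks) = add_mset k A + B" by simp
    from Cons.prems[OF this] show "\<not> int N dvd x + int (\<kappa> k) + (\<Sum>i\<in>#A. int (\<kappa> i)) - (\<Sum>i\<in>#B. int (\<kappa> i))"
      by (simp add: algebra_simps)
  qed
  also have "(\<Sum>j<N. ?c j (x - int (\<kappa> k)) * ?P j) = 0"
  proof (rule Cons.IH)
    fix A B assume "mset ks = A + B"
    then have "mset (k # ks) = A + add_mset k B" by simp
    from Cons.prems[OF this] show "\<not> int N dvd x - int (\<kappa> k) + (\<Sum>i\<in>#A. int (\<kappa> i)) - (\<Sum>i\<in>#B. int (\<kappa> i))"
      by (simp add: algebra_simps)
  qed
  finally show ?case by simp
qed

text \<open>Expanding the power one factor at a time, \<open>ks\<close> collects the modes chosen so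
  far. Once no factor is left, the coefficient is a lattice sum of cosines, which vanishes unless
  the collected modes are admissible.\<close>

lemma modal_lattice_power:
  fixes \<kappa> :: "'n::finite \<Rightarrow> nat" and b :: "'n \<Rightarrow> real"
  defines "C \<equiv> \<lambda>j k. cos ((2 * real j + 1) * real (\<kappa> k) * pi / real (2 * CARD('n) + 2))"
  shows "modal {ls. length ls = d \<and> admissible \<kappa> (mset ks + mset ls)}
    (\<lambda>z. \<Sum>j<2 * CARD('n) + 2. (\<Prod>k\<leftarrow>ks. C j k) * (\<Sum>i\<in>UNIV. C j i * (b i * fst z $ i)) ^ d)"
proof (induction d arbitrary: ks)
  case 0
  show ?case
  proof (cases "admissible \<kappa> (mset ks)")
    case True
    then show ?thesis by (simp add: modal.const)
  next
    case False
    have "(\<Sum>j<2 * CARD('n) + 2. cos ((2 * real j + 1) * of_int 0 * pi / real (2 * CARD('n) + 2)) *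
        (\<Prod>k\<leftarrow>ks. C j k)) = 0"
      unfolding C_def by (rule sum_cos_products) (use False in \<open>auto simp: admissible_def\<close>)
    then show ?thesis by (simp add: modal.zero)
  qed
next
  case (Suc d)
  let ?S = "\<lambda>j z. \<Sum>i\<in>UNIV. C j i * (b i * fst z $ i)"
  have "modal {ls. length ls = Suc d \<and> admissible \<kappa> (mset ks + mset ls)}
    (\<lambda>z. \<Sum>i\<in>UNIV. (b i * fst z $ i + 0 * snd z $ i) * (\<Sum>j<2 * CARD('n) + 2. (\<Prod>k\<leftarrow>i # ks. C j k) * ?S j z ^ d))"
    by (intro modal_sum modal_mult'[OF Suc.IH]) simp
  moreover have "(\<Sum>i\<in>UNIV. (b i * fst z $ i + 0 * snd z $ i) * (\<Sum>j<2 * CARD('n) + 2. (\<Prod>k\<leftarrow>i # ks. C j k) * ?S j z ^ d))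
    = (\<Sum>j<2 * CARD('n) + 2. (\<Prod>k\<leftarrow>ks. C j k) * ?S j z ^ Suc d)" for z
  proof -
    have "(\<Sum>i\<in>UNIV. a i * (\<Sum>j<M. (c j i * p j) * q j)) = (\<Sum>j<M. p j * ((\<Sum>i\<in>UNIV. c j i * a i) * q j))"
      for a :: "'n \<Rightarrow> real" and c p q and M :: nat
      by (simp add: sum_distrib_left sum_distrib_right mult_ac) (rule sum.swap)
    note this[of "\<lambda>i. b i * fst z $ i" C "\<lambda>j. \<Prod>k\<leftarrow>ks. C j k" "\<lambda>j. ?S j z ^ d" "2 * CARD('n) + 2"]
    then show ?thesis by (simp only: list.map prod_list.Cons power_Suc mult_zero_left add_0_right)
  qed
  ultimately show ?case by (simp only:)
qed

context
  fixes \<kappa> :: "'n::finite \<Rightarrow> nat"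
  assumes \<kappa>: "bij_betw \<kappa> UNIV {1..CARD('n)}"
begin

lemma modal_fpu_power:
  "modal (admissible_lists \<kappa> d) (\<lambda>z. c * (\<Sum>j<2 * CARD('n) + 2. (mode_sum \<kappa> (fst z) (j + 1) - mode_sum \<kappa> (fst z) j) ^ d))"
proof -
  let ?r = "1 / sqrt (real CARD('n) + 1)"
  have "modal (admissible_lists \<kappa> d) (\<lambda>z. c * ?r ^ d * (\<Sum>j<2 * CARD('n) + 2.
     (\<Sum>i\<in>UNIV. cos ((2 * real j + 1) * real (\<kappa> i) * pi / real (2 * CARD('n) + 2)) * (Omega \<kappa> i * fst z $ i)) ^ d))"
    using modal_lattice_power[of d \<kappa> "[]" "Omega \<kappa>"] by (intro modal_cmult) simp
  moreover have "real (2 * CARD('n) + 2) = 2 * real CARD('n) + 2" by simp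
  ultimately show ?thesis
    unfolding mode_sum_diff[OF \<kappa>] by (simp only: power_mult_distrib sum_distrib_left[symmetric] mult.assoc)
qed

lemma Omega_pos: "Omega \<kappa> i > 0"
proof -
  have "1 \<le> \<kappa> i" "\<kappa> i \<le> CARD('n)" using wave_number_bounds[OF \<kappa>] by auto
  then have "0 < real (\<kappa> i) * pi / (2 * real CARD('n) + 2)" "real (\<kappa> i) / (2 * real CARD('n) + 2) < 1"
    by (auto simp: field_simps)
  moreover from this(2) have "pi * (real (\<kappa> i) / (2 * real CARD('n) + 2)) < pi * 1"
    by (rule mult_strict_left_mono) simp
  ultimately show ?thesis unfolding Omega_def by (simp add: sin_gt_zero mult.commute)
qed

section \<open>Eigencoordinates of the linear flow\<close>

definition normal_mode :: "'n \<times> real \<Rightarrow> 'n phase \<Rightarrow> complex" where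
  "normal_mode t z = Complex (snd z $ fst t) (snd t * Omega \<kappa> (fst t) * fst z $ fst t)"

definition normal_monomial :: "('n \<times> real) list \<Rightarrow> 'n phase \<Rightarrow> complex" where
  "normal_monomial ts z = (\<Prod>t\<leftarrow>ts. normal_mode t z)"

lemma normal_monomial_Cons: "normal_monomial (t # ts) z = normal_mode t z * normal_monomial ts z"
  by (simp add: normal_monomial_def)

definition signed :: "('n \<times> real) list \<Rightarrow> bool" where
  "signed ts \<longleftrightarrow> (\<forall>t\<in>set ts. snd t \<in> {1, -1})"

text \<open>For a signed list, the exponent of \<open>P + i Omega Q\<close> minus that of
  \<open>P - i Omega Q\<close> in mode \<open>k\<close>. If it vanishes for all \<open>k\<close>,
  the monomial is a product of doubled energies.\<close>

definition multiplicity_difference :: "'n \<Rightarrow> ('n \<times> real) list \<Rightarrow> real" where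
  "multiplicity_difference k ts = (\<Sum>t\<leftarrow>ts. if fst t = k then snd t else 0)"

definition frequency :: "('n \<times> real) list \<Rightarrow> real" where
  "frequency ts = (\<Sum>t\<leftarrow>ts. snd t * Omega \<kappa> (fst t))"

lemma multiplicity_difference_Cons:
  "multiplicity_difference k (t # ts) = (if fst t = k then snd t else 0) + multiplicity_difference k ts"
  by (simp add: multiplicity_difference_def)

lemma frequency_Cons: "frequency (t # ts) = snd t * Omega \<kappa> (fst t) + frequency ts"
  by (simp add: frequency_def)

lemma frequency_eq: "frequency ts = (\<Sum>k\<in>UNIV. Omega \<kappa> k * multiplicity_difference k ts)"
proof (induction ts)
  case (Cons t ts)
  have "(\<Sum>k\<in>UNIV. Omega \<kappa> k * (if fst t = k then snd t else 0)) = (\<Sum>k\<in>UNIV. if fst t = k then Omega \<kappa> k * snd t else 0)"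
    by (intro sum.cong refl) simp
  then have "(\<Sum>k\<in>UNIV. Omega \<kappa> k * (if fst t = k then snd t else 0)) = snd t * Omega \<kappa> (fst t)" by simp
  then show ?case
    using Cons by (simp only: frequency_Cons multiplicity_difference_Cons distrib_left sum.distrib)
qed (simp add: frequency_def multiplicity_difference_def)

lemma modal_normal_monomial: "modal {map fst ts} (\<lambda>z. Re (c * normal_monomial ts z))"
proof (induction ts arbitrary: c)
  case Nil
  then show ?case by (simp add: normal_monomial_def modal.const)
next
  case (Cons t ts)
  have "Re (c * normal_monomial (t # ts) z)
      = (0 * fst z $ fst t + 1 * snd z $ fst t) * Re (c * normal_monomial ts z)
      + (snd t * Omega \<kappa> (fst t) * fst z $ fst t + 0 * snd z $ fst t) * Re ((c * \<i>) * normal_monomial ts z)" for z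
    unfolding normal_monomial_Cons normal_mode_def by (simp add: algebra_simps)
  moreover have "modal {map fst (t # ts)} (\<lambda>z.
      (0 * fst z $ fst t + 1 * snd z $ fst t) * Re (c * normal_monomial ts z)
      + (snd t * Omega \<kappa> (fst t) * fst z $ fst t + 0 * snd z $ fst t) * Re ((c * \<i>) * normal_monomial ts z))"
    by (intro modal.add modal_mult'[OF Cons.IH]) simp_all
  ultimately show ?case by simp
qed

inductive normal_span :: "'n list set \<Rightarrow> ('n phase \<Rightarrow> real) \<Rightarrow> bool" for K where
  zero: "normal_span K (\<lambda>z. 0)"
| add: "normal_span K F \<Longrightarrow> map fst ts \<in> K \<Longrightarrow> signed ts \<Longrightarrow>
    normal_span K (\<lambda>z. F z + Re (c * normal_monomial ts z))"

lemma normal_span_plus: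
  assumes "normal_span K F" "normal_span K G"
  shows "normal_span K (\<lambda>z. F z + G z)"
  using assms(2)
proof induction
  case (add G ts c)
  then show ?case using normal_span.add[of K "\<lambda>z. F z + G z" ts c] by (simp add: add.assoc)
qed (use assms(1) in simp)

text \<open>A real linear factor is the real part of a multiple of an eigencoordinate, and a product
  of two real parts is again a sum of two real parts. Each real factor thus splits into both signs
  while the mode list stays the same.\<close>

lemma modal_normal_span: "modal K F \<Longrightarrow> normal_span K F"
proof (induction rule: modal.induct)
  case (const K c)
  then show ?case using normal_span.add[OF normal_span.zero, of "[]" K "of_real c"]
    by (simp add: normal_monomial_def signed_def)
next
  case (mult k K F a b)
  from mult.IH show ?case
  proof induction
    case zero
    then show ?case by (simp add: normal_span.zero)
  next
    case (add F ts c)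
    \<comment> \<open>Chosen so that the real part of \<open>w\<close> times
      \<open>P + i Omega Q\<close> is \<open>a Q + b P\<close>.\<close>
    define w where "w = Complex b (- a / Omega \<kappa> k)"
    have eq: "(a * fst z $ k + b * snd z $ k) * (F z + Re (c * normal_monomial ts z))
      = (a * fst z $ k + b * snd z $ k) * F z + Re (w * c / 2 * normal_monomial ((k, 1) # ts) z)
        + Re (cnj w * c / 2 * normal_monomial ((k, -1) # ts) z)" for z
    proof -
      let ?x = "w * normal_mode (k, 1) z" and ?y = "c * normal_monomial ts z"
      have "a * fst z $ k + b * snd z $ k = Re ?x"
        using Omega_pos[of k] by (simp add: w_def normal_mode_def)
      then have "(a * fst z $ k + b * snd z $ k) * (F z + Re ?y)
          = (a * fst z $ k + b * snd z $ k) * F z + Re ?x * Re ?y"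
        by (simp only: distrib_left)
      also have "Re ?x * Re ?y = Re (?x * ?y / 2) + Re (cnj ?x * ?y / 2)"
        by (simp add: field_simps)
      also have "?x * ?y / 2 = w * c / 2 * normal_monomial ((k, 1) # ts) z"
        unfolding normal_monomial_Cons by simp
      also have "cnj ?x = cnj w * normal_mode (k, -1) z"
        by (simp add: normal_mode_def complex_eq_iff)
      also have "cnj w * normal_mode (k, -1) z * ?y / 2 = cnj w * c / 2 * normal_monomial ((k, -1) # ts) z"
        unfolding normal_monomial_Cons by simp
      finally show ?thesis by (simp only: add.assoc)
    qed
    have "map fst ((k, 1) # ts) \<in> K" "map fst ((k, -1) # ts) \<in> K"
      "signed ((k, 1) # ts)" "signed ((k, -1) # ts)"
      using add.hyps by (auto simp: signed_def)
    then show ?case unfolding eq by (intro normal_span.add add.IH)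
  qed
next
  case (add K F G)
  then show ?case by (intro normal_span_plus)
qed (rule normal_span.zero)

lemma linear_energy_derivative:
  "(linear_energy \<kappa> k has_derivative (\<lambda>w. snd z $ k * snd w $ k + (Omega \<kappa> k)\<^sup>2 * (fst z $ k * fst w $ k))) (at z)"
proof -
  have "linear_energy \<kappa> k = (\<lambda>z. 1/2 * (snd z $ k * snd z $ k + (Omega \<kappa> k)\<^sup>2 * (fst z $ k * fst z $ k)))"
    by (rule ext) (simp add: linear_energy_def power2_eq_square)
  moreover have "bounded_linear (\<lambda>z::'n phase. snd z $ k)" "bounded_linear (\<lambda>z::'n phase. fst z $ k)"
    by (intro bounded_linear_compose[OF bounded_linear_vec_nth] bounded_linear_fst bounded_linear_snd)+
  note d = this[THEN bounded_linear_imp_has_derivative]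
  ultimately show ?thesis
    by (auto intro!: derivative_eq_intros d simp: algebra_simps)
qed

definition energy_vector :: "'n \<Rightarrow> 'n phase \<Rightarrow> 'n phase" where
  "energy_vector k z = (axis k (snd z $ k), - axis k ((Omega \<kappa> k)\<^sup>2 * fst z $ k))"

lemma poisson_bracket_energy:
  assumes "(F has_derivative F') (at z)"
  shows "poisson_bracket F (linear_energy \<kappa> k) z = F' (energy_vector k z)"
proof -
  have "hamiltonian_vector (\<lambda>w. snd z $ k * snd w $ k + (Omega \<kappa> k)\<^sup>2 * (fst z $ k * fst w $ k)) = energy_vector k z"
    by (auto simp: hamiltonian_vector_def energy_vector_def vec_eq_iff axis_def)
  then show ?thesis using poisson_bracket_eq[OF assms linear_energy_derivative] by simp
qed

lemma energies_commute: "poisson_bracket (linear_energy \<kappa> i) (linear_energy \<kappa> k) z = 0"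
  by (subst poisson_bracket_energy[OF linear_energy_derivative])
    (simp add: energy_vector_def axis_def)

text \<open>Each factor of mode \<open>k\<close> is an eigenvector of the flow of its energy, with
  eigenvalue its sign times \<open>i Omega\<close>; factors of other modes are constant along it.
  The product rule adds the eigenvalues.\<close>

lemma normal_monomial_derivative:
  assumes "signed ts"
  shows "\<exists>D. (normal_monomial ts has_derivative D) (at z) \<and>
    D (energy_vector k z) = \<i> * of_real (Omega \<kappa> k * multiplicity_difference k ts) * normal_monomial ts z"
  using assms
proof (induction ts)
  case Nil
  then show ?case
    by (auto simp: normal_monomial_def[abs_def] multiplicity_difference_def intro!: exI[of _ "\<lambda>_. 0"])
next
  case (Cons t ts)
  then obtain D where D: "(normal_monomial ts has_derivative D) (at z)"
    "D (energy_vector k z) = \<i> * of_real (Omega \<kappa> k * multiplicity_difference k ts) * normal_monomial ts z"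
    by (auto simp: signed_def)
  have "linear (normal_mode t)"
    by (rule linearI) (simp_all add: normal_mode_def complex_eq_iff algebra_simps)
  then have "(normal_mode t has_derivative normal_mode t) (at z)"
    by (intro bounded_linear_imp_has_derivative) (simp add: linear_conv_bounded_linear)
  from has_derivative_mult[OF this D(1)]
  have deriv: "(normal_monomial (t # ts) has_derivative
      (\<lambda>w. normal_mode t z * D w + normal_mode t w * normal_monomial ts z)) (at z)"
    by (simp add: normal_monomial_Cons[abs_def])
  have "normal_mode t (energy_vector k z) = \<i> * of_real (Omega \<kappa> k * (if fst t = k then snd t else 0)) * normal_mode t z"
    using Cons.prems by (auto simp: signed_def normal_mode_def energy_vector_def axis_def complex_eq_iff power2_eq_square)
  then have "normal_mode t z * D (energy_vector k z) + normal_mode t (energy_vector k z) * normal_monomial ts z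
      = \<i> * of_real (Omega \<kappa> k * multiplicity_difference k (t # ts)) * normal_monomial (t # ts) z"
    unfolding normal_monomial_Cons multiplicity_difference_Cons
    by (simp only: D(2) of_real_add of_real_mult distrib_left distrib_right mult_ac add_ac)
  with deriv show ?case by blast
qed

lemma poisson_bracket_normal_monomial:
  assumes "signed ts"
  shows "poisson_bracket (\<lambda>z. Re (c * normal_monomial ts z)) (linear_energy \<kappa> k) z
    = Re (c * \<i> * of_real (Omega \<kappa> k * multiplicity_difference k ts) * normal_monomial ts z)"
proof -
  obtain D where D: "(normal_monomial ts has_derivative D) (at z)"
    "D (energy_vector k z) = \<i> * of_real (Omega \<kappa> k * multiplicity_difference k ts) * normal_monomial ts z"
    using normal_monomial_derivative[OF assms] by blast
  have "((\<lambda>z. Re (c * normal_monomial ts z)) has_derivative (\<lambda>w. Re (c * D w))) (at z)"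
    by (intro bounded_linear.has_derivative[OF bounded_linear_Re] has_derivative_mult_right D)
  from poisson_bracket_energy[OF this] show ?thesis by (simp only: D(2) mult.assoc)
qed

lemma linear_energy_differentiable: "linear_energy \<kappa> k differentiable (at z)"
  using linear_energy_derivative differentiable_def by blast

lemma poisson_bracket_fpu_H2:
  "poisson_bracket F (fpu_H2 \<kappa>) z = (\<Sum>k\<in>UNIV. poisson_bracket F (linear_energy \<kappa> k) z)"
proof -
  have "finite A \<Longrightarrow> (\<lambda>z. \<Sum>k\<in>A. linear_energy \<kappa> k z) differentiable (at z) \<and>
    poisson_bracket F (\<lambda>z. \<Sum>k\<in>A. linear_energy \<kappa> k z) z = (\<Sum>k\<in>A. poisson_bracket F (linear_energy \<kappa> k) z)" for A
    by (induction A rule: finite_induct)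
      (simp_all add: poisson_bracket_antisym[of F "\<lambda>z. 0"] poisson_bracket_const poisson_bracket_add_right
        linear_energy_differentiable differentiable_add)
  from this[of UNIV] show ?thesis by (simp add: fpu_H2_def[abs_def])
qed

lemma poisson_bracket_fpu_H2_monomial:
  assumes "signed ts"
  shows "poisson_bracket (\<lambda>z. Re (c * normal_monomial ts z)) (fpu_H2 \<kappa>) z
    = Re (c * \<i> * of_real (frequency ts) * normal_monomial ts z)"
  unfolding poisson_bracket_fpu_H2 poisson_bracket_normal_monomial[OF assms] frequency_eq
  by (simp only: Re_sum[symmetric] of_real_sum sum_distrib_left sum_distrib_right)

section \<open>The homological equation and the exclusion of resonances\<close>

definition resonant_lists :: "'n list set" where
  "resonant_lists = {map fst ts |ts. signed ts \<and> frequency ts = 0}"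

text \<open>Nonresonant monomials are removed by dividing by their eigenvalue under the bracket with
  \<open>fpu_H2\<close>; resonant ones are collected in \<open>R\<close>, and \<open>trivial\<close>
  lets them commute with every energy. The mode lists of \<open>R\<close> are recorded so that
  \<open>R\<close> must vanish when no list is resonant.\<close>

lemma homological_equation:
  assumes "modal K F"
    and trivial: "\<And>ts k. map fst ts \<in> K \<Longrightarrow> signed ts \<Longrightarrow> frequency ts = 0 \<Longrightarrow> multiplicity_difference k ts = 0"
  shows "\<exists>S R. modal K S \<and> modal (K \<inter> resonant_lists) R \<and>
    (\<forall>z. F z + poisson_bracket (fpu_H2 \<kappa>) S z = R z) \<and> (\<forall>k z. poisson_bracket R (linear_energy \<kappa> k) z = 0)"
  using modal_normal_span[OF assms(1)]
proof induction
  case zero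
  show ?case
    by (intro exI[of _ "\<lambda>z. 0"]) (simp add: modal.zero poisson_bracket_const poisson_bracket_antisym[of _ "\<lambda>z. 0"])
next
  case (add F ts c)
  obtain S R where SR: "modal K S" "modal (K \<inter> resonant_lists) R"
    "\<And>z. F z + poisson_bracket (fpu_H2 \<kappa>) S z = R z" "\<And>k z. poisson_bracket R (linear_energy \<kappa> k) z = 0"
    using add.IH by blast
  have mono: "modal K (\<lambda>z. Re (c * normal_monomial ts z))" for c
    by (rule modal_mono[OF modal_normal_monomial]) (use add.hyps in simp)
  show ?case
  proof (cases "frequency ts = 0")
    case True
    have R': "modal (K \<inter> resonant_lists) (\<lambda>z. Re (c * normal_monomial ts z))"
      by (rule modal_mono[OF modal_normal_monomial]) (use add.hyps True in \<open>auto simp: resonant_lists_def\<close>)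
    have "poisson_bracket (\<lambda>z. R z + Re (c * normal_monomial ts z)) (linear_energy \<kappa> k) z = 0" for k z
      unfolding poisson_bracket_add_left[OF modal_differentiable[OF SR(2)] modal_differentiable[OF R']]
        SR(4) poisson_bracket_normal_monomial[OF add.hyps(3)] trivial[OF add.hyps(2,3) True] by simp
    moreover have "F z + Re (c * normal_monomial ts z) + poisson_bracket (fpu_H2 \<kappa>) S z
        = R z + Re (c * normal_monomial ts z)" for z
      using SR(3)[of z] by linarith
    ultimately show ?thesis using SR(1) modal.add[OF SR(2) R'] by blast
  next
    case False
    \<comment> \<open>Division by \<open>i\<close> times the frequency is the step that requires
      nonresonance. By antisymmetry, the bracket of \<open>fpu_H2\<close> with the new term cancels
      the monomial.\<close>
    define c' where "c' = c / (\<i> * of_real (frequency ts))"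
    have c': "c' * \<i> * of_real (frequency ts) = c" using False by (simp add: c'_def)
    have "poisson_bracket (fpu_H2 \<kappa>) (\<lambda>z. S z + Re (c' * normal_monomial ts z)) z
      = poisson_bracket (fpu_H2 \<kappa>) S z - Re (c * normal_monomial ts z)" for z
      unfolding poisson_bracket_add_right[OF modal_differentiable[OF SR(1)] modal_differentiable[OF mono]]
        poisson_bracket_antisym[of "fpu_H2 \<kappa>" "\<lambda>z. Re (c' * normal_monomial ts z)"]
        poisson_bracket_fpu_H2_monomial[OF add.hyps(3)] c' by simp
    then have "F z + Re (c * normal_monomial ts z)
        + poisson_bracket (fpu_H2 \<kappa>) (\<lambda>z. S z + Re (c' * normal_monomial ts z)) z = R z" for z
      using SR(3)[of z] by (simp only:)
    then show ?thesis using modal.add[OF SR(1) mono] SR(2,4) by blast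
  qed
qed

lemma frequency_three:
  assumes "map fst ts \<in> admissible_lists \<kappa> 3" "signed ts"
  shows "frequency ts \<noteq> 0"
proof -
  obtain k1 s1 k2 s2 k3 s3 where ts: "ts = [(k1, s1), (k2, s2), (k3, s3)]"
    using assms(1) by (auto simp: eval_nat_numeral length_Suc_conv)
  obtain A B where AB: "mset (map fst ts) = A + B"
    "int (2 * CARD('n) + 2) dvd (\<Sum>i\<in>#A. int (\<kappa> i)) - (\<Sum>i\<in>#B. int (\<kappa> i))"
    using assms(1) unfolding admissible_def by auto
  from signs_of_partition[OF AB(1), of \<kappa>]
  obtain es where es: "length es = length (map fst ts)" "set es \<subseteq> {1, -1}"
    "(\<Sum>(e, k)\<leftarrow>zip es (map fst ts). e * int (\<kappa> k)) = (\<Sum>i\<in>#A. int (\<kappa> i)) - (\<Sum>i\<in>#B. int (\<kappa> i))"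
    by blast
  then obtain e1 e2 e3 where e: "es = [e1, e2, e3]" by (auto simp: ts length_Suc_conv)
  have b: "0 < \<kappa> k" "2 * \<kappa> k < 2 * CARD('n) + 2" for k using wave_number_bounds[OF \<kappa>, of k] by auto
  have "s1 * sin (real (\<kappa> k1) * pi / real (2 * CARD('n) + 2)) + s2 * sin (real (\<kappa> k2) * pi / real (2 * CARD('n) + 2))
     + s3 * sin (real (\<kappa> k3) * pi / real (2 * CARD('n) + 2)) \<noteq> 0"
    by (rule three_wave_nonresonance[OF b b b, of e1 e2 e3])
      (use es assms(2) AB(2) in \<open>auto simp: e ts signed_def add.assoc\<close>)
  then show ?thesis by (simp add: ts frequency_def Omega_def algebra_simps)
qed

text \<open>The modes cancel in pairs of equal wave number and opposite sign. Injectivity of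
  \<kappa> makes the paired modes themselves equal, so they contribute zero.\<close>

lemma frequency_four:
  assumes "map fst ts \<in> admissible_lists \<kappa> 4" "signed ts" "frequency ts = 0"
  shows "multiplicity_difference k ts = 0"
proof -
  obtain k1 s1 k2 s2 k3 s3 k4 s4 where ts: "ts = [(k1, s1), (k2, s2), (k3, s3), (k4, s4)]"
    using assms(1) by (auto simp: eval_nat_numeral length_Suc_conv)
  obtain A B where AB: "mset (map fst ts) = A + B"
    "int (2 * CARD('n) + 2) dvd (\<Sum>i\<in>#A. int (\<kappa> i)) - (\<Sum>i\<in>#B. int (\<kappa> i))"
    using assms(1) unfolding admissible_def by auto
  from signs_of_partition[OF AB(1), of \<kappa>]
  obtain es where es: "length es = length (map fst ts)" "set es \<subseteq> {1, -1}"
    "(\<Sum>(e, k)\<leftarrow>zip es (map fst ts). e * int (\<kappa> k)) = (\<Sum>i\<in>#A. int (\<kappa> i)) - (\<Sum>i\<in>#B. int (\<kappa> i))"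
    by blast
  then obtain e1 e2 e3 e4 where e: "es = [e1, e2, e3, e4]" by (auto simp: ts length_Suc_conv)
  have b: "0 < \<kappa> k" "2 * \<kappa> k < 2 * CARD('n) + 2" for k using wave_number_bounds[OF \<kappa>, of k] by auto
  have "2 * (s1 * sin (real (\<kappa> k1) * pi / real (2 * CARD('n) + 2)) + s2 * sin (real (\<kappa> k2) * pi / real (2 * CARD('n) + 2))
     + s3 * sin (real (\<kappa> k3) * pi / real (2 * CARD('n) + 2)) + s4 * sin (real (\<kappa> k4) * pi / real (2 * CARD('n) + 2))) = 0"
    using assms(3) by (simp add: ts frequency_def Omega_def algebra_simps)
  then have "\<kappa> k1 = \<kappa> k2 \<and> s1 = - s2 \<and> \<kappa> k3 = \<kappa> k4 \<and> s3 = - s4 \<or> \<kappa> k1 = \<kappa> k3 \<and> s1 = - s3 \<and> \<kappa> k2 = \<kappa> k4 \<and> s2 = - s4 \<or>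
    \<kappa> k1 = \<kappa> k4 \<and> s1 = - s4 \<and> \<kappa> k2 = \<kappa> k3 \<and> s2 = - s3"
    by (intro four_wave_resonance[OF b b b b, of e1 e2 e3 e4])
      (use es assms(2) AB(2) in \<open>auto simp: e ts signed_def add.assoc\<close>)
  then show ?thesis unfolding wave_number_eq[OF \<kappa>]
    by (auto simp: ts multiplicity_difference_def)
qed

lemma quadratic_hamiltonian_fpu_H2:
  "quadratic_hamiltonian (\<lambda>z w. \<Sum>i\<in>UNIV. snd z $ i * snd w $ i + (Omega \<kappa> i)\<^sup>2 * (fst z $ i * fst w $ i)) (fpu_H2 \<kappa>)"
proof (rule quadratic_hamiltonian.intro)
  show "bounded_bilinear (\<lambda>z w::'n phase. \<Sum>i\<in>UNIV. snd z $ i * snd w $ i + (Omega \<kappa> i)\<^sup>2 * (fst z $ i * fst w $ i))"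
    unfolding bilinear_conv_bounded_bilinear[symmetric] bilinear_def linear_iff
    by (auto simp: sum_distrib_left algebra_simps simp flip: sum.distrib)
  show "fpu_H2 \<kappa> z = (\<Sum>i\<in>UNIV. snd z $ i * snd z $ i + (Omega \<kappa> i)\<^sup>2 * (fst z $ i * fst z $ i)) / 2" for z
    by (simp add: fpu_H2_def linear_energy_def power2_eq_square sum_divide_distrib)
  have "homog 2 (\<lambda>z. \<Sum>i\<in>UNIV. (0 * fst z $ i + 1 * snd z $ i) * ((0 * fst z $ i + 1 * snd z $ i) * (1/2)) +
      ((Omega \<kappa> i)\<^sup>2 * fst z $ i + 0 * snd z $ i) * ((1 * fst z $ i + 0 * snd z $ i) * (1/2)))"
    by (intro modal_sum modal.add modal.mult modal.const) simp_all
  moreover have "fpu_H2 \<kappa> z = (\<Sum>i\<in>UNIV. (0 * fst z $ i + 1 * snd z $ i) * ((0 * fst z $ i + 1 * snd z $ i) * (1/2)) +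
      ((Omega \<kappa> i)\<^sup>2 * fst z $ i + 0 * snd z $ i) * ((1 * fst z $ i + 0 * snd z $ i) * (1/2)))" for z
    by (simp add: fpu_H2_def linear_energy_def power2_eq_square algebra_simps)
  ultimately show "homog 2 (fpu_H2 \<kappa>)" by presburger
qed (simp add: mult.commute)

text \<open>The quartic terms created by eliminating the cubic part thus obey the same selection
  rule as \<open>fpu_H4\<close>, and the four-wave result applies to them.\<close>

lemma modal_bracket_admissible:
  assumes "modal (admissible_lists \<kappa> 3) F" "modal (admissible_lists \<kappa> 3) G"
  shows "modal (admissible_lists \<kappa> 4) (poisson_bracket F G)"
proof (rule modal_poisson_bracket[OF assms])
  fix i ks ls
  assume "ks \<in> remove_mode i (admissible_lists \<kappa> 3)" "ls \<in> remove_mode i (admissible_lists \<kappa> 3)"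
  then obtain ks' ls' where k: "length ks' = 3" "admissible \<kappa> (mset ks')" "mset ks' = add_mset i (mset ks)"
    "length ls' = 3" "admissible \<kappa> (mset ls')" "mset ls' = add_mset i (mset ls)"
    by (auto simp: remove_mode_def)
  have "length ks = 2" "length ls = 2"
    using k(1,4) arg_cong[OF k(3), of size] arg_cong[OF k(6), of size] by auto
  then show "ks @ ls \<in> admissible_lists \<kappa> 4"
    using admissible_contract[of \<kappa> i "mset ks" "mset ls"] k by simp
qed

end

section \<open>Normalization at degree three and then at degree four\<close>

theorem corollary7p3:
  fixes \<alpha> \<beta> :: real and \<kappa> :: "'n::finite \<Rightarrow> nat"
  assumes "bij_betw \<kappa> UNIV {1..CARD('n)}"
  shows "\<exists>H4bar.
     homogeneous_polynomial 4 H4bar \<and>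
     birkhoff_normal_form (fpu_H2 \<kappa>) (fpu_H \<alpha> \<beta> \<kappa>) 4 (\<lambda>z. fpu_H2 \<kappa> z + H4bar z) \<and>
     (\<forall>i k z. poisson_bracket (linear_energy \<kappa> i) (linear_energy \<kappa> k) z = 0) \<and>
     (\<forall>k z. poisson_bracket (\<lambda>z. fpu_H2 \<kappa> z + H4bar z) (linear_energy \<kappa> k) z = 0)"
proof -
  interpret quadratic_hamiltonian
    "\<lambda>z w. \<Sum>i\<in>UNIV. snd z $ i * snd w $ i + (Omega \<kappa> i)\<^sup>2 * (fst z $ i * fst w $ i)" "fpu_H2 \<kappa>"
    by (rule quadratic_hamiltonian_fpu_H2[OF assms])
  let ?H = "fpu_H \<alpha> \<beta> \<kappa>" and ?H2 = "fpu_H2 \<kappa>" and ?H3 = "fpu_H3 \<alpha> \<kappa>" and ?H4 = "fpu_H4 \<beta> \<kappa>"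
  have H3: "modal (admissible_lists \<kappa> 3) ?H3" and H4: "modal (admissible_lists \<kappa> 4) ?H4"
    unfolding fpu_H3_def[abs_def] fpu_H4_def[abs_def] by (rule modal_fpu_power[OF assms])+
  have homog: "homog d F" if "modal (admissible_lists \<kappa> d) F" for d F
    by (rule modal_mono[OF that]) auto
  obtain S3 R3 where S3: "modal (admissible_lists \<kappa> 3) S3" "\<And>z. ?H3 z + poisson_bracket ?H2 S3 z = R3 z"
      "modal (admissible_lists \<kappa> 3 \<inter> resonant_lists \<kappa>) R3"
    using homological_equation[OF assms H3] frequency_three[OF assms] by blast
  \<comment> \<open>No admissible triple is resonant, so nothing of the cubic part remains.\<close>
  have "admissible_lists \<kappa> 3 \<inter> resonant_lists \<kappa> = {}"
    using frequency_three[OF assms] unfolding resonant_lists_def[OF assms] by blast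
  then have R3: "R3 z = 0" for z using modal_empty[OF S3(3)] by blast
  \<comment> \<open>Replacing the inner bracket by \<open>- 1 * ?H3 z\<close> makes the iterated
    bracket one of admissible cubic forms; in effect \<open>A4\<close> is \<open>?H4\<close> plus
    half the bracket of \<open>?H3\<close> with \<open>S3\<close>.\<close>
  have S3_eq: "poisson_bracket ?H2 S3 = (\<lambda>z. - 1 * ?H3 z)"
    using S3(2) R3 by (simp add: fun_eq_iff eq_neg_iff_add_eq_0 add.commute)
  define A4 where "A4 z = ?H4 z + poisson_bracket ?H3 S3 z + poisson_bracket (poisson_bracket ?H2 S3) S3 z / 2" for z
  have "modal (admissible_lists \<kappa> 4) (\<lambda>z. ?H4 z + poisson_bracket ?H3 S3 z + 1 / 2 * poisson_bracket (poisson_bracket ?H2 S3) S3 z)"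
    unfolding S3_eq
    by (intro modal.add modal_cmult modal_bracket_admissible[OF assms] H3 H4 S3(1) modal_cmult[OF H3])
  then have A4: "modal (admissible_lists \<kappa> 4) A4" by (simp add: A4_def[abs_def])
  obtain S4 R where S4: "modal (admissible_lists \<kappa> 4) S4" "\<And>z. A4 z + poisson_bracket ?H2 S4 z = R z"
      "modal (admissible_lists \<kappa> 4 \<inter> resonant_lists \<kappa>) R" "\<And>k z. poisson_bracket R (linear_energy \<kappa> k) z = 0"
    using homological_equation[OF assms A4] frequency_four[OF assms] by blast
  have R: "homog 4 R" by (rule modal_mono[OF S4(3)]) auto
  obtain \<Phi> where \<Phi>: "polynomial_symplectic \<Phi>" "\<And>B3 B4 H. homog 3 B3 \<Longrightarrow> homog 4 B4 \<Longrightarrow> jet4 ?H2 B3 B4 H \<Longrightarrow>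
     jet4 ?H2 (\<lambda>z. B3 z + poisson_bracket ?H2 S3 z)
       (\<lambda>z. B4 z + poisson_bracket B3 S3 z + poisson_bracket (poisson_bracket ?H2 S3) S3 z / 2) (H \<circ> \<Phi>)"
    using cubic_transformation[OF modal_power_sum[OF homog[OF S3(1)] order_refl]] by auto
  obtain \<Psi> where \<Psi>: "polynomial_symplectic \<Psi>" "\<And>B4 H. homog 4 B4 \<Longrightarrow> jet4 ?H2 (\<lambda>z. 0) B4 H \<Longrightarrow>
     jet4 ?H2 (\<lambda>z. 0) (\<lambda>z. B4 z + poisson_bracket ?H2 S4 z) (H \<circ> \<Psi>)"
    using quartic_transformation[OF modal_power_sum[OF homog[OF S4(1)] order_refl]] by auto
  have "jet4 ?H2 ?H3 ?H4 ?H" by (simp add: jet4_def fpu_H_def)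
  from \<Phi>(2)[OF homog[OF H3] homog[OF H4] this] have "jet4 ?H2 (\<lambda>z. 0) A4 (?H \<circ> \<Phi>)"
    by (simp add: S3(2) R3 A4_def[abs_def])
  from \<Psi>(2)[OF homog[OF A4] this] have "jet4 ?H2 (\<lambda>z. 0) R (?H \<circ> (\<Phi> \<circ> \<Psi>))"
    by (simp add: S4(2) o_assoc)
  then have bigo: "(\<lambda>z. ?H ((\<Phi> \<circ> \<Psi>) z) - (?H2 z + R z)) \<in> O[nhds 0](\<lambda>z. norm z ^ (4 + 1))"
    by (simp add: jet4_def)
  have symp: "polynomial_symplectic (\<Phi> \<circ> \<Psi>)" by (rule polynomial_symplectic_comp[OF \<Phi>(1) \<Psi>(1)])
  \<comment> \<open>\<open>fpu_H2\<close> is the sum of the energies, and \<open>R\<close> commutes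
    with each of them.\<close>
  have R_H2: "poisson_bracket ?H2 R z = 0" for z
    unfolding poisson_bracket_antisym[of ?H2] poisson_bracket_fpu_H2[OF assms] by (simp add: S4(4))
  have H2_E: "poisson_bracket ?H2 (linear_energy \<kappa> k) z = 0" for k z
    unfolding poisson_bracket_antisym[of ?H2] poisson_bracket_fpu_H2[OF assms] by (simp add: energies_commute[OF assms])
  have "birkhoff_normal_form ?H2 ?H 4 (\<lambda>z. ?H2 z + R z)"
    unfolding birkhoff_normal_form_def
  proof (intro conjI exI)
    let ?Kr = "\<lambda>r::nat. if r = 4 then R else (\<lambda>z. 0)"
    have "{3..4} = {3, 4::nat}" by auto
    then show "(\<lambda>z. ?H2 z + R z) = (\<lambda>z. ?H2 z + (\<Sum>r=3..4. ?Kr r z))" by simp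
    show "\<forall>r\<in>{3..4}. homogeneous_polynomial r (?Kr r) \<and> (\<forall>z. poisson_bracket ?H2 (?Kr r) z = 0)"
      using homog_homogeneous_polynomial[OF R] homog_homogeneous_polynomial[OF modal.zero] R_H2
      by (auto simp: poisson_bracket_antisym[of ?H2 "\<lambda>z. 0"] poisson_bracket_const)
    show "0 \<in> (UNIV :: 'n phase set)" by simp
    show "symplectic_diffeo UNIV (\<Phi> \<circ> \<Psi>)" by (rule polynomial_symplectic_diffeo[OF symp])
    show "(\<Phi> \<circ> \<Psi>) 0 = 0" "((\<Phi> \<circ> \<Psi>) has_derivative id) (at 0)"
      using symp by (simp_all only: polynomial_symplectic_def)
    show "(\<lambda>z. ?H ((\<Phi> \<circ> \<Psi>) z) - (?H2 z + R z)) \<in> O[nhds 0](\<lambda>z. norm z ^ (4 + 1))" by (rule bigo)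
  qed
  moreover have "poisson_bracket (\<lambda>z. ?H2 z + R z) (linear_energy \<kappa> k) z = 0" for k z
    by (simp add: poisson_bracket_add_left modal_differentiable[OF A2_homog] modal_differentiable[OF R] H2_E S4(4))
  ultimately show ?thesis
    using homog_homogeneous_polynomial[OF R] energies_commute[OF assms] by (intro exI[of _ R]) blast
qed

end
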